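(* The non-symmetric $\mathbf{Cat}$-enriched inverse $K$-theory multifunctor $\mathcal P:\Gamma\text{-}\mathbf{Cat}\to\mathbf{PermCat}^{\mathsf{sus}}$ sends each monoid in $\Gamma\text{-}\mathbf{Cat}$ to a tight ring category. That is, for each monoid $(X,\mu,\eta)$ in $(\Gamma\text{-}\mathbf{Cat},\wedge,J)$, the permutative category $\mathcal P X$, with multiplication $\otimes=\mathcal P\mu:\mathcal P X\times\mathcal P X\to\mathcal P X$, multiplicative unit $\mathcal P\eta\in\mathcal P X$, and factorization morphisms $\partial^l=(\mathcal P\mu)^2_1$ and $\partial^r=(\mathcal P\mu)^2_2$ (the two linearity constraints of the bilinear functor $\mathcal P\mu$), is a tight ring category.
   Context: **The category $\mathcal F$.** Write $\underline n=\{0,1,\dots,n\}$ (basepoint $0$) and $\overline n=\{1,\dots,n\}$ ($\overline 0=\emptyset$). $\mathcal F$ has objects $\underline n$, $n\ge0$, and pointed maps. It is permutative under smash product, $\underline m\wedge\underline n=\underline{mn}$ via the lexicographic bijection $(x,y)\mapsto n(x-1)+y$ for $x,y>0$, with strict unit $\underline 1$. This also identifies $\overline m\times\overline n$ with $\overline{mn}$. **Monoids in $\Gamma\text{-}\mathbf{Cat}$.** A $\Gamma$-category is a functor $X:\mathcal F\to\mathbf{Cat}$ (small categories) with $X\underline 0=\mathbf 1$ the terminal category; each $X\underline n$ is pointed, with basepoint $*$ the image of $X\underline 0\to X\underline n$. $\Gamma\text{-}\mathbf{Cat}$ is symmetric monoidal under Day convolution $\wedge$ of pointed diagrams, with unit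 $J$, $J\underline n=\underline n$ (discrete). A monoid $(X,\mu:X\wedge X\to X,\eta:J\to X)$ is equivalently: a $\Gamma$-category $X$; pointed functors $\mu:X\underline m\wedge X\underline n\to X\underline{mn}$ (smash product of pointed categories) natural in $\underline m,\underline n\in\mathcal F$; and an object $\eta\in X\underline 1$; such that $\mu(\mu(x,y),z)=\mu(x,\mu(y,z))$ and $\mu(\eta,x)=x=\mu(x,\eta)$, on objects and (with $1_\eta$) on morphisms. **The permutative category $\mathcal P X$.** A permutative category is a symmetric monoidal category with identity associativity and unit isomorphisms. The category $\mathcal A$ has as objects finite (possibly empty) sequences $m=(m_1,\dots,m_p)$ of positive integers. A morphism $\phi:m\to n=(n_1,\dots,n_q)$ is a map of sets $\coprod_i\overline{m_i}\to\coprod_j\overline{n_j}$ such that for each $j$ the preimage of $\overline{n_j}$ is empty or contained in a single $\overline{m_i}$. The functor $AX:\mathcal A\to\mathbf{Cat}$ has $(AX)(m)=\prod_{i=1}^pX\underline{m_i}$ (and $\mathbf 1$ if $p=0$). For $\phi:m\to n$, the $j$-th coordinate of $\phi_*=(AX)(\phi)$ is constant at the basepoint of $X\underline{n_j}$ if $\phi^{-1}(\overline{n_j})=\emptyset$; if $\emptyset\ne\phi^{-1}(\overline{n_j})\subset\overline{m_i}$, it is projection to $X\underline{m_i}$ followed by $X\phi_{i,j}$, where $\phi_{i,j}:\underline{m_i}\to\underline{n_j}$ is $\phi$ on $\phi^{-1}(\overline{n_j})$ and $0$ elsewhere. $\mathcal P X=\int_{\mathcal A}AX$ is the Grothendieck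 construction: objects are pairs $(m,x)$ with $x=(x_1,\dots,x_p)\in(AX)(m)$; morphisms $(m,x)\to(n,y)$ are pairs $(\phi:m\to n,\ f:\phi_*x\to y)$; $(\psi,g)(\phi,f)=(\psi\phi,\,g\circ\psi_*f)$. It is permutative under concatenation $(m,x)\oplus(n,y)=((m,n),(x,y))$, with unit $((),* )$ and braiding $(\tau,1)$, $\tau$ the block swap. **$\mathcal P\eta$, $\mathcal P\mu$ and its linearity constraints.** $\mathcal P\eta$ is the object $((1),\eta)$ of $\mathcal P X$. On objects $(m,x),(n,y)$ of $\mathcal P X$ of lengths $p,q$, $(\mathcal P\mu)((m,x),(n,y))$ is the pair of sequences of length $pq$ whose entries at index $(i,j)$, $1\le i\le p$, $1\le j\le q$, are $m_in_j$ and $\mu(x_i,y_j)\in X\underline{m_in_j}$; the indices are ordered reverse lexicographically, i.e. $(i,j)$ is in position $i+p(j-1)$. On morphisms $(\phi^1,f^1):(m,x)\to(m',x')$ and $(\phi^2,f^2):(n,y)\to(n',y')$, $\mathcal P\mu$ gives $(\phi,f)$ with $\phi(a_1,a_2)=(\phi^1(a_1),\phi^2(a_2))$ (under $\overline{m_in_j}\cong\overline{m_i}\times\overline{n_j}$) and $f$ having $(i,j)$-component $\mu(f^1_i,f^2_j)$. The linearity constraints $$(\mathcal P\mu)^2_1:(A\otimes C)\oplus(B\otimes C)\to(A\oplus B)\otimes C,\qquad(\mathcal P\mu)^2_2:(A\otimes B)\oplus(A\otimes C)\to A\otimes(B\oplus C)$$ (with $\otimes=\mathcal P\mu$) are of the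 form $(\sigma,1)$, where the second component is an identity and $\sigma$ is the block permutation in $\mathcal A$ defined as follows, mapping each block identically onto its image block. For $(\mathcal P\mu)^2_1$, with $p$ the length of $A$, $\sigma$ sends block $(i,j)$ of $A\otimes C$ to block $(i,j)$ of $(A\oplus B)\otimes C$ and block $(i,j)$ of $B\otimes C$ to block $(p+i,j)$. For $(\mathcal P\mu)^2_2$, with $q$ the length of $B$, $\sigma$ sends block $(i,j)$ of $A\otimes B$ to block $(i,j)$ of $A\otimes(B\oplus C)$ and block $(i,j)$ of $A\otimes C$ to block $(i,q+j)$. **Ring categories.** A ring category $(\mathsf C,(\oplus,\mathbf 0,\xi),(\otimes,\mathbb 1),(\partial^l,\partial^r))$ consists of a permutative category $(\mathsf C,\oplus,\mathbf 0,\xi)$, a strict monoidal category $(\mathsf C,\otimes,\mathbb 1)$ on the same underlying category, and natural transformations $$\partial^l_{A,B,C}:(A\otimes C)\oplus(B\otimes C)\to(A\oplus B)\otimes C,\qquad\partial^r_{A,B,C}:(A\otimes B)\oplus(A\otimes C)\to A\otimes(B\oplus C),$$ such that for all objects (writing $\otimes$ as juxtaposition): 1. Multiplicative zero: $\mathbf 0\otimes A=\mathbf 0=A\otimes\mathbf 0$ and $1_{\mathbf 0}\otimes f=1_{\mathbf 0}=f\otimes1_{\mathbf 0}$ for all objects $A$ and morphisms $f$. 2. Zero factorization: $\partial^l_{\mathbf 0,B,C}=1_{BC}$, $\partial^l_{A,\mathbf 0,C}=1_{AC}$, $\partial^l_{A,B,\mathbf 0}=1_{\mathbf 0}$, $\partial^r_{\mathbf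 0,B,C}=1_{\mathbf 0}$, $\partial^r_{A,\mathbf 0,C}=1_{AC}$, $\partial^r_{A,B,\mathbf 0}=1_{AB}$. 3. Unit factorization: $\partial^l_{A,B,\mathbb 1}=1_{A\oplus B}$, $\partial^r_{\mathbb 1,B,C}=1_{B\oplus C}$. 4. Symmetry factorization: $(\xi_{A,B}\otimes1_C)\,\partial^l_{A,B,C}=\partial^l_{B,A,C}\,\xi_{AC,BC}$ and $(1_A\otimes\xi_{B,C})\,\partial^r_{A,B,C}=\partial^r_{A,C,B}\,\xi_{AB,AC}$. 5. Internal factorization: $\partial^l_{A\oplus A',A'',B}(\partial^l_{A,A',B}\oplus1)=\partial^l_{A,A'\oplus A'',B}(1\oplus\partial^l_{A',A'',B})$ and $\partial^r_{A,B\oplus B',B''}(\partial^r_{A,B,B'}\oplus1)=\partial^r_{A,B,B'\oplus B''}(1\oplus\partial^r_{A,B',B''})$. 6. External factorization: $\partial^l_{A,A',BC}=(\partial^l_{A,A',B}\otimes1_C)\,\partial^l_{AB,A'B,C}$; $(\partial^r_{A,B,B'}\otimes1_C)\,\partial^l_{AB,AB',C}=(1_A\otimes\partial^l_{B,B',C})\,\partial^r_{A,BC,B'C}$; $\partial^r_{AB,C,C'}=(1_A\otimes\partial^r_{B,C,C'})\,\partial^r_{A,BC,BC'}$. 7. 2-by-2 factorization: $\partial^l_{A,A',B\oplus B'}(\partial^r_{A,B,B'}\oplus\partial^r_{A',B,B'})=\partial^r_{A\oplus A',B,B'}(\partial^l_{A,A',B}\oplus\partial^l_{A,A',B'})(1\oplus\xi\oplus1)$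 as morphisms $AB\oplus AB'\oplus A'B\oplus A'B'\to(A\oplus A')(B\oplus B')$. A ring category is tight if $\partial^l$ and $\partial^r$ are natural isomorphisms. *)

theory Defs
  imports "HOL-Library.FuncSet"
begin

section \<open>Categories and functors\<close>

record ('o, 'm) cat =
  obj :: "'o set"
  arr :: "'m set"
  src :: "'m \<Rightarrow> 'o"
  tgt :: "'m \<Rightarrow> 'o"
  idt :: "'o \<Rightarrow> 'm"
  cmp :: "'m \<Rightarrow> 'm \<Rightarrow> 'm"  (infixr "\<cdot>\<index>" 55)

definition hom :: "('o, 'm) cat \<Rightarrow> 'o \<Rightarrow> 'o \<Rightarrow> 'm set" where
  "hom \<C> a b = {f \<in> arr \<C>. src \<C> f = a \<and> tgt \<C> f = b}"

locale category =
  fixes \<C> :: "('o, 'm) cat" (structure)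
  assumes src_obj: "f \<in> arr \<C> \<Longrightarrow> src \<C> f \<in> obj \<C>"
    and tgt_obj: "f \<in> arr \<C> \<Longrightarrow> tgt \<C> f \<in> obj \<C>"
    and idt_hom: "a \<in> obj \<C> \<Longrightarrow> idt \<C> a \<in> hom \<C> a a"
    and cmp_hom: "\<lbrakk>f \<in> hom \<C> a b; g \<in> hom \<C> b c\<rbrakk> \<Longrightarrow> g \<cdot> f \<in> hom \<C> a c"
    and cmp_idt_left: "f \<in> hom \<C> a b \<Longrightarrow> idt \<C> b \<cdot> f = f"
    and cmp_idt_right: "f \<in> hom \<C> a b \<Longrightarrow> f \<cdot> idt \<C> a = f"
    and cmp_assoc: "\<lbrakk>f \<in> hom \<C> a b; g \<in> hom \<C> b c; h \<in> hom \<C> c d\<rbrakk>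
      \<Longrightarrow> h \<cdot> (g \<cdot> f) = (h \<cdot> g) \<cdot> f"

definition is_iso :: "('o, 'm) cat \<Rightarrow> 'm \<Rightarrow> bool" where
  "is_iso \<C> f \<longleftrightarrow> f \<in> arr \<C> \<and>
     (\<exists>g \<in> hom \<C> (tgt \<C> f) (src \<C> f).
        cmp \<C> g f = idt \<C> (src \<C> f) \<and> cmp \<C> f g = idt \<C> (tgt \<C> f))"

locale cat_functor = dom: category \<C> + cod: category \<D>
  for \<C> :: "('o, 'm) cat" and \<D> :: "('p, 'n) cat" +
  fixes Fo :: "'o \<Rightarrow> 'p" and Fa :: "'m \<Rightarrow> 'n"
  assumes Fo_obj: "a \<in> obj \<C> \<Longrightarrow> Fo a \<in> obj \<D>"
    and Fa_hom: "f \<in> hom \<C> a b \<Longrightarrow> Fa f \<in> hom \<D> (Fo a) (Fo b)"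
    and Fa_idt: "a \<in> obj \<C> \<Longrightarrow> Fa (idt \<C> a) = idt \<D> (Fo a)"
    and Fa_cmp: "\<lbrakk>f \<in> hom \<C> a b; g \<in> hom \<C> b c\<rbrakk>
      \<Longrightarrow> Fa (cmp \<C> g f) = cmp \<D> (Fa g) (Fa f)"

definition prod_cat :: "('o, 'm) cat \<Rightarrow> ('p, 'n) cat \<Rightarrow> ('o \<times> 'p, 'm \<times> 'n) cat" where
  "prod_cat \<C> \<D> =
    \<lparr>obj = obj \<C> \<times> obj \<D>,
     arr = arr \<C> \<times> arr \<D>,
     src = map_prod (src \<C>) (src \<D>),
     tgt = map_prod (tgt \<C>) (tgt \<D>),
     idt = map_prod (idt \<C>) (idt \<D>),
     cmp = (\<lambda>(g, g') (f, f'). (cmp \<C> g f, cmp \<D> g' f'))\<rparr>"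

definition list_prod_cat :: "('o, 'm) cat list \<Rightarrow> ('o list, 'm list) cat" where
  "list_prod_cat Cs =
    \<lparr>obj = {xs. list_all2 (\<lambda>\<C> x. x \<in> obj \<C>) Cs xs},
     arr = {fs. list_all2 (\<lambda>\<C> f. f \<in> arr \<C>) Cs fs},
     src = map2 src Cs,
     tgt = map2 tgt Cs,
     idt = map2 idt Cs,
     cmp = (\<lambda>gs fs. map (\<lambda>(\<C>, g, f). cmp \<C> g f) (zip Cs (zip gs fs)))\<rparr>"

definition terminal_cat :: "('o, 'm) cat \<Rightarrow> bool" where
  "terminal_cat \<C> \<longleftrightarrow> category \<C> \<and> (\<exists>!a. a \<in> obj \<C>) \<and> (\<exists>!f. f \<in> arr \<C>)"


section \<open>Functors to Cat and the Grothendieck construction\<close>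

text \<open>Data of a functor from a category with objects \<open>'b\<close> and arrows \<open>'s\<close> to small categories.
  All values \<open>fib F b\<close> live in common types \<open>'o\<close>, \<open>'m\<close>; this is no restriction, since one may
  pass to disjoint unions.  Equality of functors means agreement on the carriers.\<close>

record ('b, 's, 'o, 'm) diagram =
  fib :: "'b \<Rightarrow> ('o, 'm) cat"
  push_o :: "'s \<Rightarrow> 'o \<Rightarrow> 'o"
  push_a :: "'s \<Rightarrow> 'm \<Rightarrow> 'm"

locale cat_valued_functor = base: category \<B>
  for \<B> :: "('b, 's) cat" +
  fixes F :: "('b, 's, 'o, 'm) diagram"
  assumes fib_category: "b \<in> obj \<B> \<Longrightarrow> category (fib F b)"
    and push_functor: "\<phi> \<in> hom \<B> b c \<Longrightarrow>
      cat_functor (fib F b) (fib F c) (push_o F \<phi>) (push_a F \<phi>)"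
    and push_o_idt: "\<lbrakk>b \<in> obj \<B>; x \<in> obj (fib F b)\<rbrakk> \<Longrightarrow> push_o F (idt \<B> b) x = x"
    and push_a_idt: "\<lbrakk>b \<in> obj \<B>; f \<in> arr (fib F b)\<rbrakk> \<Longrightarrow> push_a F (idt \<B> b) f = f"
    and push_o_cmp: "\<lbrakk>\<phi> \<in> hom \<B> b c; \<psi> \<in> hom \<B> c d; x \<in> obj (fib F b)\<rbrakk>
      \<Longrightarrow> push_o F (cmp \<B> \<psi> \<phi>) x = push_o F \<psi> (push_o F \<phi> x)"
    and push_a_cmp: "\<lbrakk>\<phi> \<in> hom \<B> b c; \<psi> \<in> hom \<B> c d; f \<in> arr (fib F b)\<rbrakk>
      \<Longrightarrow> push_a F (cmp \<B> \<psi> \<phi>) f = push_a F \<psi> (push_a F \<phi> f)"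

text \<open>\<open>Gr x \<phi> f y\<close> is the morphism \<open>(\<phi>, f : \<phi>\<^sub>* x \<rightarrow> y)\<close>; \<open>x\<close> and \<open>y\<close> are recorded so that
  source and target are determined by the morphism.\<close>

datatype ('s, 'o, 'm) gr_arrow =
  Gr (gr_src: 'o) (gr_base: 's) (gr_fib: 'm) (gr_tgt: 'o)

definition grothendieck ::
    "('b, 's) cat \<Rightarrow> ('b, 's, 'o, 'm) diagram \<Rightarrow> ('b \<times> 'o, ('s, 'o, 'm) gr_arrow) cat" where
  "grothendieck \<B> F =
    \<lparr>obj = (SIGMA b : obj \<B>. obj (fib F b)),
     arr = {Gr x \<phi> f y | x \<phi> f y.
        \<phi> \<in> arr \<B> \<and> x \<in> obj (fib F (src \<B> \<phi>)) \<and> y \<in> obj (fib F (tgt \<B> \<phi>)) \<and>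
        f \<in> hom (fib F (tgt \<B> \<phi>)) (push_o F \<phi> x) y},
     src = (\<lambda>u. (src \<B> (gr_base u), gr_src u)),
     tgt = (\<lambda>u. (tgt \<B> (gr_base u), gr_tgt u)),
     idt = (\<lambda>(b, x). Gr x (idt \<B> b) (idt (fib F b) x) x),
     cmp = (\<lambda>v u. Gr (gr_src u)
        (cmp \<B> (gr_base v) (gr_base u))
        (cmp (fib F (tgt \<B> (gr_base v))) (gr_fib v) (push_a F (gr_base v) (gr_fib u)))
        (gr_tgt v))\<rparr>"


section \<open>The categories \<open>\<F>\<close> and \<open>\<A>\<close>\<close>

datatype ('i, 'e) set_map =
  SetMap (sm_src: 'i) (sm_fun: "'e \<Rightarrow> 'e") (sm_tgt: 'i)

text \<open>Objects \<open>i \<in> I\<close> with underlying sets \<open>U i\<close> and maps between them satisfying \<open>P\<close>.  Maps are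
  extensional, so that equality of arrows is equality of maps on \<open>U i\<close>.\<close>

definition concrete_cat ::
    "'i set \<Rightarrow> ('i \<Rightarrow> 'e set) \<Rightarrow> ('i \<Rightarrow> 'i \<Rightarrow> ('e \<Rightarrow> 'e) \<Rightarrow> bool) \<Rightarrow> ('i, ('i, 'e) set_map) cat" where
  "concrete_cat I U P =
    \<lparr>obj = I,
     arr = {SetMap i f j | i f j. i \<in> I \<and> j \<in> I \<and> f \<in> U i \<rightarrow>\<^sub>E U j \<and> P i j f},
     src = sm_src,
     tgt = sm_tgt,
     idt = (\<lambda>i. SetMap i (\<lambda>u\<in>U i. u) i),
     cmp = (\<lambda>\<psi> \<phi>. SetMap (sm_src \<phi>) (compose (U (sm_src \<phi>)) (sm_fun \<psi>) (sm_fun \<phi>)) (sm_tgt \<psi>))\<rparr>"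

type_synonym F_arrow = "(nat, nat) set_map"
type_synonym A_arrow = "(nat list, nat \<times> nat) set_map"

definition F_cat :: "(nat, F_arrow) cat" where
  "F_cat = concrete_cat UNIV (\<lambda>n. {0..n}) (\<lambda>m n f. f 0 = 0)"

text \<open>Lexicographic bijection from \<open>{1..m} \<times> {1..n}\<close> to \<open>{1..m * n}\<close> and the components of
  its inverse.\<close>

definition lex :: "nat \<Rightarrow> nat \<Rightarrow> nat \<Rightarrow> nat" where
  "lex n x y = n * (x - 1) + y"

definition lex_fst :: "nat \<Rightarrow> nat \<Rightarrow> nat" where
  "lex_fst n c = (c - 1) div n + 1"

definition lex_snd :: "nat \<Rightarrow> nat \<Rightarrow> nat" where
  "lex_snd n c = (c - 1) mod n + 1"

definition F_smash :: "F_arrow \<Rightarrow> F_arrow \<Rightarrow> F_arrow" where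
  "F_smash \<phi> \<psi> = SetMap (sm_src \<phi> * sm_src \<psi>)
     (\<lambda>c\<in>{0..sm_src \<phi> * sm_src \<psi>}.
        if c = 0 then 0
        else let x = sm_fun \<phi> (lex_fst (sm_src \<psi>) c); y = sm_fun \<psi> (lex_snd (sm_src \<psi>) c)
             in if x = 0 \<or> y = 0 then 0 else lex (sm_tgt \<psi>) x y)
     (sm_tgt \<phi> * sm_tgt \<psi>)"

text \<open>The coproduct of the sets \<open>{1..m ! i}\<close>.  Block indices \<open>i\<close> are counted from \<open>0\<close>, elements of
  a block from \<open>1\<close> (\<open>0\<close> being the basepoint in \<open>F_cat\<close>).\<close>

definition blocks :: "nat list \<Rightarrow> (nat \<times> nat) set" where
  "blocks m = (SIGMA i : {..<length m}. {1..m ! i})"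

definition block_preimage :: "nat list \<Rightarrow> (nat \<times> nat \<Rightarrow> nat \<times> nat) \<Rightarrow> nat \<Rightarrow> (nat \<times> nat) set" where
  "block_preimage m f j = {u \<in> blocks m. fst (f u) = j}"

definition A_cat :: "(nat list, A_arrow) cat" where
  "A_cat = concrete_cat {m. \<forall>k \<in> set m. 0 < k} blocks
     (\<lambda>m n f. \<forall>j < length n. block_preimage m f j = {} \<or>
        (\<exists>i < length m. block_preimage m f j \<subseteq> {i} \<times> {1..m ! i}))"


section \<open>\<open>\<Gamma>\<close>-categories and their monoids\<close>

type_synonym ('o, 'm) gamma_diagram = "(nat, F_arrow, 'o, 'm) diagram"

definition basept :: "('o, 'm) gamma_diagram \<Rightarrow> nat \<Rightarrow> 'o" where
  "basept X n = push_o X (SetMap 0 (\<lambda>u\<in>{0..0}. 0) n) (THE a. a \<in> obj (fib X 0))"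

locale gamma_category = cat_valued_functor F_cat X
  for X :: "('o, 'm) gamma_diagram" +
  assumes fib_0_terminal: "terminal_cat (fib X 0)"

text \<open>A pointed functor out of the smash product of pointed categories is, by the defining universal
  property of the smash product (the quotient of the product collapsing the wedge), a functor out of
  the product which is constant at the basepoint on both summands of the wedge.\<close>

locale gamma_monoid = gamma_category X
  for X :: "('o, 'm) gamma_diagram" +
  fixes mu_o :: "nat \<Rightarrow> nat \<Rightarrow> 'o \<Rightarrow> 'o \<Rightarrow> 'o"
    and mu_a :: "nat \<Rightarrow> nat \<Rightarrow> 'm \<Rightarrow> 'm \<Rightarrow> 'm"
    and \<eta> :: 'o
  assumes mu_functor: "cat_functor (prod_cat (fib X m) (fib X n)) (fib X (m * n))
        (case_prod (mu_o m n)) (case_prod (mu_a m n))"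
    and mu_o_basept_right: "x \<in> obj (fib X m) \<Longrightarrow> mu_o m n x (basept X n) = basept X (m * n)"
    and mu_o_basept_left: "y \<in> obj (fib X n) \<Longrightarrow> mu_o m n (basept X m) y = basept X (m * n)"
    and mu_a_basept_right: "f \<in> arr (fib X m) \<Longrightarrow>
        mu_a m n f (idt (fib X n) (basept X n)) = idt (fib X (m * n)) (basept X (m * n))"
    and mu_a_basept_left: "g \<in> arr (fib X n) \<Longrightarrow>
        mu_a m n (idt (fib X m) (basept X m)) g = idt (fib X (m * n)) (basept X (m * n))"
    and mu_o_natural: "\<lbrakk>\<phi> \<in> hom F_cat m m'; \<psi> \<in> hom F_cat n n';
          x \<in> obj (fib X m); y \<in> obj (fib X n)\<rbrakk> \<Longrightarrow>
        mu_o m' n' (push_o X \<phi> x) (push_o X \<psi> y) = push_o X (F_smash \<phi> \<psi>) (mu_o m n x y)"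
    and mu_a_natural: "\<lbrakk>\<phi> \<in> hom F_cat m m'; \<psi> \<in> hom F_cat n n';
          f \<in> arr (fib X m); g \<in> arr (fib X n)\<rbrakk> \<Longrightarrow>
        mu_a m' n' (push_a X \<phi> f) (push_a X \<psi> g) = push_a X (F_smash \<phi> \<psi>) (mu_a m n f g)"
    and eta_obj: "\<eta> \<in> obj (fib X 1)"
    and mu_o_assoc: "\<lbrakk>x \<in> obj (fib X m); y \<in> obj (fib X n); z \<in> obj (fib X k)\<rbrakk> \<Longrightarrow>
        mu_o (m * n) k (mu_o m n x y) z = mu_o m (n * k) x (mu_o n k y z)"
    and mu_a_assoc: "\<lbrakk>f \<in> arr (fib X m); g \<in> arr (fib X n); h \<in> arr (fib X k)\<rbrakk> \<Longrightarrow>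
        mu_a (m * n) k (mu_a m n f g) h = mu_a m (n * k) f (mu_a n k g h)"
    and mu_o_unit_left: "x \<in> obj (fib X n) \<Longrightarrow> mu_o 1 n \<eta> x = x"
    and mu_o_unit_right: "x \<in> obj (fib X n) \<Longrightarrow> mu_o n 1 x \<eta> = x"
    and mu_a_unit_left: "f \<in> arr (fib X n) \<Longrightarrow> mu_a 1 n (idt (fib X 1) \<eta>) f = f"
    and mu_a_unit_right: "f \<in> arr (fib X n) \<Longrightarrow> mu_a n 1 f (idt (fib X 1) \<eta>) = f"


section \<open>The permutative category \<open>\<P> X\<close>\<close>

definition A_component :: "A_arrow \<Rightarrow> nat \<Rightarrow> nat \<Rightarrow> F_arrow" where
  "A_component \<phi> i j = SetMap (sm_src \<phi> ! i)
     (\<lambda>a\<in>{0..sm_src \<phi> ! i}. if a \<noteq> 0 \<and> fst (sm_fun \<phi> (i, a)) = j then snd (sm_fun \<phi> (i, a)) else 0)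
     (sm_tgt \<phi> ! j)"

text \<open>The \<open>i\<close> whose block contains the preimage of block \<open>j\<close>, if that preimage is nonempty.\<close>

definition A_index :: "A_arrow \<Rightarrow> nat \<Rightarrow> nat" where
  "A_index \<phi> j = (THE i. i < length (sm_src \<phi>) \<and>
     block_preimage (sm_src \<phi>) (sm_fun \<phi>) j \<subseteq> {i} \<times> {1..sm_src \<phi> ! i})"

definition A_diagram ::
    "('o, 'm) gamma_diagram \<Rightarrow> (nat list, A_arrow, 'o list, 'm list) diagram" where
  "A_diagram X =
    \<lparr>fib = (\<lambda>m. list_prod_cat (map (fib X) m)),
     push_o = (\<lambda>\<phi> xs. map (\<lambda>j.
        if block_preimage (sm_src \<phi>) (sm_fun \<phi>) j = {} then basept X (sm_tgt \<phi> ! j)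
        else push_o X (A_component \<phi> (A_index \<phi> j) j) (xs ! A_index \<phi> j))
        [0..<length (sm_tgt \<phi>)]),
     push_a = (\<lambda>\<phi> fs. map (\<lambda>j.
        if block_preimage (sm_src \<phi>) (sm_fun \<phi>) j = {}
        then idt (fib X (sm_tgt \<phi> ! j)) (basept X (sm_tgt \<phi> ! j))
        else push_a X (A_component \<phi> (A_index \<phi> j) j) (fs ! A_index \<phi> j))
        [0..<length (sm_tgt \<phi>)])\<rparr>"

type_synonym 'o P_obj = "nat list \<times> 'o list"
type_synonym ('o, 'm) P_arr = "(A_arrow, 'o list, 'm list) gr_arrow"

definition P_cat :: "('o, 'm) gamma_diagram \<Rightarrow> ('o P_obj, ('o, 'm) P_arr) cat" where
  "P_cat X = grothendieck A_cat (A_diagram X)"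

definition P_sum_o :: "'o P_obj \<Rightarrow> 'o P_obj \<Rightarrow> 'o P_obj" where
  "P_sum_o A B = (fst A @ fst B, snd A @ snd B)"

definition A_sum :: "A_arrow \<Rightarrow> A_arrow \<Rightarrow> A_arrow" where
  "A_sum \<phi> \<psi> = SetMap (sm_src \<phi> @ sm_src \<psi>)
     (\<lambda>(i, a)\<in>blocks (sm_src \<phi> @ sm_src \<psi>).
        if i < length (sm_src \<phi>) then sm_fun \<phi> (i, a)
        else let (j, b) = sm_fun \<psi> (i - length (sm_src \<phi>), a) in (length (sm_tgt \<phi>) + j, b))
     (sm_tgt \<phi> @ sm_tgt \<psi>)"

definition P_sum_a :: "('o, 'm) P_arr \<Rightarrow> ('o, 'm) P_arr \<Rightarrow> ('o, 'm) P_arr" where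
  "P_sum_a u v = Gr (gr_src u @ gr_src v) (A_sum (gr_base u) (gr_base v))
     (gr_fib u @ gr_fib v) (gr_tgt u @ gr_tgt v)"

definition P_zero :: "'o P_obj" where
  "P_zero = ([], [])"

text \<open>The morphism \<open>(\<sigma>, 1)\<close> mapping block \<open>i\<close> of the source identically to block \<open>s i\<close> of the
  target.\<close>

definition P_block :: "('o, 'm) gamma_diagram \<Rightarrow> (nat \<Rightarrow> nat) \<Rightarrow> 'o P_obj \<Rightarrow> 'o P_obj \<Rightarrow> ('o, 'm) P_arr" where
  "P_block X s A B = Gr (snd A)
     (SetMap (fst A) (\<lambda>(i, a)\<in>blocks (fst A). (s i, a)) (fst B))
     (idt (fib (A_diagram X) (fst B)) (snd B))
     (snd B)"

definition P_braid :: "('o, 'm) gamma_diagram \<Rightarrow> 'o P_obj \<Rightarrow> 'o P_obj \<Rightarrow> ('o, 'm) P_arr" where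
  "P_braid X A B = P_block X
     (\<lambda>i. let p = length (fst A); q = length (fst B) in if i < p then q + i else i - p)
     (P_sum_o A B) (P_sum_o B A)"


section \<open>\<open>\<P> \<mu>\<close>, \<open>\<P> \<eta>\<close> and the linearity constraints\<close>

definition P_unit :: "'o \<Rightarrow> 'o P_obj" where
  "P_unit \<eta> = ([1], [\<eta>])"

text \<open>Reverse lexicographic order on \<open>{..<p} \<times> {..<q}\<close>: the pair \<open>(i, j)\<close> is in position
  \<open>i + p * j\<close> (counted from \<open>0\<close>).\<close>

definition rlex :: "nat \<Rightarrow> nat \<Rightarrow> nat \<Rightarrow> nat" where
  "rlex p i j = i + p * j"

definition rlex_list :: "nat \<Rightarrow> nat \<Rightarrow> (nat \<Rightarrow> nat \<Rightarrow> 'c) \<Rightarrow> 'c list" where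
  "rlex_list p q h = map (\<lambda>k. h (k mod p) (k div p)) [0..<p * q]"

definition A_mult :: "nat list \<Rightarrow> nat list \<Rightarrow> nat list" where
  "A_mult m n = rlex_list (length m) (length n) (\<lambda>i j. m ! i * n ! j)"

definition P_mult_o :: "(nat \<Rightarrow> nat \<Rightarrow> 'o \<Rightarrow> 'o \<Rightarrow> 'o) \<Rightarrow> 'o P_obj \<Rightarrow> 'o P_obj \<Rightarrow> 'o P_obj" where
  "P_mult_o mu_o = (\<lambda>(m, x) (n, y).
     (A_mult m n,
      rlex_list (length m) (length n) (\<lambda>i j. mu_o (m ! i) (n ! j) (x ! i) (y ! j))))"

definition A_mult_arr :: "A_arrow \<Rightarrow> A_arrow \<Rightarrow> A_arrow" where
  "A_mult_arr \<phi> \<psi> = SetMap (A_mult (sm_src \<phi>) (sm_src \<psi>))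
     (\<lambda>(k, c)\<in>blocks (A_mult (sm_src \<phi>) (sm_src \<psi>)).
        let i = k mod length (sm_src \<phi>);
            j = k div length (sm_src \<phi>);
            (i', a) = sm_fun \<phi> (i, lex_fst (sm_src \<psi> ! j) c);
            (j', b) = sm_fun \<psi> (j, lex_snd (sm_src \<psi> ! j) c)
        in (rlex (length (sm_tgt \<phi>)) i' j', lex (sm_tgt \<psi> ! j') a b))
     (A_mult (sm_tgt \<phi>) (sm_tgt \<psi>))"

definition P_mult_a ::
    "(nat \<Rightarrow> nat \<Rightarrow> 'o \<Rightarrow> 'o \<Rightarrow> 'o) \<Rightarrow> (nat \<Rightarrow> nat \<Rightarrow> 'm \<Rightarrow> 'm \<Rightarrow> 'm) \<Rightarrow>
     ('o, 'm) P_arr \<Rightarrow> ('o, 'm) P_arr \<Rightarrow> ('o, 'm) P_arr" where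
  "P_mult_a mu_o mu_a u v =
     (let m = sm_src (gr_base u); m' = sm_tgt (gr_base u);
          n = sm_src (gr_base v); n' = sm_tgt (gr_base v)
      in Gr (snd (P_mult_o mu_o (m, gr_src u) (n, gr_src v)))
            (A_mult_arr (gr_base u) (gr_base v))
            (rlex_list (length m') (length n')
               (\<lambda>i j. mu_a (m' ! i) (n' ! j) (gr_fib u ! i) (gr_fib v ! j)))
            (snd (P_mult_o mu_o (m', gr_tgt u) (n', gr_tgt v))))"

definition P_dist_l ::
    "('o, 'm) gamma_diagram \<Rightarrow> (nat \<Rightarrow> nat \<Rightarrow> 'o \<Rightarrow> 'o \<Rightarrow> 'o) \<Rightarrow>
     'o P_obj \<Rightarrow> 'o P_obj \<Rightarrow> 'o P_obj \<Rightarrow> ('o, 'm) P_arr" where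
  "P_dist_l X mu_o A B C = P_block X
     (\<lambda>k. let p = length (fst A); q = length (fst B); r = length (fst C) in
        if k < p * r then rlex (p + q) (k mod p) (k div p)
        else rlex (p + q) (p + (k - p * r) mod q) ((k - p * r) div q))
     (P_sum_o (P_mult_o mu_o A C) (P_mult_o mu_o B C))
     (P_mult_o mu_o (P_sum_o A B) C)"

definition P_dist_r ::
    "('o, 'm) gamma_diagram \<Rightarrow> (nat \<Rightarrow> nat \<Rightarrow> 'o \<Rightarrow> 'o \<Rightarrow> 'o) \<Rightarrow>
     'o P_obj \<Rightarrow> 'o P_obj \<Rightarrow> 'o P_obj \<Rightarrow> ('o, 'm) P_arr" where
  "P_dist_r X mu_o A B C = P_block X
     (\<lambda>k. let p = length (fst A); q = length (fst B) in
        if k < p * q then rlex p (k mod p) (k div p)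
        else rlex p ((k - p * q) mod p) (q + (k - p * q) div p))
     (P_sum_o (P_mult_o mu_o A B) (P_mult_o mu_o A C))
     (P_mult_o mu_o A (P_sum_o B C))"


section \<open>Ring categories\<close>

locale strict_monoidal_category = category \<C>
  for \<C> :: "('o, 'm) cat" (structure) +
  fixes tensor_o :: "'o \<Rightarrow> 'o \<Rightarrow> 'o" (infixr "\<otimes>" 70)
    and tensor_a :: "'m \<Rightarrow> 'm \<Rightarrow> 'm" (infixr "\<otimes>\<^sub>a" 70)
    and e :: 'o
  assumes tensor_functor:
      "cat_functor (prod_cat \<C> \<C>) \<C> (case_prod tensor_o) (case_prod tensor_a)"
    and unit_obj: "e \<in> obj \<C>"
    and tensor_o_assoc: "\<lbrakk>A \<in> obj \<C>; B \<in> obj \<C>; D \<in> obj \<C>\<rbrakk> \<Longrightarrow>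
      (A \<otimes> B) \<otimes> D = A \<otimes> (B \<otimes> D)"
    and tensor_a_assoc: "\<lbrakk>f \<in> arr \<C>; g \<in> arr \<C>; h \<in> arr \<C>\<rbrakk> \<Longrightarrow>
      (f \<otimes>\<^sub>a g) \<otimes>\<^sub>a h = f \<otimes>\<^sub>a (g \<otimes>\<^sub>a h)"
    and tensor_o_unit_left: "A \<in> obj \<C> \<Longrightarrow> e \<otimes> A = A"
    and tensor_o_unit_right: "A \<in> obj \<C> \<Longrightarrow> A \<otimes> e = A"
    and tensor_a_unit_left: "f \<in> arr \<C> \<Longrightarrow> idt \<C> e \<otimes>\<^sub>a f = f"
    and tensor_a_unit_right: "f \<in> arr \<C> \<Longrightarrow> f \<otimes>\<^sub>a idt \<C> e = f"

locale permutative_category = strict_monoidal_category \<C> sum_o sum_a zero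
  for \<C> :: "('o, 'm) cat" (structure)
    and sum_o :: "'o \<Rightarrow> 'o \<Rightarrow> 'o" (infixr "\<oplus>" 65)
    and sum_a :: "'m \<Rightarrow> 'm \<Rightarrow> 'm" (infixr "\<oplus>\<^sub>a" 65)
    and zero :: 'o +
  fixes \<xi> :: "'o \<Rightarrow> 'o \<Rightarrow> 'm"
  assumes braid_hom: "\<lbrakk>A \<in> obj \<C>; B \<in> obj \<C>\<rbrakk> \<Longrightarrow> \<xi> A B \<in> hom \<C> (A \<oplus> B) (B \<oplus> A)"
    and braid_natural: "\<lbrakk>f \<in> hom \<C> A A'; g \<in> hom \<C> B B'\<rbrakk> \<Longrightarrow>
      \<xi> A' B' \<cdot> (f \<oplus>\<^sub>a g) = (g \<oplus>\<^sub>a f) \<cdot> \<xi> A B"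
    and braid_symmetry: "\<lbrakk>A \<in> obj \<C>; B \<in> obj \<C>\<rbrakk> \<Longrightarrow> \<xi> B A \<cdot> \<xi> A B = idt \<C> (A \<oplus> B)"
    and braid_unit: "A \<in> obj \<C> \<Longrightarrow> \<xi> A zero = idt \<C> A"
    and braid_hexagon: "\<lbrakk>A \<in> obj \<C>; B \<in> obj \<C>; D \<in> obj \<C>\<rbrakk> \<Longrightarrow>
      \<xi> A (B \<oplus> D) = (idt \<C> B \<oplus>\<^sub>a \<xi> A D) \<cdot> (\<xi> A B \<oplus>\<^sub>a idt \<C> D)"

locale ring_category =
  additive: permutative_category \<C> sum_o sum_a zero \<xi> +
  multiplicative: strict_monoidal_category \<C> mult_o mult_a one
  for \<C> :: "('o, 'm) cat" (structure)
    and sum_o :: "'o \<Rightarrow> 'o \<Rightarrow> 'o" (infixr "\<oplus>" 65)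
    and sum_a :: "'m \<Rightarrow> 'm \<Rightarrow> 'm" (infixr "\<oplus>\<^sub>a" 65)
    and zero :: 'o
    and \<xi> :: "'o \<Rightarrow> 'o \<Rightarrow> 'm"
    and mult_o :: "'o \<Rightarrow> 'o \<Rightarrow> 'o" (infixr "\<otimes>" 70)
    and mult_a :: "'m \<Rightarrow> 'm \<Rightarrow> 'm" (infixr "\<otimes>\<^sub>a" 70)
    and one :: 'o +
  fixes dl :: "'o \<Rightarrow> 'o \<Rightarrow> 'o \<Rightarrow> 'm"
    and dr :: "'o \<Rightarrow> 'o \<Rightarrow> 'o \<Rightarrow> 'm"
  assumes dl_hom: "\<lbrakk>A \<in> obj \<C>; B \<in> obj \<C>; C \<in> obj \<C>\<rbrakk> \<Longrightarrow>
      dl A B C \<in> hom \<C> ((A \<otimes> C) \<oplus> (B \<otimes> C)) ((A \<oplus> B) \<otimes> C)"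
    and dl_natural: "\<lbrakk>f \<in> hom \<C> A A'; g \<in> hom \<C> B B'; h \<in> hom \<C> C C'\<rbrakk> \<Longrightarrow>
      dl A' B' C' \<cdot> ((f \<otimes>\<^sub>a h) \<oplus>\<^sub>a (g \<otimes>\<^sub>a h)) = ((f \<oplus>\<^sub>a g) \<otimes>\<^sub>a h) \<cdot> dl A B C"
    and dr_hom: "\<lbrakk>A \<in> obj \<C>; B \<in> obj \<C>; C \<in> obj \<C>\<rbrakk> \<Longrightarrow>
      dr A B C \<in> hom \<C> ((A \<otimes> B) \<oplus> (A \<otimes> C)) (A \<otimes> (B \<oplus> C))"
    and dr_natural: "\<lbrakk>f \<in> hom \<C> A A'; g \<in> hom \<C> B B'; h \<in> hom \<C> C C'\<rbrakk> \<Longrightarrow>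
      dr A' B' C' \<cdot> ((f \<otimes>\<^sub>a g) \<oplus>\<^sub>a (f \<otimes>\<^sub>a h)) = (f \<otimes>\<^sub>a (g \<oplus>\<^sub>a h)) \<cdot> dr A B C"
    and zero_mult_o: "A \<in> obj \<C> \<Longrightarrow> zero \<otimes> A = zero"
    and mult_o_zero: "A \<in> obj \<C> \<Longrightarrow> A \<otimes> zero = zero"
    and zero_mult_a: "f \<in> arr \<C> \<Longrightarrow> idt \<C> zero \<otimes>\<^sub>a f = idt \<C> zero"
    and mult_a_zero: "f \<in> arr \<C> \<Longrightarrow> f \<otimes>\<^sub>a idt \<C> zero = idt \<C> zero"
    and dl_zero_1: "\<lbrakk>B \<in> obj \<C>; C \<in> obj \<C>\<rbrakk> \<Longrightarrow> dl zero B C = idt \<C> (B \<otimes> C)"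
    and dl_zero_2: "\<lbrakk>A \<in> obj \<C>; C \<in> obj \<C>\<rbrakk> \<Longrightarrow> dl A zero C = idt \<C> (A \<otimes> C)"
    and dl_zero_3: "\<lbrakk>A \<in> obj \<C>; B \<in> obj \<C>\<rbrakk> \<Longrightarrow> dl A B zero = idt \<C> zero"
    and dr_zero_1: "\<lbrakk>B \<in> obj \<C>; C \<in> obj \<C>\<rbrakk> \<Longrightarrow> dr zero B C = idt \<C> zero"
    and dr_zero_2: "\<lbrakk>A \<in> obj \<C>; C \<in> obj \<C>\<rbrakk> \<Longrightarrow> dr A zero C = idt \<C> (A \<otimes> C)"
    and dr_zero_3: "\<lbrakk>A \<in> obj \<C>; B \<in> obj \<C>\<rbrakk> \<Longrightarrow> dr A B zero = idt \<C> (A \<otimes> B)"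
    and dl_unit: "\<lbrakk>A \<in> obj \<C>; B \<in> obj \<C>\<rbrakk> \<Longrightarrow> dl A B one = idt \<C> (A \<oplus> B)"
    and dr_unit: "\<lbrakk>B \<in> obj \<C>; C \<in> obj \<C>\<rbrakk> \<Longrightarrow> dr one B C = idt \<C> (B \<oplus> C)"
    and dl_symmetry: "\<lbrakk>A \<in> obj \<C>; B \<in> obj \<C>; C \<in> obj \<C>\<rbrakk> \<Longrightarrow>
      (\<xi> A B \<otimes>\<^sub>a idt \<C> C) \<cdot> dl A B C = dl B A C \<cdot> \<xi> (A \<otimes> C) (B \<otimes> C)"
    and dr_symmetry: "\<lbrakk>A \<in> obj \<C>; B \<in> obj \<C>; C \<in> obj \<C>\<rbrakk> \<Longrightarrow>
      (idt \<C> A \<otimes>\<^sub>a \<xi> B C) \<cdot> dr A B C = dr A C B \<cdot> \<xi> (A \<otimes> B) (A \<otimes> C)"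
    and dl_internal: "\<lbrakk>A \<in> obj \<C>; A' \<in> obj \<C>; A'' \<in> obj \<C>; B \<in> obj \<C>\<rbrakk> \<Longrightarrow>
      dl (A \<oplus> A') A'' B \<cdot> (dl A A' B \<oplus>\<^sub>a idt \<C> (A'' \<otimes> B)) =
      dl A (A' \<oplus> A'') B \<cdot> (idt \<C> (A \<otimes> B) \<oplus>\<^sub>a dl A' A'' B)"
    and dr_internal: "\<lbrakk>A \<in> obj \<C>; B \<in> obj \<C>; B' \<in> obj \<C>; B'' \<in> obj \<C>\<rbrakk> \<Longrightarrow>
      dr A (B \<oplus> B') B'' \<cdot> (dr A B B' \<oplus>\<^sub>a idt \<C> (A \<otimes> B'')) =
      dr A B (B' \<oplus> B'') \<cdot> (idt \<C> (A \<otimes> B) \<oplus>\<^sub>a dr A B' B'')"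
    and dl_external: "\<lbrakk>A \<in> obj \<C>; A' \<in> obj \<C>; B \<in> obj \<C>; C \<in> obj \<C>\<rbrakk> \<Longrightarrow>
      dl A A' (B \<otimes> C) = (dl A A' B \<otimes>\<^sub>a idt \<C> C) \<cdot> dl (A \<otimes> B) (A' \<otimes> B) C"
    and dl_dr_external: "\<lbrakk>A \<in> obj \<C>; B \<in> obj \<C>; B' \<in> obj \<C>; C \<in> obj \<C>\<rbrakk> \<Longrightarrow>
      (dr A B B' \<otimes>\<^sub>a idt \<C> C) \<cdot> dl (A \<otimes> B) (A \<otimes> B') C =
      (idt \<C> A \<otimes>\<^sub>a dl B B' C) \<cdot> dr A (B \<otimes> C) (B' \<otimes> C)"
    and dr_external: "\<lbrakk>A \<in> obj \<C>; B \<in> obj \<C>; C \<in> obj \<C>; C' \<in> obj \<C>\<rbrakk> \<Longrightarrow>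
      dr (A \<otimes> B) C C' = (idt \<C> A \<otimes>\<^sub>a dr B C C') \<cdot> dr A (B \<otimes> C) (B \<otimes> C')"
    and two_by_two: "\<lbrakk>A \<in> obj \<C>; A' \<in> obj \<C>; B \<in> obj \<C>; B' \<in> obj \<C>\<rbrakk> \<Longrightarrow>
      dl A A' (B \<oplus> B') \<cdot> (dr A B B' \<oplus>\<^sub>a dr A' B B') =
      dr (A \<oplus> A') B B' \<cdot> (dl A A' B \<oplus>\<^sub>a dl A A' B') \<cdot>
        (idt \<C> (A \<otimes> B) \<oplus>\<^sub>a \<xi> (A \<otimes> B') (A' \<otimes> B) \<oplus>\<^sub>a idt \<C> (A' \<otimes> B'))"

locale tight_ring_category = ring_category +
  assumes dl_iso: "\<lbrakk>A \<in> obj \<C>; B \<in> obj \<C>; C \<in> obj \<C>\<rbrakk> \<Longrightarrow> is_iso \<C> (dl A B C)"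
    and dr_iso: "\<lbrakk>A \<in> obj \<C>; B \<in> obj \<C>; C \<in> obj \<C>\<rbrakk> \<Longrightarrow> is_iso \<C> (dr A B C)"

end

theory Submission
  imports Defs
begin

text \<open>A \<open>\<Gamma>\<close>-category is a pointed functor from \<open>\<F>\<close> to sets twice over, on objects and on morphisms, and
  in both cases pushing a list forward along a morphism of \<open>\<A>\<close> is compatible with composition,
  concatenation and the reverse lexicographic product.  Hence \<open>\<oplus>\<close> and \<open>\<otimes>\<close> are strictly associative
  bifunctors on \<open>\<P> X\<close>.  The braiding and both distributivity morphisms permute blocks and have identity
  fibre components; such morphisms are closed under composition, \<open>\<oplus>\<close> and \<open>\<otimes>\<close>, and two of them are equal
  as soon as the permutations of block indices are.  Every ring category axiom without arbitrary
  morphisms thereby becomes an identity between index maps.\<close>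

section \<open>Concrete categories\<close>

text \<open>Two observations shape the argument. The first concerns blocks that are not hit. There
  the pushed list has the basepoint, and a separate clause for this would double the cases of every
  compatibility proof. But the component of a morphism at an unhit block is the zero map of
  \<open>F_cat\<close>, which factors through the object 0, where X has one object and one morphism.
  So the zero map acts as the constant at the basepoint, and the projection formula holds for any
  source block containing the preimage, empty or not. The second is arithmetic. The position i + p j
  of a pair depends on the number p of left blocks but not on the number of right ones, and i + p (q
  + j) = p q + (i + p j). Hence tensoring on the left distributes over concatenation on the nose and
  right distributivity disappears from every axiom. Only left distributivity moves blocks: it
  interleaves the columns of two products. Strict associativity of the product asks for
  associativity of two numberings, the reverse lexicographic one of blocks and the lexicographic one
  inside a block.\<close>

lemma concrete_cat_simps [simp]:
  "obj (concrete_cat I U P) = I"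
  "src (concrete_cat I U P) = sm_src"
  "tgt (concrete_cat I U P) = sm_tgt"
  "idt (concrete_cat I U P) i = SetMap i (\<lambda>u\<in>U i. u) i"
  "cmp (concrete_cat I U P) \<psi> \<phi> =
    SetMap (sm_src \<phi>) (compose (U (sm_src \<phi>)) (sm_fun \<psi>) (sm_fun \<phi>)) (sm_tgt \<psi>)"
  by (simp_all add: concrete_cat_def)

lemma hom_concrete_cat:
  "u \<in> hom (concrete_cat I U P) i j \<longleftrightarrow>
    i \<in> I \<and> j \<in> I \<and> (\<exists>f. u = SetMap i f j \<and> f \<in> U i \<rightarrow>\<^sub>E U j \<and> P i j f)"
  by (auto simp: hom_def concrete_cat_def)

lemma arr_concrete_cat:
  "u \<in> arr (concrete_cat I U P) \<Longrightarrow> sm_src u \<in> I \<and> sm_tgt u \<in> I"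
  by (auto simp: concrete_cat_def)

text \<open>Extensionality makes the unit laws equalities of arrows: composing with a restricted
  identity gives back a map that is \<open>undefined\<close> off its domain.\<close>

lemma category_concrete_cat:
  assumes "\<And>i. i \<in> I \<Longrightarrow> P i i (\<lambda>u\<in>U i. u)"
    and "\<And>i j k f g. \<lbrakk>f \<in> U i \<rightarrow>\<^sub>E U j; g \<in> U j \<rightarrow>\<^sub>E U k; P i j f; P j k g\<rbrakk> \<Longrightarrow> P i k (compose (U i) g f)"
  shows "category (concrete_cat I U P)"
proof
  fix a b c d and f g h
  assume f: "f \<in> hom (concrete_cat I U P) a b" and g: "g \<in> hom (concrete_cat I U P) b c"
  from f g obtain f' g' where "f = SetMap a f' b" "g = SetMap b g' c"
    "f' \<in> U a \<rightarrow>\<^sub>E U b" "g' \<in> U b \<rightarrow>\<^sub>E U c" "P a b f'" "P b c g'" "a \<in> I" "c \<in> I"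
    by (auto simp: hom_concrete_cat)
  then show "cmp (concrete_cat I U P) g f \<in> hom (concrete_cat I U P) a c"
    using assms(2)[of f' a b g' c] by (auto simp: hom_concrete_cat compose_def)
  assume h: "h \<in> hom (concrete_cat I U P) c d"
  show "cmp (concrete_cat I U P) h (cmp (concrete_cat I U P) g f) =
    cmp (concrete_cat I U P) (cmp (concrete_cat I U P) h g) f"
    using f g h by (auto simp: hom_concrete_cat compose_def PiE_iff fun_eq_iff)
next
  fix a b f assume f: "f \<in> hom (concrete_cat I U P) a b"
  then show "cmp (concrete_cat I U P) (idt (concrete_cat I U P) b) f = f"
    "cmp (concrete_cat I U P) f (idt (concrete_cat I U P) a) = f"
    by (auto simp: hom_concrete_cat compose_def PiE_iff fun_eq_iff extensional_def) metis+
qed (use assms in \<open>auto simp: hom_concrete_cat dest: arr_concrete_cat\<close>)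

lemma (in category) hom_src_tgt: "f \<in> arr \<C> \<Longrightarrow> f \<in> hom \<C> (src \<C> f) (tgt \<C> f)"
  by (simp add: hom_def)

lemma (in category) idt_arr: "a \<in> obj \<C> \<Longrightarrow> idt \<C> a \<in> arr \<C>"
  using idt_hom by (simp add: hom_def)

lemma (in category) hom_obj: "f \<in> hom \<C> a b \<Longrightarrow> a \<in> obj \<C> \<and> b \<in> obj \<C>"
  using src_obj tgt_obj by (auto simp: hom_def)

section \<open>The category of finite pointed sets\<close>

lemma F_hom_iff:
  "u \<in> hom F_cat m n \<longleftrightarrow> (\<exists>f. u = SetMap m f n \<and> f \<in> {0..m} \<rightarrow>\<^sub>E {0..n} \<and> f 0 = 0)"
  by (simp add: F_cat_def hom_concrete_cat)

lemma F_idt: "idt F_cat n = SetMap n (\<lambda>u\<in>{0..n}. u) n"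
  by (simp add: F_cat_def)

lemma F_cmp: "cmp F_cat \<psi> \<phi> =
    SetMap (sm_src \<phi>) (compose {0..sm_src \<phi>} (sm_fun \<psi>) (sm_fun \<phi>)) (sm_tgt \<psi>)"
  by (simp add: F_cat_def)

lemma category_F_cat: "category F_cat"
  unfolding F_cat_def by (rule category_concrete_cat) (auto simp: compose_def)

section \<open>Blocks and the category of sequences\<close>

lemma in_blocks [simp]: "(i, a) \<in> blocks m \<longleftrightarrow> i < length m \<and> 1 \<le> a \<and> a \<le> m ! i"
  by (auto simp: blocks_def)

text \<open>A preimage lies in one block exactly when any two of its elements have the same first
  coordinate. The second form names no witness block and passes to composites by being applied
  twice.\<close>

lemma block_condition_iff:
  assumes "f \<in> blocks m \<rightarrow> blocks n"
  shows "(\<forall>j < length n. block_preimage m f j = {} \<or>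
      (\<exists>i < length m. block_preimage m f j \<subseteq> {i} \<times> {1..m ! i})) \<longleftrightarrow>
    (\<forall>u\<in>blocks m. \<forall>v\<in>blocks m. fst (f u) = fst (f v) \<longrightarrow> fst u = fst v)" (is "?L \<longleftrightarrow> ?R")
proof
  assume L: ?L
  show ?R
  proof (intro ballI impI)
    fix u v assume u: "u \<in> blocks m" and v: "v \<in> blocks m" and eq: "fst (f u) = fst (f v)"
    from u assms have "f u \<in> blocks n" by auto
    then have "fst (f u) < length n" by (cases "f u") auto
    with L consider "block_preimage m f (fst (f u)) = {}"
      | i where "block_preimage m f (fst (f u)) \<subseteq> {i} \<times> {1..m ! i}"
      by blast
    moreover have "u \<in> block_preimage m f (fst (f u))" "v \<in> block_preimage m f (fst (f u))"
      using u v eq by (simp_all add: block_preimage_def)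
    ultimately show "fst u = fst v"
      by cases (simp, metis mem_Times_iff singletonD subsetD)
  qed
next
  assume R: ?R
  show ?L
  proof (intro allI impI disjCI)
    fix j assume "\<not> (\<exists>i < length m. block_preimage m f j \<subseteq> {i} \<times> {1..m ! i})"
    with R show "block_preimage m f j = {}"
      by (fastforce simp: block_preimage_def blocks_def)
  qed
qed

abbreviation A_obj :: "nat list set" where
  "A_obj \<equiv> obj A_cat"

lemma A_obj_iff: "m \<in> A_obj \<longleftrightarrow> (\<forall>i < length m. 0 < m ! i)"
  by (simp add: A_cat_def all_set_conv_all_nth)

lemma A_hom_iff:
  "u \<in> hom A_cat m n \<longleftrightarrow> m \<in> A_obj \<and> n \<in> A_obj \<and>
    (\<exists>f. u = SetMap m f n \<and> f \<in> blocks m \<rightarrow>\<^sub>E blocks n \<and>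
      (\<forall>u\<in>blocks m. \<forall>v\<in>blocks m. fst (f u) = fst (f v) \<longrightarrow> fst u = fst v))"
proof -
  let ?P = "\<lambda>f. \<forall>j < length n. block_preimage m f j = {} \<or>
      (\<exists>i < length m. block_preimage m f j \<subseteq> {i} \<times> {1..m ! i})"
  let ?Q = "\<lambda>f. \<forall>u\<in>blocks m. \<forall>v\<in>blocks m. fst (f u) = fst (f v) \<longrightarrow> fst u = fst v"
  \<comment> \<open>The equivalence of the two conditions is available for maps into
    \<open>blocks n\<close>, so the typing is carried along as a conjunct.\<close>
  have "f \<in> blocks m \<rightarrow>\<^sub>E blocks n \<and> ?P f \<longleftrightarrow> f \<in> blocks m \<rightarrow>\<^sub>E blocks n \<and> ?Q f" for f
    by (rule conj_cong[OF refl], rule block_condition_iff) (simp add: PiE_def)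
  then show ?thesis
    unfolding A_cat_def hom_concrete_cat concrete_cat_simps by simp
qed

lemma A_idt: "idt A_cat m = SetMap m (\<lambda>u\<in>blocks m. u) m"
  by (simp add: A_cat_def)

lemma A_cmp: "cmp A_cat \<psi> \<phi> =
    SetMap (sm_src \<phi>) (compose (blocks (sm_src \<phi>)) (sm_fun \<psi>) (sm_fun \<phi>)) (sm_tgt \<psi>)"
  by (simp add: A_cat_def)

lemma A_src_tgt [simp]: "src A_cat = sm_src" "tgt A_cat = sm_tgt"
  by (simp_all add: A_cat_def)

lemma category_A_cat: "category A_cat"
proof -
  let ?P = "\<lambda>m n f. \<forall>j < length n. block_preimage m f j = {} \<or>
      (\<exists>i < length m. block_preimage m f j \<subseteq> {i} \<times> {1..m ! i})"
  have *: "f \<in> blocks m \<rightarrow> blocks n" if "f \<in> blocks m \<rightarrow>\<^sub>E blocks n" for f m n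
    using that by auto
  show ?thesis
    unfolding A_cat_def
  proof (rule category_concrete_cat)
    fix i show "?P i i (\<lambda>u\<in>blocks i. u)"
      by (subst block_condition_iff) auto
  next
    fix i j k f g
    assume f: "f \<in> blocks i \<rightarrow>\<^sub>E blocks j" and g: "g \<in> blocks j \<rightarrow>\<^sub>E blocks k"
      and P: "?P i j f" "?P j k g"
    have "compose (blocks i) g f \<in> blocks i \<rightarrow> blocks k"
      using f g by (auto simp: compose_def)
    moreover have "\<forall>u\<in>blocks i. \<forall>v\<in>blocks i.
        fst (compose (blocks i) g f u) = fst (compose (blocks i) g f v) \<longrightarrow> fst u = fst v"
    proof (intro ballI impI)
      fix u v assume uv: "u \<in> blocks i" "v \<in> blocks i"
        and eq: "fst (compose (blocks i) g f u) = fst (compose (blocks i) g f v)"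
      then have "fst (g (f u)) = fst (g (f v))" by (simp add: compose_def)
      moreover have "f u \<in> blocks j" "f v \<in> blocks j" using uv f by auto
      ultimately have "fst (f u) = fst (f v)"
        using P(2)[unfolded block_condition_iff[OF *[OF g]]] by blast
      with uv show "fst u = fst v"
        using P(1)[unfolded block_condition_iff[OF *[OF f]]] by blast
    qed
    ultimately show "?P i k (compose (blocks i) g f)"
      by (simp only: block_condition_iff)
  qed
qed

interpretation F: category F_cat by (rule category_F_cat)
interpretation A: category A_cat by (rule category_A_cat)

lemma A_homD:
  assumes "\<phi> \<in> hom A_cat m n"
  shows "m \<in> A_obj" "n \<in> A_obj" "sm_src \<phi> = m" "sm_tgt \<phi> = n"
    "sm_fun \<phi> \<in> blocks m \<rightarrow>\<^sub>E blocks n"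
  using assms by (auto simp: A_hom_iff)

lemma A_hom_inj:
  assumes "\<phi> \<in> hom A_cat m n" "(i, a) \<in> blocks m" "(i', a') \<in> blocks m"
    "fst (sm_fun \<phi> (i, a)) = fst (sm_fun \<phi> (i', a'))"
  shows "i = i'"
  using assms by (force simp: A_hom_iff)

lemma A_hom_funE:
  assumes "\<phi> \<in> hom A_cat m n" "(i, a) \<in> blocks m"
  obtains j b where "sm_fun \<phi> (i, a) = (j, b)" "j < length n" "1 \<le> b" "b \<le> n ! j"
  using PiE_mem[OF A_homD(5)[OF assms(1)] assms(2)] by (cases "sm_fun \<phi> (i, a)") simp

lemma A_hom_fun_in:
  assumes "\<phi> \<in> hom A_cat m n" "(i, a) \<in> blocks m"
  shows "(fst (sm_fun \<phi> (i, a)), snd (sm_fun \<phi> (i, a))) \<in> blocks n"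
  using PiE_mem[OF A_homD(5)[OF assms(1)] assms(2)] by simp

lemma A_hom_fun_less:
  "\<phi> \<in> hom A_cat m n \<Longrightarrow> (i, a) \<in> blocks m \<Longrightarrow> fst (sm_fun \<phi> (i, a)) < length n"
  using A_hom_fun_in in_blocks by metis

lemma A_arr_eqI:
  assumes "\<phi> \<in> hom A_cat m n" "\<psi> \<in> hom A_cat m n"
    "\<And>i a. (i, a) \<in> blocks m \<Longrightarrow> sm_fun \<phi> (i, a) = sm_fun \<psi> (i, a)"
  shows "\<phi> = \<psi>"
proof -
  have "sm_fun \<phi> = sm_fun \<psi>"
    using assms by (intro PiE_ext[OF A_homD(5)[OF assms(1)] A_homD(5)[OF assms(2)]]) (auto simp del: in_blocks)
  then show ?thesis
    using A_homD(3,4)[OF assms(1)] A_homD(3,4)[OF assms(2)] by (cases \<phi>; cases \<psi>) simp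
qed

lemma A_cmp_fun:
  assumes "\<phi> \<in> hom A_cat m n" "(i, a) \<in> blocks m"
  shows "sm_fun (cmp A_cat \<psi> \<phi>) (i, a) = sm_fun \<psi> (sm_fun \<phi> (i, a))"
  using assms by (simp add: A_cmp A_homD compose_def del: in_blocks)

lemma A_homI:
  assumes "m \<in> A_obj" "n \<in> A_obj"
    and "\<And>i a. (i, a) \<in> blocks m \<Longrightarrow> f (i, a) \<in> blocks n"
    and "\<And>i a i' a'. \<lbrakk>(i, a) \<in> blocks m; (i', a') \<in> blocks m; fst (f (i, a)) = fst (f (i', a'))\<rbrakk> \<Longrightarrow> i = i'"
  shows "SetMap m (\<lambda>u\<in>blocks m. f u) n \<in> hom A_cat m n"
  unfolding A_hom_iff using assms by (auto simp del: in_blocks)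

text \<open>Each coordinate of a pushed list is computed along this split. The second alternative
  only asks that the preimage of block \<open>j\<close> lie over \<open>i\<close>, so it fits
  \<open>push_nth\<close> directly.\<close>

lemma A_hom_cases:
  assumes "\<phi> \<in> hom A_cat m n"
  obtains (empty) "\<forall>i a. (i, a) \<in> blocks m \<longrightarrow> fst (sm_fun \<phi> (i, a)) \<noteq> j"
  | (block) i where "i < length m"
      "\<forall>i' a. (i', a) \<in> blocks m \<longrightarrow> fst (sm_fun \<phi> (i', a)) = j \<longrightarrow> i' = i"
  using A_hom_inj[OF assms] by (metis in_blocks)


section \<open>Indexing of blocks\<close>

lemma rlex_less:
  assumes "i < p" "j < q"
  shows "rlex p i j < p * q"
proof -
  have "rlex p i j < p * Suc j" using assms by (simp add: rlex_def)
  also have "\<dots> \<le> p * q" using assms by (intro mult_le_mono2) simp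
  finally show ?thesis .
qed

lemma rlex_mod [simp]: "i < p \<Longrightarrow> rlex p i j mod p = i"
  and rlex_div [simp]: "i < p \<Longrightarrow> rlex p i j div p = j"
  by (simp_all add: rlex_def)

lemma rlex_inject: "i < p \<Longrightarrow> i' < p \<Longrightarrow> rlex p i j = rlex p i' j' \<longleftrightarrow> i = i' \<and> j = j'"
  by (metis rlex_mod rlex_div)

lemma rlex_cases:
  assumes "k < p * q"
  obtains i j where "i < p" "j < q" "k = rlex p i j"
proof
  have "p > 0" using assms by (cases p) auto
  then show "k mod p < p" by simp
  show "k div p < q" using assms by (simp add: less_mult_imp_div_less mult.commute)
  show "k = rlex p (k mod p) (k div p)" by (simp add: rlex_def)
qed

text \<open>Both sides are i + p j + p q k. This is the numerical reason why the product of
  sequences is strictly associative.\<close>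

lemma rlex_assoc: "rlex (p * q) (rlex p i j) k = rlex p i (rlex q j k)"
  by (simp add: rlex_def algebra_simps)

lemma length_rlex_list [simp]: "length (rlex_list p q h) = p * q"
  by (simp add: rlex_list_def)

lemma rlex_list_nth [simp]:
  "i < p \<Longrightarrow> j < q \<Longrightarrow> rlex_list p q h ! rlex p i j = h i j"
  by (simp add: rlex_list_def rlex_less)

lemma rlex_list_eqI:
  assumes "length xs = p * q" "length ys = p * q"
    "\<And>i j. i < p \<Longrightarrow> j < q \<Longrightarrow> xs ! rlex p i j = ys ! rlex p i j"
  shows "xs = ys"
proof (rule nth_equalityI)
  fix k assume "k < length xs"
  then show "xs ! k = ys ! k"
    using rlex_cases[of k p q] assms by metis
qed (use assms in simp)

lemma length_A_mult [simp]: "length (A_mult m n) = length m * length n"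
  by (simp add: A_mult_def)

lemma A_mult_nth [simp]:
  "i < length m \<Longrightarrow> j < length n \<Longrightarrow> A_mult m n ! rlex (length m) i j = m ! i * n ! j"
  by (simp add: A_mult_def)

lemma A_mult_assoc: "A_mult (A_mult m n) k = A_mult m (A_mult n k)"
proof (rule rlex_list_eqI[where p = "length m" and q = "length n * length k"])
  fix i j assume i: "i < length m" and "j < length n * length k"
  then obtain j' l where j: "j' < length n" "l < length k" "j = rlex (length n) j' l"
    by (metis rlex_cases)
  have "A_mult (A_mult m n) k ! rlex (length (A_mult m n)) (rlex (length m) i j') l = m ! i * n ! j' * k ! l"
    using i j by (subst A_mult_nth) (auto simp: rlex_less)
  moreover have "A_mult m (A_mult n k) ! rlex (length m) i j = m ! i * (n ! j' * k ! l)"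
    using i j by (subst A_mult_nth) (auto simp: rlex_less)
  ultimately show "A_mult (A_mult m n) k ! rlex (length m) i j = A_mult m (A_mult n k) ! rlex (length m) i j"
    using j by (simp add: rlex_assoc)
qed auto

lemma A_mult_obj: "m \<in> A_obj \<Longrightarrow> n \<in> A_obj \<Longrightarrow> A_mult m n \<in> A_obj"
  by (auto simp: A_obj_iff elim!: rlex_cases)

text \<open>For entries counted from 1, the predecessor of \<open>lex n a b\<close> is n (a - 1) +
  (b - 1) with b - 1 < n, so quotient and remainder by n recover the two entries.\<close>

lemma lex_fst_lex [simp]: "1 \<le> a \<Longrightarrow> 1 \<le> b \<Longrightarrow> b \<le> n \<Longrightarrow> lex_fst n (lex n a b) = a"
  and lex_snd_lex [simp]: "1 \<le> a \<Longrightarrow> 1 \<le> b \<Longrightarrow> b \<le> n \<Longrightarrow> lex_snd n (lex n a b) = b"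
  by (cases a; cases b; simp add: lex_def lex_fst_def lex_snd_def)+

lemma lex_bounds:
  assumes "1 \<le> a" "a \<le> m" "1 \<le> b" "b \<le> n"
  shows "1 \<le> lex n a b" "lex n a b \<le> m * n"
proof -
  show "1 \<le> lex n a b" using assms by (simp add: lex_def)
  have "n * (a - 1) + b \<le> n * (a - 1) + n" using assms by simp
  also have "\<dots> = n * a" using assms by (cases a) auto
  also have "\<dots> \<le> m * n" using assms by simp
  finally show "lex n a b \<le> m * n" by (simp add: lex_def)
qed

lemma lex_cases:
  assumes "1 \<le> c" "c \<le> m * n"
  obtains a b where "1 \<le> a" "a \<le> m" "1 \<le> b" "b \<le> n" "c = lex n a b"
proof
  have n: "n > 0" using assms by (cases n) auto
  have "c - 1 < m * n" using assms by simp
  then have "(c - 1) div n < m" by (rule less_mult_imp_div_less)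
  then show "lex_fst n c \<le> m" by (simp add: lex_fst_def)
  show "lex_snd n c \<le> n" using n by (simp add: lex_snd_def Suc_le_eq)
  have "n * ((c - 1) div n) + (c - 1) mod n = c - 1" by simp
  then show "c = lex n (lex_fst n c) (lex_snd n c)"
    using assms by (simp add: lex_def lex_fst_def lex_snd_def)
qed (simp_all add: lex_fst_def lex_snd_def)

text \<open>The bound on b lets the truncated predecessor of n (a - 1) + b be taken in the second
  summand; then both sides are n k (a - 1) + k (b - 1) + c.\<close>

lemma lex_assoc: "1 \<le> b \<Longrightarrow> lex k (lex n a b) c = lex (n * k) a (lex k b c)"
  by (cases b) (simp_all add: lex_def algebra_simps)

text \<open>Coordinates on a product: a point of block (i, j) is a pair of points of the two
  factors. Maps out of a product are compared on points written in this form.\<close>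

lemma blocks_A_mult_cases:
  assumes "(k, c) \<in> blocks (A_mult m n)"
  obtains i a j b where "(i, a) \<in> blocks m" "(j, b) \<in> blocks n"
    "k = rlex (length m) i j" "c = lex (n ! j) a b"
proof -
  from assms have k: "k < length m * length n" and c: "1 \<le> c" "c \<le> A_mult m n ! k" by auto
  obtain i j where ij: "i < length m" "j < length n" "k = rlex (length m) i j"
    using k by (rule rlex_cases)
  with c have "c \<le> m ! i * n ! j" by simp
  with c(1) obtain a b where "1 \<le> a" "a \<le> m ! i" "1 \<le> b" "b \<le> n ! j" "c = lex (n ! j) a b"
    by (rule lex_cases)
  with ij that show thesis by simp
qed

lemma in_blocks_A_mult:
  "(i, a) \<in> blocks m \<Longrightarrow> (j, b) \<in> blocks n \<Longrightarrow>
    (rlex (length m) i j, lex (n ! j) a b) \<in> blocks (A_mult m n)"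
  using lex_bounds[of a "m ! i" b "n ! j"] by (simp add: rlex_less)

lemma blocks_append_cases:
  assumes "(k, a) \<in> blocks (m @ n)"
  obtains (left) "(k, a) \<in> blocks m"
  | (right) j where "k = length m + j" "(j, a) \<in> blocks n"
  using assms
  by (cases "k < length m") (auto simp: nth_append not_less le_iff_add)

lemma A_append_obj: "m @ n \<in> A_obj \<longleftrightarrow> m \<in> A_obj \<and> n \<in> A_obj"
  by (auto simp: A_cat_def)


section \<open>Operations on \<open>\<A>\<close>\<close>

lemma A_sum_fun_left:
  "(i, a) \<in> blocks (sm_src \<phi>) \<Longrightarrow> sm_fun (A_sum \<phi> \<psi>) (i, a) = sm_fun \<phi> (i, a)"
  by (simp add: A_sum_def nth_append)

lemma A_sum_fun_right:
  "(j, a) \<in> blocks (sm_src \<psi>) \<Longrightarrow> sm_fun (A_sum \<phi> \<psi>) (length (sm_src \<phi>) + j, a) =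
    (length (sm_tgt \<phi>) + fst (sm_fun \<psi> (j, a)), snd (sm_fun \<psi> (j, a)))"
  by (simp add: A_sum_def case_prod_beta)

lemma A_sum_src_tgt [simp]:
  "sm_src (A_sum \<phi> \<psi>) = sm_src \<phi> @ sm_src \<psi>" "sm_tgt (A_sum \<phi> \<psi>) = sm_tgt \<phi> @ sm_tgt \<psi>"
  by (simp_all add: A_sum_def)

text \<open>Images of left blocks have index below \<open>length n\<close>, images of right blocks
  have index at least \<open>length n\<close>. Two blocks that meet a common target block therefore
  lie on the same side, where the hypothesis on that side applies.\<close>

lemma A_sum_hom:
  assumes \<phi>: "\<phi> \<in> hom A_cat m n" and \<psi>: "\<psi> \<in> hom A_cat m' n'"
  shows "A_sum \<phi> \<psi> \<in> hom A_cat (m @ m') (n @ n')"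
proof -
  note D = A_homD[OF \<phi>] A_homD[OF \<psi>]
  have L: "sm_fun (A_sum \<phi> \<psi>) (i, a) = sm_fun \<phi> (i, a)" if "(i, a) \<in> blocks m" for i a
    using A_sum_fun_left that D by metis
  have R: "sm_fun (A_sum \<phi> \<psi>) (length m + i, a) =
      (length n + fst (sm_fun \<psi> (i, a)), snd (sm_fun \<psi> (i, a)))" if "(i, a) \<in> blocks m'" for i a
    using A_sum_fun_right that D by metis
  \<comment> \<open>The function of \<open>A_sum\<close> is already restricted to the blocks;
    restricting it again brings it into the shape of \<open>A_homI\<close> and is undone at the
    end.\<close>
  have "SetMap (m @ m') (\<lambda>u\<in>blocks (m @ m'). sm_fun (A_sum \<phi> \<psi>) u) (n @ n') \<in> hom A_cat (m @ m') (n @ n')"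
  proof (rule A_homI)
    show "m @ m' \<in> A_obj" "n @ n' \<in> A_obj" using D by (simp_all add: A_append_obj)
  next
    fix i a assume "(i, a) \<in> blocks (m @ m')"
    then show "sm_fun (A_sum \<phi> \<psi>) (i, a) \<in> blocks (n @ n')"
    proof (cases rule: blocks_append_cases)
      case left
      with \<phi> show ?thesis by (auto simp: L nth_append elim: A_hom_funE simp del: in_blocks)
         (auto simp: nth_append elim: A_hom_funE)
    next
      case (right j)
      then obtain k b where "sm_fun \<psi> (j, a) = (k, b)" "(k, b) \<in> blocks n'"
        using A_hom_funE[OF \<psi>] by (metis in_blocks)
      with right show ?thesis by (simp add: R)
    qed
  next
    fix i a i' a'
    assume ia: "(i, a) \<in> blocks (m @ m')" and ia': "(i', a') \<in> blocks (m @ m')"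
      and eq: "fst (sm_fun (A_sum \<phi> \<psi>) (i, a)) = fst (sm_fun (A_sum \<phi> \<psi>) (i', a'))"
    have lt: "fst (sm_fun \<phi> (i, a)) < length n" if "(i, a) \<in> blocks m" for i a
      using A_hom_funE[OF \<phi> that] by (metis fst_conv)
    from ia show "i = i'"
    proof (cases rule: blocks_append_cases)
      case left
      note ia = left
      from ia' show ?thesis
      proof (cases rule: blocks_append_cases)
        case left
        with ia eq show ?thesis using A_hom_inj[OF \<phi>] by (simp only: L)
      next
        case (right j)
        with ia eq lt[OF ia] show ?thesis by (simp add: L R)
      qed
    next
      case (right j)
      note ia = right
      from ia' show ?thesis
      proof (cases rule: blocks_append_cases)
        case left
        with ia eq lt[OF left] show ?thesis by (simp add: L R)
      next
        case (right j')
        with ia eq have "fst (sm_fun \<psi> (j, a)) = fst (sm_fun \<psi> (j', a'))" by (simp add: R)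
        with ia right show ?thesis using A_hom_inj[OF \<psi>] by simp
      qed
    qed
  qed
  also have "SetMap (m @ m') (\<lambda>u\<in>blocks (m @ m'). sm_fun (A_sum \<phi> \<psi>) u) (n @ n') = A_sum \<phi> \<psi>"
    using D by (auto simp: A_sum_def fun_eq_iff)
  finally show ?thesis .
qed

lemma A_mult_arr_src_tgt [simp]:
  "sm_src (A_mult_arr \<phi> \<psi>) = A_mult (sm_src \<phi>) (sm_src \<psi>)"
  "sm_tgt (A_mult_arr \<phi> \<psi>) = A_mult (sm_tgt \<phi>) (sm_tgt \<psi>)"
  by (simp_all add: A_mult_arr_def)

lemma A_mult_arr_fun:
  assumes "(i, a) \<in> blocks (sm_src \<phi>)" "(j, b) \<in> blocks (sm_src \<psi>)"
  shows "sm_fun (A_mult_arr \<phi> \<psi>) (rlex (length (sm_src \<phi>)) i j, lex (sm_src \<psi> ! j) a b) =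
    (rlex (length (sm_tgt \<phi>)) (fst (sm_fun \<phi> (i, a))) (fst (sm_fun \<psi> (j, b))),
     lex (sm_tgt \<psi> ! fst (sm_fun \<psi> (j, b))) (snd (sm_fun \<phi> (i, a))) (snd (sm_fun \<psi> (j, b))))"
  using assms in_blocks_A_mult[OF assms]
  by (simp add: A_mult_arr_def Let_def case_prod_beta)

text \<open>The target block has index \<open>rlex (length m') i' j'\<close> with i' in range, so it
  determines i' and j' separately; these determine the source blocks i and j by the condition on
  each factor.\<close>

lemma A_mult_arr_hom:
  assumes \<phi>: "\<phi> \<in> hom A_cat m m'" and \<psi>: "\<psi> \<in> hom A_cat n n'"
  shows "A_mult_arr \<phi> \<psi> \<in> hom A_cat (A_mult m n) (A_mult m' n')"
proof -
  note D = A_homD[OF \<phi>] A_homD[OF \<psi>]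
  note fn = A_mult_arr_fun[of _ _ \<phi> _ _ \<psi>, unfolded D]
  let ?f = "sm_fun (A_mult_arr \<phi> \<psi>)"
  have hom: "SetMap (A_mult m n) (\<lambda>u\<in>blocks (A_mult m n). ?f u) (A_mult m' n') \<in> hom A_cat (A_mult m n) (A_mult m' n')"
  proof (rule A_homI)
    show "A_mult m n \<in> A_obj" "A_mult m' n' \<in> A_obj" using D by (simp_all add: A_mult_obj)
  next
    fix k c assume "(k, c) \<in> blocks (A_mult m n)"
    then obtain i a j b where *: "(i, a) \<in> blocks m" "(j, b) \<in> blocks n"
      "k = rlex (length m) i j" "c = lex (n ! j) a b" by (rule blocks_A_mult_cases)
    show "?f (k, c) \<in> blocks (A_mult m' n')"
      unfolding *(3,4) fn[OF *(1,2)]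
      using in_blocks_A_mult[OF A_hom_fun_in[OF \<phi> *(1)] A_hom_fun_in[OF \<psi> *(2)]] .
  next
    fix k c k' c'
    assume "(k, c) \<in> blocks (A_mult m n)" "(k', c') \<in> blocks (A_mult m n)"
      and eq: "fst (?f (k, c)) = fst (?f (k', c'))"
    then obtain i a j b i' a' j' b' where
      *: "(i, a) \<in> blocks m" "(j, b) \<in> blocks n" "k = rlex (length m) i j" "c = lex (n ! j) a b" and
      o: "(i', a') \<in> blocks m" "(j', b') \<in> blocks n" "k' = rlex (length m) i' j'" "c' = lex (n ! j') a' b'"
      by (metis blocks_A_mult_cases)
    have "fst (sm_fun \<phi> (i, a)) < length m'" "fst (sm_fun \<phi> (i', a')) < length m'"
      using A_hom_fun_less[OF \<phi>] *(1) o(1) by simp_all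
    with eq have "fst (sm_fun \<phi> (i, a)) = fst (sm_fun \<phi> (i', a')) \<and> fst (sm_fun \<psi> (j, b)) = fst (sm_fun \<psi> (j', b'))"
      using * o by (simp add: fn rlex_inject del: in_blocks)
    then show "k = k'"
      using A_hom_inj[OF \<phi> *(1) o(1)] A_hom_inj[OF \<psi> *(2) o(2)] * o by simp
  qed
  have "SetMap (A_mult m n) (\<lambda>u\<in>blocks (A_mult m n). ?f u) (A_mult m' n') = A_mult_arr \<phi> \<psi>"
    using D by (auto simp: A_mult_arr_def fun_eq_iff)
  with hom show ?thesis by simp
qed


section \<open>Pushing lists forward along morphisms of \<open>\<A>\<close>\<close>

text \<open>The map through the object 0: \<open>F_zero m n\<close> is the composite of
  \<open>F_zero m 0\<close> and \<open>F_zero 0 n\<close>.\<close>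

definition F_zero :: "nat \<Rightarrow> nat \<Rightarrow> F_arrow" where
  "F_zero m n = SetMap m (\<lambda>u\<in>{0..m}. 0) n"

lemma F_zero_hom: "F_zero m n \<in> hom F_cat m n"
  by (auto simp: F_zero_def F_hom_iff)

lemma F_cmp_zero: "\<phi> \<in> hom F_cat n k \<Longrightarrow> cmp F_cat \<phi> (F_zero m n) = F_zero m k"
  by (auto simp: F_zero_def F_hom_iff F_cmp compose_def)

lemma A_component_hom:
  assumes \<phi>: "\<phi> \<in> hom A_cat m n" and "i < length m" "j < length n"
  shows "A_component \<phi> i j \<in> hom F_cat (m ! i) (n ! j)"
proof -
  note D = A_homD[OF \<phi>]
  have "snd (sm_fun \<phi> (i, a)) \<le> n ! j"
    if "a \<in> {0..m ! i}" "a \<noteq> 0" "fst (sm_fun \<phi> (i, a)) = j" for a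
    using A_hom_fun_in[OF \<phi>, of i a] that assms by simp
  then show ?thesis
    by (auto simp: A_component_def D F_hom_iff)
qed

text \<open>This turns the basepoint clause of a pushforward into an instance of the projection
  clause.\<close>

lemma A_component_zero:
  assumes "\<phi> \<in> hom A_cat m n"
    and "\<forall>a. (i, a) \<in> blocks m \<longrightarrow> fst (sm_fun \<phi> (i, a)) \<noteq> j" "i < length m"
  shows "A_component \<phi> i j = F_zero (m ! i) (n ! j)"
  using assms(2,3) by (auto simp: A_component_def F_zero_def A_homD[OF assms(1)] fun_eq_iff Suc_le_eq)

text \<open>An element of block i that \<phi> sends into block j is treated alike by both sides. One
  that leaves block j is killed by the component of \<phi>, and its image under the composite misses
  block l because \<psi> reaches l only from j.\<close>

lemma A_component_cmp:
  assumes \<phi>: "\<phi> \<in> hom A_cat m n" and \<psi>: "\<psi> \<in> hom A_cat n k" and i: "i < length m" and j: "j < length n"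
    and only: "\<forall>j' b. (j', b) \<in> blocks n \<longrightarrow> fst (sm_fun \<psi> (j', b)) = l \<longrightarrow> j' = j"
  shows "A_component (cmp A_cat \<psi> \<phi>) i l = cmp F_cat (A_component \<psi> j l) (A_component \<phi> i j)"
proof -
  note D = A_homD[OF \<phi>] A_homD[OF \<psi>]
  have "sm_fun (A_component (cmp A_cat \<psi> \<phi>) i l) a =
      sm_fun (cmp F_cat (A_component \<psi> j l) (A_component \<phi> i j)) a" if a: "a \<in> {0..m ! i}" for a
  proof -
    have L: "sm_fun (A_component (cmp A_cat \<psi> \<phi>) i l) a =
        (if a \<noteq> 0 \<and> fst (sm_fun (cmp A_cat \<psi> \<phi>) (i, a)) = l
         then snd (sm_fun (cmp A_cat \<psi> \<phi>) (i, a)) else 0)"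
      using a by (simp add: A_component_def D A_cmp)
    have R1: "sm_fun (A_component \<phi> i j) a =
        (if a \<noteq> 0 \<and> fst (sm_fun \<phi> (i, a)) = j then snd (sm_fun \<phi> (i, a)) else 0)"
      using a by (simp add: A_component_def D)
    have R2: "sm_fun (cmp F_cat (A_component \<psi> j l) (A_component \<phi> i j)) a =
        sm_fun (A_component \<psi> j l) (sm_fun (A_component \<phi> i j) a)"
      using a by (simp add: F_cmp compose_def A_component_def D)
    show ?thesis
    proof (cases "a = 0")
      case True
      then show ?thesis unfolding R2 L R1 by (simp add: A_component_def D)
    next
      case False
      with a i have ia: "(i, a) \<in> blocks m" by simp
      obtain j' b where b: "sm_fun \<phi> (i, a) = (j', b)" "j' < length n" "1 \<le> b" "b \<le> n ! j'"
        using A_hom_funE[OF \<phi> ia] .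
      have eq: "sm_fun (cmp A_cat \<psi> \<phi>) (i, a) = sm_fun \<psi> (j', b)"
        using A_cmp_fun[OF \<phi> ia] b by simp
      show ?thesis
      proof (cases "j' = j")
        case True
        then show ?thesis using False b unfolding R2 L R1 eq by (simp add: A_component_def D)
      next
        case neq: False
        \<comment> \<open>The contrapositive of \<open>only\<close>: arriving in l would force j' =
          j.\<close>
        then have "fst (sm_fun \<psi> (j', b)) \<noteq> l" using only b by auto
        then show ?thesis using neq b unfolding R2 L R1 eq by (simp add: A_component_def D)
      qed
    qed
  qed
  moreover have "sm_fun (A_component (cmp A_cat \<psi> \<phi>) i l) a =
      sm_fun (cmp F_cat (A_component \<psi> j l) (A_component \<phi> i j)) a" if a: "a \<notin> {0..m ! i}" for a
    unfolding A_component_def A_cmp F_cmp set_map.sel D compose_def restrict_apply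
    using a by (simp only: if_False)
  ultimately have "sm_fun (A_component (cmp A_cat \<psi> \<phi>) i l) =
      sm_fun (cmp F_cat (A_component \<psi> j l) (A_component \<phi> i j))"
    by blast
  then show ?thesis
    by (simp add: A_component_def A_cmp F_cmp D)
qed

text \<open>Write a nonzero element as \<open>lex\<close> of a pair. It reaches block (i', j')
  exactly when its first entry reaches i' and its second reaches j'; otherwise one smash factor is 0
  and \<open>F_smash\<close> returns 0 as well. Here \<open>rlex_inject\<close> separates the two
  target indices.\<close>

lemma A_component_mult:
  assumes \<phi>: "\<phi> \<in> hom A_cat m m'" and \<psi>: "\<psi> \<in> hom A_cat n n'"
    and "i < length m" "i' < length m'" "j < length n" "j' < length n'"
  shows "A_component (A_mult_arr \<phi> \<psi>) (rlex (length m) i j) (rlex (length m') i' j') =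
    F_smash (A_component \<phi> i i') (A_component \<psi> j j')"
proof -
  note D = A_homD[OF \<phi>] A_homD[OF \<psi>]
  let ?L = "A_component (A_mult_arr \<phi> \<psi>) (rlex (length m) i j) (rlex (length m') i' j')"
  let ?R = "F_smash (A_component \<phi> i i') (A_component \<psi> j j')"
  have "sm_fun ?L c = sm_fun ?R c" if c: "c \<in> {0..m ! i * n ! j}" for c
  proof (cases "c = 0")
    case False
    with c have "1 \<le> c" "c \<le> m ! i * n ! j" by auto
    then obtain a b where ab: "1 \<le> a" "a \<le> m ! i" "1 \<le> b" "b \<le> n ! j" "c = lex (n ! j) a b"
      by (rule lex_cases)
    with assms have ia: "(i, a) \<in> blocks m" and jb: "(j, b) \<in> blocks n" by auto
    obtain i1 a1 j1 b1 where *: "sm_fun \<phi> (i, a) = (i1, a1)" "i1 < length m'" "1 \<le> a1"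
      "sm_fun \<psi> (j, b) = (j1, b1)" "j1 < length n'" "1 \<le> b1"
      by (metis A_hom_funE[OF \<phi> ia] A_hom_funE[OF \<psi> jb])
    have "sm_fun (A_mult_arr \<phi> \<psi>) (rlex (length m) i j, c) = (rlex (length m') i1 j1, lex (n' ! j1) a1 b1)"
      using A_mult_arr_fun[of i a \<phi> j b \<psi>] ia jb ab * D by simp
    then show ?thesis
      using c False assms ab * by (auto simp: A_component_def F_smash_def D rlex_inject)
  qed (use assms in \<open>simp add: A_component_def F_smash_def D\<close>)
  moreover have "sm_fun ?L c = sm_fun ?R c" if "c \<notin> {0..m ! i * n ! j}" for c
    using that assms by (simp add: A_component_def F_smash_def D)
  ultimately have "sm_fun ?L = sm_fun ?R"
    by blast
  then show ?thesis
    using assms by (simp add: A_component_def F_smash_def D)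
qed

text \<open>The common shape of \<open>push_o\<close> and \<open>push_a\<close> of
  \<open>A_diagram X\<close>: \<open>b\<close> gives the basepoints, \<open>p\<close> the action of
  \<open>F_cat\<close> on objects or on morphisms.\<close>

definition A_push :: "(nat \<Rightarrow> 'a) \<Rightarrow> (F_arrow \<Rightarrow> 'a \<Rightarrow> 'a) \<Rightarrow> A_arrow \<Rightarrow> 'a list \<Rightarrow> 'a list" where
  "A_push b p \<phi> xs = map (\<lambda>j.
      if block_preimage (sm_src \<phi>) (sm_fun \<phi>) j = {} then b (sm_tgt \<phi> ! j)
      else p (A_component \<phi> (A_index \<phi> j) j) (xs ! A_index \<phi> j))
    [0..<length (sm_tgt \<phi>)]"

definition list_elems :: "(nat \<Rightarrow> 'a set) \<Rightarrow> nat list \<Rightarrow> 'a list set" where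
  "list_elems S m = {xs. length xs = length m \<and> (\<forall>i < length m. xs ! i \<in> S (m ! i))}"

lemma list_elemsD:
  "xs \<in> list_elems S m \<Longrightarrow> length xs = length m"
  "xs \<in> list_elems S m \<Longrightarrow> i < length m \<Longrightarrow> xs ! i \<in> S (m ! i)"
  by (simp_all add: list_elems_def)

lemma list_elems_append:
  "xs \<in> list_elems S m \<Longrightarrow> ys \<in> list_elems S n \<Longrightarrow> xs @ ys \<in> list_elems S (m @ n)"
  by (auto simp: list_elems_def nth_append)

definition A_block :: "(nat \<Rightarrow> nat) \<Rightarrow> nat list \<Rightarrow> nat list \<Rightarrow> A_arrow" where
  "A_block s m n = SetMap m (\<lambda>(i, a)\<in>blocks m. (s i, a)) n"

text \<open>Besides permuting indices, \<open>s\<close> must preserve block sizes, since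
  \<open>A_block\<close> is the identity inside each block.\<close>

definition block_map :: "(nat \<Rightarrow> nat) \<Rightarrow> nat list \<Rightarrow> nat list \<Rightarrow> bool" where
  "block_map s m n \<longleftrightarrow> m \<in> A_obj \<and> n \<in> A_obj \<and> bij_betw s {..<length m} {..<length n} \<and>
    (\<forall>i < length m. n ! s i = m ! i)"

lemma block_map_less: "block_map s m n \<Longrightarrow> i < length m \<Longrightarrow> s i < length n"
  by (auto simp: block_map_def bij_betw_def)

lemma A_block_fun [simp]:
  "(i, a) \<in> blocks m \<Longrightarrow> sm_fun (A_block s m n) (i, a) = (s i, a)"
  by (simp add: A_block_def)

lemma A_block_src_tgt [simp]: "sm_src (A_block s m n) = m" "sm_tgt (A_block s m n) = n"
  by (simp_all add: A_block_def)

lemma A_block_hom: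
  assumes "block_map s m n"
  shows "A_block s m n \<in> hom A_cat m n"
proof -
  have "SetMap m (\<lambda>u\<in>blocks m. (\<lambda>(i, a). (s i, a)) u) n \<in> hom A_cat m n"
    using assms block_map_less[OF assms]
    by (intro A_homI) (auto simp: block_map_def bij_betw_def inj_on_def)
  then show ?thesis by (simp add: A_block_def)
qed

text \<open>The objects and the morphisms of a \<open>\<Gamma>\<close>-category are two instances.\<close>

locale gamma_set =
  fixes S :: "nat \<Rightarrow> 'a set" and b :: "nat \<Rightarrow> 'a" and p :: "F_arrow \<Rightarrow> 'a \<Rightarrow> 'a"
  assumes b_in: "b n \<in> S n"
    and p_in: "\<lbrakk>\<phi> \<in> hom F_cat m n; x \<in> S m\<rbrakk> \<Longrightarrow> p \<phi> x \<in> S n"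
    and p_idt: "x \<in> S n \<Longrightarrow> p (idt F_cat n) x = x"
    and p_cmp: "\<lbrakk>\<phi> \<in> hom F_cat m n; \<psi> \<in> hom F_cat n k; x \<in> S m\<rbrakk> \<Longrightarrow>
      p (cmp F_cat \<psi> \<phi>) x = p \<psi> (p \<phi> x)"
    and p_zero: "x \<in> S m \<Longrightarrow> p (F_zero m n) x = b n"
begin

text \<open>The basepoint is its own image under \<open>F_zero m m\<close>, and \<phi> after a zero
  map is again a zero map.\<close>

lemma p_basept: "\<phi> \<in> hom F_cat m n \<Longrightarrow> p \<phi> (b m) = b n"
  using p_cmp[OF F_zero_hom, of \<phi> m n "b m" m] p_zero[OF b_in] F_cmp_zero[of \<phi> m n m] b_in[of m]
  by metis

abbreviation push :: "A_arrow \<Rightarrow> 'a list \<Rightarrow> 'a list" where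
  "push \<equiv> A_push b p"

lemma length_push [simp]: "length (push \<phi> xs) = length (sm_tgt \<phi>)"
  by (simp add: A_push_def)

lemma push_nth_empty:
  assumes "\<phi> \<in> hom A_cat m n" "j < length n"
    and "\<forall>i a. (i, a) \<in> blocks m \<longrightarrow> fst (sm_fun \<phi> (i, a)) \<noteq> j"
  shows "push \<phi> xs ! j = b (n ! j)"
proof -
  have "block_preimage m (sm_fun \<phi>) j = {}"
    using assms(3) by (auto simp: block_preimage_def simp del: in_blocks)
  then show ?thesis using A_homD[OF assms(1)] assms(2) by (simp add: A_push_def)
qed

text \<open>The formula holds for every i over which the preimage lies. For a nonempty preimage this
  i is \<open>A_index\<close>; for an empty one the component at i is a zero map, which sends
  everything to the basepoint.\<close>

lemma push_nth:
  assumes \<phi>: "\<phi> \<in> hom A_cat m n" and xs: "xs \<in> list_elems S m" and j: "j < length n"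
    and i: "i < length m"
    and only: "\<forall>i' a. (i', a) \<in> blocks m \<longrightarrow> fst (sm_fun \<phi> (i', a)) = j \<longrightarrow> i' = i"
  shows "push \<phi> xs ! j = p (A_component \<phi> i j) (xs ! i)"
proof (cases "block_preimage m (sm_fun \<phi>) j = {}")
  case True
  have "p (F_zero (m ! i) (n ! j)) (xs ! i) = b (n ! j)"
    using xs i by (intro p_zero) (simp add: list_elemsD)
  moreover have *: "fst (sm_fun \<phi> (i', a)) \<noteq> j" if "(i', a) \<in> blocks m" for i' a
    using True that by (auto simp: block_preimage_def simp del: in_blocks)
  then have "A_component \<phi> i j = F_zero (m ! i) (n ! j)"
    using i by (intro A_component_zero[OF \<phi>]) blast+
  ultimately show ?thesis
    using push_nth_empty[OF \<phi> j] * by simp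
next
  case False
  have sub: "block_preimage m (sm_fun \<phi>) j \<subseteq> {i} \<times> {1..m ! i}"
    using only by (auto simp: block_preimage_def)
  \<comment> \<open>The description has a unique solution because a nonempty preimage cannot lie
    over two different blocks.\<close>
  have "A_index \<phi> j = i"
    unfolding A_index_def A_homD[OF \<phi>]
  proof (rule the_equality)
    fix i' assume "i' < length m \<and> block_preimage m (sm_fun \<phi>) j \<subseteq> {i'} \<times> {1..m ! i'}"
    with sub False show "i' = i" by blast
  qed (use i sub in simp)
  then show ?thesis
    using False j by (simp add: A_push_def A_homD[OF \<phi>])
qed

lemma push_in:
  assumes \<phi>: "\<phi> \<in> hom A_cat m n" and xs: "xs \<in> list_elems S m"
  shows "push \<phi> xs \<in> list_elems S n"
proof -
  have "push \<phi> xs ! j \<in> S (n ! j)" if "j < length n" for j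
    using \<phi>
  proof (cases rule: A_hom_cases[where j = j])
    case empty
    then show ?thesis using push_nth_empty[OF \<phi> that] b_in by simp
  next
    case (block i)
    then show ?thesis
      using push_nth[OF \<phi> xs that block] p_in[OF A_component_hom[OF \<phi> block(1) that]] xs
      by (simp add: list_elemsD)
  qed
  then show ?thesis by (simp add: list_elems_def A_homD[OF \<phi>])
qed

lemma push_idt:
  assumes "m \<in> A_obj" "xs \<in> list_elems S m"
  shows "push (idt A_cat m) xs = xs"
proof (rule nth_equalityI)
  have \<phi>: "idt A_cat m \<in> hom A_cat m m" using assms by (rule_tac A.idt_hom)
  note D = A_homD[OF \<phi>]
  show "length (push (idt A_cat m) xs) = length xs"
    using assms D by (simp add: list_elemsD)
  fix j assume "j < length (push (idt A_cat m) xs)"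
  then have j: "j < length m" using D by simp
  have "A_component (idt A_cat m) j j = idt F_cat (m ! j)"
    using j by (auto simp: A_component_def A_idt F_idt fun_eq_iff)
  moreover have "push (idt A_cat m) xs ! j = p (A_component (idt A_cat m) j j) (xs ! j)"
    using j by (intro push_nth[OF \<phi> assms(2)]) (auto simp: A_idt)
  ultimately show "push (idt A_cat m) xs ! j = xs ! j"
    using assms j by (simp add: p_idt list_elemsD)
qed

text \<open>If \<psi> misses l, both sides are basepoints. If \<psi> reaches l only from j and
  \<phi> misses j, the composite misses l, and on the other side the action preserves the basepoint.
  Otherwise j comes only from some i, and \<open>A_component_cmp\<close> combines with functoriality
  of \<open>p\<close>.\<close>

lemma push_cmp:
  assumes \<phi>: "\<phi> \<in> hom A_cat m n" and \<psi>: "\<psi> \<in> hom A_cat n k" and xs: "xs \<in> list_elems S m"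
  shows "push (cmp A_cat \<psi> \<phi>) xs = push \<psi> (push \<phi> xs)"
proof (rule nth_equalityI)
  have \<psi>\<phi>: "cmp A_cat \<psi> \<phi> \<in> hom A_cat m k" using A.cmp_hom[OF \<phi> \<psi>] .
  note D = A_homD[OF \<psi>\<phi>] A_homD[OF \<psi>]
  show "length (push (cmp A_cat \<psi> \<phi>) xs) = length (push \<psi> (push \<phi> xs))"
    using D by simp
  fix l assume "l < length (push (cmp A_cat \<psi> \<phi>) xs)"
  then have l: "l < length k" using D by simp
  have fn: "\<exists>j b. sm_fun \<phi> (i, a) = (j, b) \<and> (j, b) \<in> blocks n \<and>
      sm_fun (cmp A_cat \<psi> \<phi>) (i, a) = sm_fun \<psi> (j, b)" if "(i, a) \<in> blocks m" for i a
    using A_cmp_fun[OF \<phi> that] A_hom_funE[OF \<phi> that] by (metis in_blocks)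
  show "push (cmp A_cat \<psi> \<phi>) xs ! l = push \<psi> (push \<phi> xs) ! l"
    using \<psi>
  proof (cases rule: A_hom_cases[where j = l])
    case empty
    have "fst (sm_fun (cmp A_cat \<psi> \<phi>) (i, a)) \<noteq> l" if "(i, a) \<in> blocks m" for i a
      using fn[OF that] empty by metis
    then show ?thesis
      using push_nth_empty[OF \<psi> l empty] push_nth_empty[OF \<psi>\<phi> l] by simp
  next
    case (block j)
    note j = block
    have R: "push \<psi> (push \<phi> xs) ! l = p (A_component \<psi> j l) (push \<phi> xs ! j)"
      using push_nth[OF \<psi> push_in[OF \<phi> xs] l block] .
    note hom\<psi> = A_component_hom[OF \<psi> block(1) l]
    show ?thesis
      using \<phi>
    proof (cases rule: A_hom_cases[where j = j])
      case empty
      have "fst (sm_fun (cmp A_cat \<psi> \<phi>) (i, a)) \<noteq> l" if "(i, a) \<in> blocks m" for i a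
        using fn[OF that] empty that block(2) by (metis fst_conv)
      then have "push (cmp A_cat \<psi> \<phi>) xs ! l = b (k ! l)"
        by (intro push_nth_empty[OF \<psi>\<phi> l]) blast
      then show ?thesis
        using R push_nth_empty[OF \<phi> block(1) empty] p_basept[OF hom\<psi>] by simp
    next
      case (block i)
      note i = block
      have "push (cmp A_cat \<psi> \<phi>) xs ! l = p (A_component (cmp A_cat \<psi> \<phi>) i l) (xs ! i)"
      proof (rule push_nth[OF \<psi>\<phi> xs l i(1)], intro allI impI)
        fix i' a assume "(i', a) \<in> blocks m" "fst (sm_fun (cmp A_cat \<psi> \<phi>) (i', a)) = l"
        then show "i' = i"
          using fn[of i' a] i(2) j(2)
          by (metis fst_conv)
      qed
      also have "\<dots> = p (A_component \<psi> j l) (p (A_component \<phi> i j) (xs ! i))"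
        using A_component_cmp[OF \<phi> \<psi> i(1) j(1)] j(2)
        by (simp add: p_cmp[OF A_component_hom[OF \<phi> i(1) j(1)] hom\<psi>] list_elemsD[OF xs] i(1) del: in_blocks)
      also have "\<dots> = push \<psi> (push \<phi> xs) ! l"
        using R push_nth[OF \<phi> xs j(1) i] by simp
      finally show ?thesis .
    qed
  qed
qed

text \<open>A target block on one side is reached only from source blocks on the same side, and the
  component there is that of the corresponding summand. Each coordinate thus reduces to the same
  coordinate of one summand.\<close>

lemma push_sum:
  assumes \<phi>: "\<phi> \<in> hom A_cat m n" and \<psi>: "\<psi> \<in> hom A_cat m' n'"
    and xs: "xs \<in> list_elems S m" and ys: "ys \<in> list_elems S m'"
  shows "push (A_sum \<phi> \<psi>) (xs @ ys) = push \<phi> xs @ push \<psi> ys"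
proof (rule nth_equalityI)
  note D = A_homD[OF \<phi>] A_homD[OF \<psi>]
  note hom = A_sum_hom[OF \<phi> \<psi>]
  note xy = list_elems_append[OF xs ys]
  have len: "length xs = length m" using xs by (simp add: list_elemsD)
  have L: "sm_fun (A_sum \<phi> \<psi>) (i, a) = sm_fun \<phi> (i, a) \<and> fst (sm_fun \<phi> (i, a)) < length n"
    if "(i, a) \<in> blocks m" for i a
    using A_sum_fun_left that D A_hom_fun_less[OF \<phi> that] by metis
  have R: "sm_fun (A_sum \<phi> \<psi>) (length m + i, a) =
      (length n + fst (sm_fun \<psi> (i, a)), snd (sm_fun \<psi> (i, a)))" if "(i, a) \<in> blocks m'" for i a
    using A_sum_fun_right that D by metis
  show "length (push (A_sum \<phi> \<psi>) (xs @ ys)) = length (push \<phi> xs @ push \<psi> ys)"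
    by simp
  fix j assume "j < length (push (A_sum \<phi> \<psi>) (xs @ ys))"
  then have j: "j < length (n @ n')" using D by simp
  show "push (A_sum \<phi> \<psi>) (xs @ ys) ! j = (push \<phi> xs @ push \<psi> ys) ! j"
  proof (cases "j < length n")
    case True
    have only: "(i, a) \<in> blocks m \<and> fst (sm_fun \<phi> (i, a)) = j"
      if "(i, a) \<in> blocks (m @ m')" "fst (sm_fun (A_sum \<phi> \<psi>) (i, a)) = j" for i a
      using that(1)
    proof (cases rule: blocks_append_cases)
      case left
      with that show ?thesis using L by simp
    next
      case (right i')
      with that R[OF right(2)] True show ?thesis by simp
    qed
    from \<phi> have "push (A_sum \<phi> \<psi>) (xs @ ys) ! j = push \<phi> xs ! j"
    proof (cases rule: A_hom_cases[where j = j])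
      case empty
      with only have "push (A_sum \<phi> \<psi>) (xs @ ys) ! j = b ((n @ n') ! j)"
        by (intro push_nth_empty[OF hom j]) metis
      then show ?thesis using push_nth_empty[OF \<phi> True empty] True by (simp add: nth_append)
    next
      case (block i)
      with only have "push (A_sum \<phi> \<psi>) (xs @ ys) ! j = p (A_component (A_sum \<phi> \<psi>) i j) ((xs @ ys) ! i)"
        by (intro push_nth[OF hom xy j]) auto
      moreover have "A_component (A_sum \<phi> \<psi>) i j = A_component \<phi> i j"
        using block(1) True L by (auto simp: A_component_def D fun_eq_iff nth_append)
      ultimately show ?thesis using push_nth[OF \<phi> xs True block] block len by (simp add: nth_append)
    qed
    then show ?thesis using True D by (simp add: nth_append)
  next
    case False
    define j' where "j' = j - length n"
    have j': "j = length n + j'" "j' < length n'" using False j by (auto simp: j'_def)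
    have only: "\<exists>i'. i = length m + i' \<and> (i', a) \<in> blocks m' \<and> fst (sm_fun \<psi> (i', a)) = j'"
      if "(i, a) \<in> blocks (m @ m')" "fst (sm_fun (A_sum \<phi> \<psi>) (i, a)) = j" for i a
      using that(1)
    proof (cases rule: blocks_append_cases)
      case left
      with that show ?thesis using L[OF left] False by simp
    next
      case (right i')
      with that R[OF right(2)] j' show ?thesis by simp
    qed
    from \<psi> have "push (A_sum \<phi> \<psi>) (xs @ ys) ! j = push \<psi> ys ! j'"
    proof (cases rule: A_hom_cases[where j = j'])
      case empty
      with only have "push (A_sum \<phi> \<psi>) (xs @ ys) ! j = b ((n @ n') ! j)"
        by (intro push_nth_empty[OF hom j]) metis
      then show ?thesis using push_nth_empty[OF \<psi> j'(2) empty] j' by (simp add: nth_append)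
    next
      case (block i)
      with only have "push (A_sum \<phi> \<psi>) (xs @ ys) ! j =
          p (A_component (A_sum \<phi> \<psi>) (length m + i) j) ((xs @ ys) ! (length m + i))"
        by (intro push_nth[OF hom xy j]) (simp, metis)
      moreover have "A_component (A_sum \<phi> \<psi>) (length m + i) j = A_component \<psi> i j'"
        using block(1) j' R by (auto simp: A_component_def D fun_eq_iff nth_append)
      ultimately show ?thesis using push_nth[OF \<psi> ys j'(2) block] block len by (simp add: nth_append)
    qed
    then show ?thesis using j' D by (simp add: nth_append)
  qed
qed

text \<open>The component of a block permutation at (i, \<open>s i\<close>) is an identity of
  \<open>F_cat\<close>, and injectivity of \<open>s\<close> makes i the only source.\<close>

lemma push_block:
  assumes s: "block_map s m n" and xs: "xs \<in> list_elems S m" and i: "i < length m"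
  shows "push (A_block s m n) xs ! s i = xs ! i"
proof -
  note hom = A_block_hom[OF s]
  have "push (A_block s m n) xs ! s i = p (A_component (A_block s m n) i (s i)) (xs ! i)"
    using s i by (intro push_nth[OF hom xs block_map_less[OF s i] i])
      (auto simp: block_map_def bij_betw_def inj_on_def)
  also have "A_component (A_block s m n) i (s i) = idt F_cat (m ! i)"
  proof -
    have "sm_fun (A_component (A_block s m n) i (s i)) a = sm_fun (idt F_cat (m ! i)) a" for a
      using i by (cases "a = 0") (auto simp: A_component_def F_idt)
    then have "sm_fun (A_component (A_block s m n) i (s i)) = sm_fun (idt F_cat (m ! i))"
      by blast
    with s i show ?thesis
      by (simp add: block_map_def A_component_def F_idt)
  qed
  finally show ?thesis using xs i by (simp add: p_idt list_elemsD)
qed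

end

section \<open>External products of lists\<close>

definition list_mult ::
    "(nat \<Rightarrow> nat \<Rightarrow> 'a \<Rightarrow> 'a \<Rightarrow> 'a) \<Rightarrow> nat list \<Rightarrow> nat list \<Rightarrow> 'a list \<Rightarrow> 'a list \<Rightarrow> 'a list" where
  "list_mult mu m n x y = rlex_list (length m) (length n) (\<lambda>i j. mu (m ! i) (n ! j) (x ! i) (y ! j))"

lemma length_list_mult [simp]: "length (list_mult mu m n x y) = length m * length n"
  by (simp add: list_mult_def)

lemma list_mult_nth [simp]:
  "i < length m \<Longrightarrow> j < length n \<Longrightarrow>
    list_mult mu m n x y ! rlex (length m) i j = mu (m ! i) (n ! j) (x ! i) (y ! j)"
  by (simp add: list_mult_def)

locale gamma_set_monoid = gamma_set +
  fixes mu :: "nat \<Rightarrow> nat \<Rightarrow> 'a \<Rightarrow> 'a \<Rightarrow> 'a" and e :: 'a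
  assumes mu_in: "\<lbrakk>x \<in> S m; y \<in> S n\<rbrakk> \<Longrightarrow> mu m n x y \<in> S (m * n)"
    and mu_basept_right: "x \<in> S m \<Longrightarrow> mu m n x (b n) = b (m * n)"
    and mu_basept_left: "y \<in> S n \<Longrightarrow> mu m n (b m) y = b (m * n)"
    and mu_natural: "\<lbrakk>\<phi> \<in> hom F_cat m m'; \<psi> \<in> hom F_cat n n'; x \<in> S m; y \<in> S n\<rbrakk> \<Longrightarrow>
      mu m' n' (p \<phi> x) (p \<psi> y) = p (F_smash \<phi> \<psi>) (mu m n x y)"
    and mu_assoc: "\<lbrakk>x \<in> S m; y \<in> S n; z \<in> S k\<rbrakk> \<Longrightarrow>
      mu (m * n) k (mu m n x y) z = mu m (n * k) x (mu n k y z)"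
    and e_in: "e \<in> S 1"
    and mu_unit_left: "x \<in> S n \<Longrightarrow> mu 1 n e x = x"
    and mu_unit_right: "x \<in> S n \<Longrightarrow> mu n 1 x e = x"
begin

lemma list_mult_in:
  assumes "x \<in> list_elems S m" "y \<in> list_elems S n"
  shows "list_mult mu m n x y \<in> list_elems S (A_mult m n)"
  using assms by (auto simp: list_elems_def mu_in elim!: rlex_cases)

text \<open>By \<open>rlex_assoc\<close> both bracketings place the triple (i, j', l) in the same
  position, so associativity of \<open>mu\<close> can be applied entry by entry.\<close>

lemma list_mult_assoc:
  assumes "x \<in> list_elems S m" "y \<in> list_elems S n" "z \<in> list_elems S k"
  shows "list_mult mu (A_mult m n) k (list_mult mu m n x y) z =
    list_mult mu m (A_mult n k) x (list_mult mu n k y z)"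
proof (rule rlex_list_eqI[where p = "length m" and q = "length n * length k"])
  fix i j assume i: "i < length m" and "j < length n * length k"
  then obtain j' l where j: "j' < length n" "l < length k" "j = rlex (length n) j' l"
    by (metis rlex_cases)
  have "list_mult mu (A_mult m n) k (list_mult mu m n x y) z ! rlex (length (A_mult m n)) (rlex (length m) i j') l =
      mu (m ! i * n ! j') (k ! l) (mu (m ! i) (n ! j') (x ! i) (y ! j')) (z ! l)"
    using i j by (subst list_mult_nth) (auto simp: rlex_less)
  moreover have "list_mult mu m (A_mult n k) x (list_mult mu n k y z) ! rlex (length m) i j =
      mu (m ! i) (n ! j' * k ! l) (x ! i) (mu (n ! j') (k ! l) (y ! j') (z ! l))"
    using i j by (subst list_mult_nth) (auto simp: rlex_less)
  ultimately show "list_mult mu (A_mult m n) k (list_mult mu m n x y) z ! rlex (length m) i j =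
      list_mult mu m (A_mult n k) x (list_mult mu n k y z) ! rlex (length m) i j"
    using i j assms by (simp add: rlex_assoc list_elemsD mu_assoc)
qed auto

lemma list_mult_unit_left:
  assumes "x \<in> list_elems S n"
  shows "list_mult mu [1] n [e] x = x"
proof (rule nth_equalityI)
  fix j assume "j < length (list_mult mu [1] n [e] x)"
  then have "j < length n" by simp
  with assms show "list_mult mu [1] n [e] x ! j = x ! j"
    using list_mult_nth[of 0 "[1]" j n mu "[e]" x] mu_unit_left by (simp add: rlex_def list_elemsD)
qed (use assms in \<open>simp add: list_elemsD\<close>)

lemma list_mult_unit_right:
  assumes "x \<in> list_elems S n"
  shows "list_mult mu n [1] x [e] = x"
proof (rule nth_equalityI)
  fix i assume "i < length (list_mult mu n [1] x [e])"
  then have "i < length n" by simp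
  with assms show "list_mult mu n [1] x [e] ! i = x ! i"
    using list_mult_nth[of i n 0 "[1]" mu x "[e]"] mu_unit_right by (simp add: rlex_def list_elemsD)
qed (use assms in \<open>simp add: list_elemsD\<close>)

text \<open>If one factor misses its target block, so does the product map, and \<open>mu\<close>
  collapses on the wedge. If neither does, the component is a smash product of components and
  naturality of \<open>mu\<close> applies.\<close>

lemma push_mult:
  assumes \<phi>: "\<phi> \<in> hom A_cat m m'" and \<psi>: "\<psi> \<in> hom A_cat n n'"
    and x: "x \<in> list_elems S m" and y: "y \<in> list_elems S n"
  shows "push (A_mult_arr \<phi> \<psi>) (list_mult mu m n x y) = list_mult mu m' n' (push \<phi> x) (push \<psi> y)"
proof (rule rlex_list_eqI)
  note D = A_homD[OF \<phi>] A_homD[OF \<psi>]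
  note hom = A_mult_arr_hom[OF \<phi> \<psi>]
  show "length (push (A_mult_arr \<phi> \<psi>) (list_mult mu m n x y)) = length m' * length n'"
    "length (list_mult mu m' n' (push \<phi> x) (push \<psi> y)) = length m' * length n'"
    using D by simp_all
  fix i' j' assume i': "i' < length m'" and j': "j' < length n'"
  define k' where "k' = rlex (length m') i' j'"
  have k': "k' < length (A_mult m' n')" using i' j' by (simp add: rlex_less k'_def)
  have nth: "A_mult m' n' ! k' = m' ! i' * n' ! j'" using i' j' by (simp add: k'_def)
  \<comment> \<open>Reaching block k' means reaching i' in the first factor and j' in the second.
    This yields an empty preimage as soon as one factor has one, and the single source block (i, j)
    otherwise.\<close>
  have only: "\<exists>i a j b. (i, a) \<in> blocks m \<and> (j, b) \<in> blocks n \<and> k = rlex (length m) i j \<and>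
      fst (sm_fun \<phi> (i, a)) = i' \<and> fst (sm_fun \<psi> (j, b)) = j'"
    if kc: "(k, c) \<in> blocks (A_mult m n)" and eq: "fst (sm_fun (A_mult_arr \<phi> \<psi>) (k, c)) = k'" for k c
  proof -
    obtain i a j b where *: "(i, a) \<in> blocks m" "(j, b) \<in> blocks n"
      "k = rlex (length m) i j" "c = lex (n ! j) a b"
      using kc by (rule blocks_A_mult_cases)
    have "fst (sm_fun \<phi> (i, a)) < length m'"
      using A_hom_fun_less[OF \<phi> *(1)] .
    then show ?thesis
      using * eq i' A_mult_arr_fun[of i a \<phi> j b \<psi>] D
      by (metis fst_conv k'_def rlex_inject)
  qed
  have R: "list_mult mu m' n' (push \<phi> x) (push \<psi> y) ! k' =
      mu (m' ! i') (n' ! j') (push \<phi> x ! i') (push \<psi> y ! j')"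
    using i' j' by (simp add: k'_def)
  have xi: "push \<phi> x ! i' \<in> S (m' ! i')" and yj: "push \<psi> y ! j' \<in> S (n' ! j')"
    using push_in[OF \<phi> x] push_in[OF \<psi> y] i' j' by (simp_all add: list_elemsD)
  from \<phi> have "push (A_mult_arr \<phi> \<psi>) (list_mult mu m n x y) ! k' =
    list_mult mu m' n' (push \<phi> x) (push \<psi> y) ! k'"
  proof (cases rule: A_hom_cases[where j = i'])
    case empty
    then have "push (A_mult_arr \<phi> \<psi>) (list_mult mu m n x y) ! k' = b (m' ! i' * n' ! j')"
      using only by (subst push_nth_empty[OF hom k']) (metis, simp add: nth)
    then show ?thesis
      using R push_nth_empty[OF \<phi> i' empty] mu_basept_left[OF yj] by simp
  next
    case (block i)
    note i = block
    from \<psi> show ?thesis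
    proof (cases rule: A_hom_cases[where j = j'])
      case empty
      then have "push (A_mult_arr \<phi> \<psi>) (list_mult mu m n x y) ! k' = b (m' ! i' * n' ! j')"
        using only by (subst push_nth_empty[OF hom k']) (metis, simp add: nth)
      then show ?thesis
        using R push_nth_empty[OF \<psi> j' empty] mu_basept_right[OF xi] by simp
    next
      case (block j)
      note j = block
      have "push (A_mult_arr \<phi> \<psi>) (list_mult mu m n x y) ! k' =
          p (A_component (A_mult_arr \<phi> \<psi>) (rlex (length m) i j) k') (list_mult mu m n x y ! rlex (length m) i j)"
        using i j only by (intro push_nth[OF hom list_mult_in[OF x y] k']) (simp add: rlex_less, metis)
      also have "\<dots> = p (F_smash (A_component \<phi> i i') (A_component \<psi> j j'))
          (mu (m ! i) (n ! j) (x ! i) (y ! j))"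
        using i j i' j' by (simp add: k'_def A_component_mult[OF \<phi> \<psi>])
      also have "\<dots> = mu (m' ! i') (n' ! j') (p (A_component \<phi> i i') (x ! i)) (p (A_component \<psi> j j') (y ! j))"
        using i j i' j' x y A_component_hom[OF \<phi>] A_component_hom[OF \<psi>]
        by (intro mu_natural[symmetric]) (auto simp: list_elemsD)
      also have "\<dots> = list_mult mu m' n' (push \<phi> x) (push \<psi> y) ! k'"
        using R push_nth[OF \<phi> x i' i] push_nth[OF \<psi> y j' j] by simp
      finally show ?thesis .
    qed
  qed
  then show "push (A_mult_arr \<phi> \<psi>) (list_mult mu m n x y) ! rlex (length m') i' j' =
    list_mult mu m' n' (push \<phi> x) (push \<psi> y) ! rlex (length m') i' j'"
    by (simp add: k'_def)
qed

end


section \<open>Products of categories\<close>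

lemma homD: "f \<in> hom C x y \<Longrightarrow> f \<in> arr C \<and> src C f = x \<and> tgt C f = y"
  by (simp add: hom_def)

lemma prod_cat_simps [simp]:
  "obj (prod_cat C D) = obj C \<times> obj D"
  "arr (prod_cat C D) = arr C \<times> arr D"
  "src (prod_cat C D) = map_prod (src C) (src D)"
  "tgt (prod_cat C D) = map_prod (tgt C) (tgt D)"
  "idt (prod_cat C D) = map_prod (idt C) (idt D)"
  "cmp (prod_cat C D) (g, g') (f, f') = (cmp C g f, cmp D g' f')"
  by (simp_all add: prod_cat_def)

lemma hom_prod_cat [simp]:
  "(f, g) \<in> hom (prod_cat C D) (x, y) (x', y') \<longleftrightarrow> f \<in> hom C x x' \<and> g \<in> hom D y y'"
  by (auto simp: hom_def)

lemma category_prod_cat: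
  assumes "category C" "category D"
  shows "category (prod_cat C D)"
proof -
  interpret C: category C by fact
  interpret D: category D by fact
  show ?thesis
    by unfold_locales
      (auto simp: C.src_obj D.src_obj C.tgt_obj D.tgt_obj C.idt_hom D.idt_hom C.cmp_idt_left
        D.cmp_idt_left C.cmp_idt_right D.cmp_idt_right
        intro: C.cmp_hom D.cmp_hom C.cmp_assoc D.cmp_assoc)
qed

lemma bifunctorI:
  assumes "category C" "category D" "category E"
    and "\<And>x y. \<lbrakk>x \<in> obj C; y \<in> obj D\<rbrakk> \<Longrightarrow> Fo x y \<in> obj E"
    and "\<And>f g x x' y y'. \<lbrakk>f \<in> hom C x x'; g \<in> hom D y y'\<rbrakk> \<Longrightarrow> Fa f g \<in> hom E (Fo x y) (Fo x' y')"
    and "\<And>x y. \<lbrakk>x \<in> obj C; y \<in> obj D\<rbrakk> \<Longrightarrow> Fa (idt C x) (idt D y) = idt E (Fo x y)"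
    and "\<And>f f' g g' x x' x'' y y' y''. \<lbrakk>f \<in> hom C x x'; f' \<in> hom C x' x''; g \<in> hom D y y'; g' \<in> hom D y' y''\<rbrakk>
      \<Longrightarrow> Fa (cmp C f' f) (cmp D g' g) = cmp E (Fa f' g') (Fa f g)"
  shows "cat_functor (prod_cat C D) E (case_prod Fo) (case_prod Fa)"
proof -
  interpret P: category "prod_cat C D" using assms(1,2) by (rule category_prod_cat)
  interpret E: category E by fact
  show ?thesis
  proof (unfold_locales; clarsimp)
    fix x y assume "x \<in> obj C" "y \<in> obj D"
    then show "Fo x y \<in> obj E" "Fa (idt C x) (idt D y) = idt E (Fo x y)" using assms by auto
  next
    fix f g x y x' y' assume "f \<in> hom C x x'" "g \<in> hom D y y'"
    then show "Fa f g \<in> hom E (Fo x y) (Fo x' y')" using assms by auto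
  next
    fix f g f' g' x y x' y' x'' y''
    assume "f \<in> hom C x x'" "g \<in> hom D y y'" "f' \<in> hom C x' x''" "g' \<in> hom D y' y''"
    then show "Fa (cmp C f' f) (cmp D g' g) = cmp E (Fa f' g') (Fa f g)" using assms(7) by blast
  qed
qed

lemma bifunctorD:
  assumes "cat_functor (prod_cat C D) E (case_prod Fo) (case_prod Fa)"
  shows "\<lbrakk>x \<in> obj C; y \<in> obj D\<rbrakk> \<Longrightarrow> Fo x y \<in> obj E"
    and "\<lbrakk>f \<in> hom C x x'; g \<in> hom D y y'\<rbrakk> \<Longrightarrow> Fa f g \<in> hom E (Fo x y) (Fo x' y')"
    and "\<lbrakk>x \<in> obj C; y \<in> obj D\<rbrakk> \<Longrightarrow> Fa (idt C x) (idt D y) = idt E (Fo x y)"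
    and "\<lbrakk>f \<in> hom C x x'; f' \<in> hom C x' x''; g \<in> hom D y y'; g' \<in> hom D y' y''\<rbrakk>
      \<Longrightarrow> Fa (cmp C f' f) (cmp D g' g) = cmp E (Fa f' g') (Fa f g)"
  using cat_functor.Fo_obj[OF assms, of "(x, y)"] cat_functor.Fa_hom[OF assms, of "(f, g)" "(x, y)" "(x', y')"]
    cat_functor.Fa_idt[OF assms, of "(x, y)"]
    cat_functor.Fa_cmp[OF assms, of "(f, g)" "(x, y)" "(x', y')" "(f', g')" "(x'', y'')"]
  by auto

lemma list_prod_cat_obj:
  "xs \<in> obj (list_prod_cat (map F m)) \<longleftrightarrow> xs \<in> list_elems (\<lambda>n. obj (F n)) m"
  by (auto simp: list_prod_cat_def list_elems_def list_all2_conv_all_nth)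

lemma list_prod_cat_arr:
  "fs \<in> arr (list_prod_cat (map F m)) \<longleftrightarrow> fs \<in> list_elems (\<lambda>n. arr (F n)) m"
  by (auto simp: list_prod_cat_def list_elems_def list_all2_conv_all_nth)

lemma list_prod_cat_nth [simp]:
  "\<lbrakk>i < length m; length xs = length m\<rbrakk> \<Longrightarrow> idt (list_prod_cat (map F m)) xs ! i = idt (F (m ! i)) (xs ! i)"
  "\<lbrakk>i < length m; length gs = length m; length fs = length m\<rbrakk> \<Longrightarrow>
    cmp (list_prod_cat (map F m)) gs fs ! i = cmp (F (m ! i)) (gs ! i) (fs ! i)"
  by (simp_all add: list_prod_cat_def)

lemma list_prod_cat_length [simp]:
  "length xs = length m \<Longrightarrow> length (idt (list_prod_cat (map F m)) xs) = length m"
  "\<lbrakk>length gs = length m; length fs = length m\<rbrakk> \<Longrightarrow> length (cmp (list_prod_cat (map F m)) gs fs) = length m"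
  by (simp_all add: list_prod_cat_def)

lemma list_prod_cat_append:
  "length xs = length m \<Longrightarrow> idt (list_prod_cat (map F (m @ n))) (xs @ ys) =
    idt (list_prod_cat (map F m)) xs @ idt (list_prod_cat (map F n)) ys"
  "\<lbrakk>length gs = length m; length fs = length m\<rbrakk> \<Longrightarrow>
    cmp (list_prod_cat (map F (m @ n))) (gs @ gs') (fs @ fs') =
    cmp (list_prod_cat (map F m)) gs fs @ cmp (list_prod_cat (map F n)) gs' fs'"
  by (simp_all add: list_prod_cat_def)

text \<open>Sources and targets are formed with \<open>map2\<close>, which truncates to the shorter
  list; the three explicit lengths keep the entrywise description faithful.\<close>

lemma hom_list_prod_cat:
  fixes F :: "nat \<Rightarrow> ('o, 'm) cat"
  shows "fs \<in> hom (list_prod_cat (map F m)) xs ys \<longleftrightarrow>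
    length fs = length m \<and> length xs = length m \<and> length ys = length m \<and>
    (\<forall>i < length m. fs ! i \<in> hom (F (m ! i)) (xs ! i) (ys ! i))"
proof
  assume "fs \<in> hom (list_prod_cat (map F m)) xs ys"
  then have *: "fs \<in> list_elems (\<lambda>n. arr (F n)) m" "xs = map2 src (map F m) fs" "ys = map2 tgt (map F m) fs"
    by (auto simp: hom_def list_prod_cat_arr) (auto simp: list_prod_cat_def)
  then show "length fs = length m \<and> length xs = length m \<and> length ys = length m \<and>
    (\<forall>i < length m. fs ! i \<in> hom (F (m ! i)) (xs ! i) (ys ! i))"
    by (auto simp: list_elems_def hom_def)
next
  assume *: "length fs = length m \<and> length xs = length m \<and> length ys = length m \<and>
    (\<forall>i < length m. fs ! i \<in> hom (F (m ! i)) (xs ! i) (ys ! i))"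
  then have "fs \<in> arr (list_prod_cat (map F m))"
    by (auto simp: list_prod_cat_arr list_elems_def hom_def)
  moreover have "map2 src (map F m) fs = xs" "map2 tgt (map F m) fs = ys"
    using * by (auto simp: hom_def intro!: nth_equalityI)
  ultimately show "fs \<in> hom (list_prod_cat (map F m)) xs ys"
    by (simp add: hom_def) (simp add: list_prod_cat_def)
qed

lemma category_list_prod_cat:
  fixes F :: "nat \<Rightarrow> ('o, 'm) cat"
  assumes F: "\<And>n. category (F n)"
  shows "category (list_prod_cat (map F m))" (is "category ?L")
proof
  fix f assume "f \<in> arr ?L"
  then have "f \<in> hom ?L (src ?L f) (tgt ?L f)" by (simp add: hom_def)
  then show "src ?L f \<in> obj ?L" "tgt ?L f \<in> obj ?L"
    using category.hom_obj[OF F] by (auto simp: hom_list_prod_cat list_prod_cat_obj list_elems_def)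
next
  fix a assume "a \<in> obj ?L"
  then show "idt ?L a \<in> hom ?L a a"
    using category.idt_hom[OF F] by (simp add: hom_list_prod_cat list_prod_cat_obj list_elems_def)
next
  fix f a b g c assume "f \<in> hom ?L a b" "g \<in> hom ?L b c"
  then show "cmp ?L g f \<in> hom ?L a c"
    using category.cmp_hom[OF F] by (fastforce simp: hom_list_prod_cat)
next
  fix f a b assume "f \<in> hom ?L a b"
  then show "cmp ?L (idt ?L b) f = f" "cmp ?L f (idt ?L a) = f"
    using category.cmp_idt_left[OF F] category.cmp_idt_right[OF F]
    by (auto simp: hom_list_prod_cat intro!: nth_equalityI)
next
  fix f a b g c h d assume "f \<in> hom ?L a b" "g \<in> hom ?L b c" "h \<in> hom ?L c d"
  then show "cmp ?L h (cmp ?L g f) = cmp ?L (cmp ?L h g) f"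
    by (auto simp: hom_list_prod_cat intro!: nth_equalityI) (metis category.cmp_assoc[OF F])
qed


section \<open>The Grothendieck construction\<close>

lemma grothendieck_simps [simp]:
  "obj (grothendieck B F) = (SIGMA b : obj B. obj (fib F b))"
  "idt (grothendieck B F) (b, x) = Gr x (idt B b) (idt (fib F b) x) x"
  "gr_src (cmp (grothendieck B F) v u) = gr_src u"
  "gr_tgt (cmp (grothendieck B F) v u) = gr_tgt v"
  "gr_base (cmp (grothendieck B F) v u) = cmp B (gr_base v) (gr_base u)"
  "gr_fib (cmp (grothendieck B F) v u) =
    cmp (fib F (tgt B (gr_base v))) (gr_fib v) (push_a F (gr_base v) (gr_fib u))"
  by (simp_all add: grothendieck_def)

lemma hom_grothendieck:
  "u \<in> hom (grothendieck B F) (b, x) (c, y) \<longleftrightarrow>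
    gr_src u = x \<and> gr_tgt u = y \<and> gr_base u \<in> hom B b c \<and> x \<in> obj (fib F b) \<and> y \<in> obj (fib F c) \<and>
    gr_fib u \<in> hom (fib F c) (push_o F (gr_base u) x) y"
  by (cases u) (auto simp: hom_def grothendieck_def)

text \<open>For associativity, the fibre parts of both composites are w after the push of v along w
  after the push of u along the composite base map. One side splits a pushed composite by
  functoriality of each pushforward, the other splits a pushforward along a composite.\<close>

lemma (in cat_valued_functor) category_grothendieck: "category (grothendieck \<B> F)"
proof
  let ?G = "grothendieck \<B> F"
  note push_hom = cat_functor.Fa_hom[OF push_functor]
  have dec: "u \<in> hom ?G (src ?G u) (tgt ?G u)" if "u \<in> arr ?G" for u
    using that by (simp add: hom_def)
  { fix u assume "u \<in> arr ?G"
    from dec[OF this] show "src ?G u \<in> obj ?G" "tgt ?G u \<in> obj ?G"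
      using base.hom_obj by (cases "src ?G u"; cases "tgt ?G u"; fastforce simp: hom_grothendieck)+ }
  { fix a assume "a \<in> obj ?G"
    then show "idt ?G a \<in> hom ?G a a"
      by (cases a) (auto simp: hom_grothendieck base.idt_hom push_o_idt intro: category.idt_hom[OF fib_category]) }
  { fix u a b v c assume u: "u \<in> hom ?G a b" and v: "v \<in> hom ?G b c"
    obtain m x n y k z where abc: "a = (m, x)" "b = (n, y)" "c = (k, z)" by (cases a; cases b; cases c)
    note u = u[unfolded abc hom_grothendieck] and v = v[unfolded abc hom_grothendieck]
    have k: "k \<in> obj \<B>" using v base.hom_obj by blast
    \<comment> \<open>Pushing along v after u agrees with pushing along the composite, so this arrow
      starts at the object demanded of a fibre component over the composite base.\<close>
    have "push_a F (gr_base v) (gr_fib u) \<in>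
        hom (fib F k) (push_o F (cmp \<B> (gr_base v) (gr_base u)) x) (push_o F (gr_base v) y)"
      using push_hom[of "gr_base v" n k "gr_fib u"] push_o_cmp[of "gr_base u" m n "gr_base v" k x] u v by simp
    then show "cmp ?G v u \<in> hom ?G a c"
      using category.cmp_hom[OF fib_category[OF k]] base.cmp_hom u v homD[of "gr_base v" \<B> n k]
      by (auto simp: abc hom_grothendieck) }
  { fix u a b assume u: "u \<in> hom ?G a b"
    obtain m x n y where ab: "a = (m, x)" "b = (n, y)" by (cases a; cases b)
    note u = u[unfolded ab hom_grothendieck]
    have n: "m \<in> obj \<B>" "n \<in> obj \<B>" using u base.hom_obj by blast+
    interpret N: category "fib F n" by (rule fib_category[OF n(2)])
    interpret U: cat_functor "fib F m" "fib F n" "push_o F (gr_base u)" "push_a F (gr_base u)"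
      using u by (intro push_functor) auto
    have t: "tgt \<B> (idt \<B> n) = n" "tgt \<B> (gr_base u) = n"
      using homD[OF base.idt_hom[OF n(2)]] homD[of "gr_base u" \<B> m n] u by auto
    have p: "push_a F (idt \<B> n) (gr_fib u) = gr_fib u"
      using push_a_idt[OF n(2)] u homD by metis
    have "cmp (fib F n) (idt (fib F n) y) (gr_fib u) = gr_fib u"
      using u by (intro N.cmp_idt_left) auto
    moreover have "cmp \<B> (idt \<B> n) (gr_base u) = gr_base u"
      using u by (intro base.cmp_idt_left) auto
    ultimately show "cmp ?G (idt ?G b) u = u"
      using u by (intro gr_arrow.expand) (simp add: ab t p)
    have "cmp (fib F n) (gr_fib u) (push_a F (gr_base u) (idt (fib F m) x)) = gr_fib u"
      using u by (subst U.Fa_idt, simp) (intro N.cmp_idt_right, auto)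
    moreover have "cmp \<B> (gr_base u) (idt \<B> m) = gr_base u"
      using u by (intro base.cmp_idt_right) auto
    ultimately show "cmp ?G u (idt ?G a) = u"
      using u by (intro gr_arrow.expand) (simp add: ab t) }
  { fix u a b v c w d assume u: "u \<in> hom ?G a b" and v: "v \<in> hom ?G b c" and w: "w \<in> hom ?G c d"
    obtain m x n y k z l t where abc: "a = (m, x)" "b = (n, y)" "c = (k, z)" "d = (l, t)"
      by (cases a; cases b; cases c; cases d)
    note u = u[unfolded abc hom_grothendieck] and v = v[unfolded abc hom_grothendieck]
      and w = w[unfolded abc hom_grothendieck]
    have l: "l \<in> obj \<B>" using w base.hom_obj by blast
    interpret N: category "fib F l" by (rule fib_category[OF l])
    interpret V: cat_functor "fib F n" "fib F k" "push_o F (gr_base v)" "push_a F (gr_base v)"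
      using v by (intro push_functor) auto
    interpret W: cat_functor "fib F k" "fib F l" "push_o F (gr_base w)" "push_a F (gr_base w)"
      using w by (intro push_functor) auto
    have t: "tgt \<B> (gr_base w) = l" "tgt \<B> (gr_base v) = k" "tgt \<B> (cmp \<B> (gr_base w) (gr_base v)) = l"
      using w v homD base.cmp_hom[of "gr_base v" n k "gr_base w" l] by fastforce+
    have fu: "push_a F (gr_base v) (gr_fib u) \<in> hom (fib F k) (push_o F (gr_base v) (push_o F (gr_base u) x)) (push_o F (gr_base v) y)"
      using u by (intro V.Fa_hom) auto
    have "push_a F (gr_base w) (cmp (fib F k) (gr_fib v) (push_a F (gr_base v) (gr_fib u))) =
      cmp (fib F l) (push_a F (gr_base w) (gr_fib v)) (push_a F (gr_base w) (push_a F (gr_base v) (gr_fib u)))"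
      using v by (intro W.Fa_cmp[OF fu]) auto
    moreover have "push_a F (cmp \<B> (gr_base w) (gr_base v)) (gr_fib u) = push_a F (gr_base w) (push_a F (gr_base v) (gr_fib u))"
      using u v w homD[of "gr_fib u" "fib F n"] by (intro push_a_cmp) auto
    moreover have "cmp (fib F l) (gr_fib w) (cmp (fib F l) (push_a F (gr_base w) (gr_fib v)) (push_a F (gr_base w) (push_a F (gr_base v) (gr_fib u)))) =
      cmp (fib F l) (cmp (fib F l) (gr_fib w) (push_a F (gr_base w) (gr_fib v))) (push_a F (gr_base w) (push_a F (gr_base v) (gr_fib u)))"
      using w v by (intro N.cmp_assoc[OF W.Fa_hom[OF fu] W.Fa_hom]) auto
    moreover have "cmp \<B> (gr_base w) (cmp \<B> (gr_base v) (gr_base u)) = cmp \<B> (cmp \<B> (gr_base w) (gr_base v)) (gr_base u)"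
      using u v w by (intro base.cmp_assoc) auto
    ultimately show "cmp ?G w (cmp ?G v u) = cmp ?G (cmp ?G w v) u"
      by (intro gr_arrow.expand) (simp add: t) }
qed


section \<open>The category \<open>\<P> X\<close>\<close>

lemma A_diagram_simps:
  "fib (A_diagram X) m = list_prod_cat (map (fib X) m)"
  "push_o (A_diagram X) = A_push (basept X) (push_o X)"
  "push_a (A_diagram X) = A_push (\<lambda>n. idt (fib X n) (basept X n)) (push_a X)"
  by (simp_all add: A_diagram_def A_push_def[abs_def])

context gamma_category
begin

abbreviation "ob n \<equiv> obj (fib X n)"
abbreviation "ar n \<equiv> arr (fib X n)"
abbreviation "bid n \<equiv> idt (fib X n) (basept X n)"
abbreviation "list_cat m \<equiv> list_prod_cat (map (fib X) m)"

lemma cat_fib: "category (fib X n)"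
  by (rule fib_category) (simp add: F_cat_def)

lemma functor_push: "\<phi> \<in> hom F_cat m n \<Longrightarrow> cat_functor (fib X m) (fib X n) (push_o X \<phi>) (push_a X \<phi>)"
  by (rule push_functor)

lemma ob_0: "ob 0 = {THE a. a \<in> ob 0}"
  using theI'[of "\<lambda>a. a \<in> ob 0"] fib_0_terminal unfolding terminal_cat_def by blast

lemma ar_0: "ar 0 = {idt (fib X 0) (THE a. a \<in> ob 0)}"
proof -
  interpret Z: category "fib X 0" by (rule cat_fib)
  have "idt (fib X 0) (THE a. a \<in> ob 0) \<in> ar 0"
    using ob_0 by (intro Z.idt_arr) blast
  then show ?thesis
    using fib_0_terminal unfolding terminal_cat_def by blast
qed

lemma basept_eq: "basept X n = push_o X (F_zero 0 n) (THE a. a \<in> ob 0)"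
  by (simp add: basept_def F_zero_def)

text \<open>The identity at the basepoint is itself the image of the only morphism over 0. Thus
  morphisms form a pointed functor in exactly the way objects do.\<close>

lemma bid_eq: "bid n = push_a X (F_zero 0 n) (idt (fib X 0) (THE a. a \<in> ob 0))"
proof -
  interpret cat_functor "fib X 0" "fib X n" "push_o X (F_zero 0 n)" "push_a X (F_zero 0 n)"
    by (rule functor_push[OF F_zero_hom])
  show ?thesis using ob_0 by (subst Fa_idt) (auto simp: basept_eq)
qed

sublocale o: gamma_set ob "basept X" "push_o X"
proof
  show in': "push_o X \<phi> x \<in> ob n" if "\<phi> \<in> hom F_cat m n" "x \<in> ob m" for \<phi> m n x
    using cat_functor.Fo_obj[OF functor_push] that .
  show "basept X n \<in> ob n" for n
    unfolding basept_eq using ob_0 by (intro in'[OF F_zero_hom]) blast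
  show "push_o X (idt F_cat n) x = x" if "x \<in> ob n" for n x
    using that by (intro push_o_idt) (simp add: F_cat_def)
  show cmp: "push_o X (cmp F_cat \<psi> \<phi>) x = push_o X \<psi> (push_o X \<phi> x)"
    if "\<phi> \<in> hom F_cat m n" "\<psi> \<in> hom F_cat n k" "x \<in> ob m" for \<phi> \<psi> m n k x
    using that by (rule push_o_cmp)
  \<comment> \<open>The zero map is factored through 0; after the first factor every x has become
    the single object there.\<close>
  show "push_o X (F_zero m n) x = basept X n" if "x \<in> ob m" for m n x
    using cmp[OF F_zero_hom[of m 0] F_zero_hom[of 0 n] that] in'[OF F_zero_hom[of m 0] that]
      F_cmp_zero[OF F_zero_hom[of 0 n], of m] ob_0 unfolding basept_eq
    by (metis singletonD)
qed

sublocale a: gamma_set ar bid "push_a X"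
proof
  show in': "push_a X \<phi> x \<in> ar n" if "\<phi> \<in> hom F_cat m n" "x \<in> ar m" for \<phi> m n x
    using cat_functor.Fa_hom[OF functor_push[OF that(1)] category.hom_src_tgt[OF cat_fib that(2)]]
    by (simp add: hom_def)
  show "bid n \<in> ar n" for n
    using o.b_in by (rule category.idt_arr[OF cat_fib])
  show "push_a X (idt F_cat n) x = x" if "x \<in> ar n" for n x
    using that by (intro push_a_idt) (simp add: F_cat_def)
  show cmp: "push_a X (cmp F_cat \<psi> \<phi>) x = push_a X \<psi> (push_a X \<phi> x)"
    if "\<phi> \<in> hom F_cat m n" "\<psi> \<in> hom F_cat n k" "x \<in> ar m" for \<phi> \<psi> m n k x
    using that by (rule push_a_cmp)
  show "push_a X (F_zero m n) x = bid n" if "x \<in> ar m" for m n x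
    using cmp[OF F_zero_hom[of m 0] F_zero_hom[of 0 n] that] in'[OF F_zero_hom[of m 0] that]
      F_cmp_zero[OF F_zero_hom[of 0 n], of m] ar_0 unfolding bid_eq
    by (metis singletonD)
qed

lemma cat_list: "category (list_cat m)"
  by (rule category_list_prod_cat[OF cat_fib])

lemma bid_hom: "bid n \<in> hom (fib X n) (basept X n) (basept X n)"
  using category.idt_hom[OF cat_fib o.b_in] .

lemma list_hom_elems:
  assumes "f \<in> hom (list_cat m) x y"
  shows "f \<in> list_elems ar m" "x \<in> list_elems ob m" "y \<in> list_elems ob m"
  using assms category.hom_obj[OF cat_list assms] homD[OF assms]
  by (auto simp: list_prod_cat_obj list_prod_cat_arr)

lemma push_hom:
  assumes \<phi>: "\<phi> \<in> hom A_cat m n" and f: "f \<in> hom (list_cat m) x y"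
  shows "a.push \<phi> f \<in> hom (list_cat n) (o.push \<phi> x) (o.push \<phi> y)"
proof -
  note el = list_hom_elems[OF f]
  have "a.push \<phi> f ! j \<in> hom (fib X (n ! j)) (o.push \<phi> x ! j) (o.push \<phi> y ! j)" if j: "j < length n" for j
    using \<phi>
  proof (cases rule: A_hom_cases[where j = j])
    case empty
    then show ?thesis
      using bid_hom by (simp add: a.push_nth_empty[OF \<phi> j empty] o.push_nth_empty[OF \<phi> j empty])
  next
    case (block i)
    then show ?thesis
      unfolding a.push_nth[OF \<phi> el(1) j block] o.push_nth[OF \<phi> el(2) j block] o.push_nth[OF \<phi> el(3) j block]
      using f by (intro cat_functor.Fa_hom[OF functor_push[OF A_component_hom[OF \<phi> block(1) j]]])
        (simp add: hom_list_prod_cat)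
  qed
  then show ?thesis using A_homD[OF \<phi>] by (simp add: hom_list_prod_cat)
qed

lemma push_idt_list:
  assumes \<phi>: "\<phi> \<in> hom A_cat m n" and x: "x \<in> list_elems ob m"
  shows "a.push \<phi> (idt (list_cat m) x) = idt (list_cat n) (o.push \<phi> x)"
proof (rule nth_equalityI)
  have el: "idt (list_cat m) x \<in> list_elems ar m"
    using category.idt_arr[OF cat_list] x by (simp add: list_prod_cat_obj list_prod_cat_arr)
  note D = A_homD[OF \<phi>] and len = list_elemsD(1)[OF x]
  show "length (a.push \<phi> (idt (list_cat m) x)) = length (idt (list_cat n) (o.push \<phi> x))"
    using D by simp
  fix j assume "j < length (a.push \<phi> (idt (list_cat m) x))"
  then have j: "j < length n" using D by simp
  show "a.push \<phi> (idt (list_cat m) x) ! j = idt (list_cat n) (o.push \<phi> x) ! j"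
    using \<phi>
  proof (cases rule: A_hom_cases[where j = j])
    case empty
    then show ?thesis using j D
      by (simp add: a.push_nth_empty[OF \<phi> j empty] o.push_nth_empty[OF \<phi> j empty])
  next
    case (block i)
    then show ?thesis
      using j D len cat_functor.Fa_idt[OF functor_push[OF A_component_hom[OF \<phi> block(1) j]] list_elemsD(2)[OF x block(1)]]
      by (simp add: a.push_nth[OF \<phi> el j block] o.push_nth[OF \<phi> x j block])
  qed
qed

lemma push_cmp_list:
  assumes \<phi>: "\<phi> \<in> hom A_cat m n" and f: "f \<in> hom (list_cat m) x y" and g: "g \<in> hom (list_cat m) y z"
  shows "a.push \<phi> (cmp (list_cat m) g f) = cmp (list_cat n) (a.push \<phi> g) (a.push \<phi> f)"
proof (rule nth_equalityI)
  note D = A_homD[OF \<phi>] and elf = list_hom_elems[OF f] and elg = list_hom_elems[OF g]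
  note elgf = list_hom_elems[OF category.cmp_hom[OF cat_list f g]]
  show "length (a.push \<phi> (cmp (list_cat m) g f)) = length (cmp (list_cat n) (a.push \<phi> g) (a.push \<phi> f))"
    using D by simp
  fix j assume "j < length (a.push \<phi> (cmp (list_cat m) g f))"
  then have j: "j < length n" using D by simp
  show "a.push \<phi> (cmp (list_cat m) g f) ! j = cmp (list_cat n) (a.push \<phi> g) (a.push \<phi> f) ! j"
    using \<phi>
  proof (cases rule: A_hom_cases[where j = j])
    case empty
    then show ?thesis using j D category.cmp_idt_left[OF cat_fib bid_hom]
      by (simp add: a.push_nth_empty[OF \<phi> j empty])
  next
    case (block i)
    have "f ! i \<in> hom (fib X (m ! i)) (x ! i) (y ! i)" "g ! i \<in> hom (fib X (m ! i)) (y ! i) (z ! i)"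
      using f g block by (simp_all add: hom_list_prod_cat)
    from cat_functor.Fa_cmp[OF functor_push[OF A_component_hom[OF \<phi> block(1) j]] this]
    show ?thesis
      using j D block list_elemsD(1)[OF elf(1)] list_elemsD(1)[OF elg(1)]
      by (simp add: a.push_nth[OF \<phi> elf(1) j block] a.push_nth[OF \<phi> elg(1) j block] a.push_nth[OF \<phi> elgf(1) j block])
  qed
qed

text \<open>Two kinds of functoriality meet: each pushforward is a functor between product
  categories, and pushforward respects identities and composition in \<open>A_cat\<close>. The
  latter comes from the \<open>gamma_set\<close> instances for objects and for morphisms.\<close>

lemma A_diagram_functor: "cat_valued_functor A_cat (A_diagram X)"
proof (rule cat_valued_functor.intro[OF category_A_cat], rule cat_valued_functor_axioms.intro)
  fix \<phi> m n assume \<phi>: "\<phi> \<in> hom A_cat m n"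
  interpret M: category "list_cat m" by (rule cat_list)
  interpret N: category "list_cat n" by (rule cat_list)
  show "cat_functor (fib (A_diagram X) m) (fib (A_diagram X) n) (push_o (A_diagram X) \<phi>) (push_a (A_diagram X) \<phi>)"
    unfolding A_diagram_simps
    by unfold_locales
      (use \<phi> in \<open>auto simp: list_prod_cat_obj push_idt_list intro: o.push_in push_hom push_cmp_list\<close>)
qed (auto simp: A_diagram_simps cat_list list_prod_cat_obj list_prod_cat_arr o.push_idt a.push_idt
    o.push_cmp a.push_cmp)

lemma P_obj_iff: "A \<in> obj (P_cat X) \<longleftrightarrow> fst A \<in> A_obj \<and> snd A \<in> list_elems ob (fst A)"
  by (cases A) (simp add: P_cat_def A_diagram_simps list_prod_cat_obj)

lemma P_objD:
  assumes "A \<in> obj (P_cat X)"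
  shows "fst A \<in> A_obj" "snd A \<in> list_elems ob (fst A)" "length (snd A) = length (fst A)"
  using assms by (auto simp: P_obj_iff dest: list_elemsD)

lemma P_hom_iff:
  "u \<in> hom (P_cat X) A B \<longleftrightarrow>
    gr_src u = snd A \<and> gr_tgt u = snd B \<and> gr_base u \<in> hom A_cat (fst A) (fst B) \<and>
    A \<in> obj (P_cat X) \<and> B \<in> obj (P_cat X) \<and>
    gr_fib u \<in> hom (list_cat (fst B)) (o.push (gr_base u) (snd A)) (snd B)"
  using A.hom_obj[of "gr_base u" "fst A" "fst B"]
  by (cases A; cases B) (auto simp: P_cat_def A_diagram_simps hom_grothendieck)

lemma P_cmp:
  "gr_src (cmp (P_cat X) v u) = gr_src u"
  "gr_tgt (cmp (P_cat X) v u) = gr_tgt v"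
  "gr_base (cmp (P_cat X) v u) = cmp A_cat (gr_base v) (gr_base u)"
  "gr_fib (cmp (P_cat X) v u) =
    cmp (list_cat (sm_tgt (gr_base v))) (gr_fib v) (a.push (gr_base v) (gr_fib u))"
  by (simp_all add: P_cat_def A_diagram_simps)

lemma P_idt: "idt (P_cat X) A = Gr (snd A) (idt A_cat (fst A)) (idt (list_cat (fst A)) (snd A)) (snd A)"
  by (cases A) (simp add: P_cat_def A_diagram_simps)

sublocale P: category "P_cat X"
  unfolding P_cat_def by (rule cat_valued_functor.category_grothendieck[OF A_diagram_functor])

lemma P_arr_eqI:
  assumes u: "u \<in> hom (P_cat X) A B" and v: "v \<in> hom (P_cat X) A B"
    and "\<And>i a. (i, a) \<in> blocks (fst A) \<Longrightarrow> sm_fun (gr_base u) (i, a) = sm_fun (gr_base v) (i, a)"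
    and "gr_fib u = gr_fib v"
  shows "u = v"
  using u v A_arr_eqI[of "gr_base u" "fst A" "fst B" "gr_base v"] assms(3,4)
  by (intro gr_arrow.expand) (simp add: P_hom_iff)

end


section \<open>Direct sum and product as bifunctors\<close>

lemma A_sum_fun:
  assumes "\<phi> \<in> hom A_cat m n"
  shows "(i, a) \<in> blocks m \<Longrightarrow> sm_fun (A_sum \<phi> \<psi>) (i, a) = sm_fun \<phi> (i, a)"
    and "\<lbrakk>\<psi> \<in> hom A_cat m' n'; (j, a) \<in> blocks m'\<rbrakk> \<Longrightarrow> sm_fun (A_sum \<phi> \<psi>) (length m + j, a) =
      (length n + fst (sm_fun \<psi> (j, a)), snd (sm_fun \<psi> (j, a)))"
  using A_sum_fun_left[of i a \<phi> \<psi>] A_sum_fun_right[of j a \<psi> \<phi>] A_homD[OF assms] A_homD[of \<psi> m' n'] by simp_all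

lemma A_idt_fun: "(i, a) \<in> blocks m \<Longrightarrow> sm_fun (idt A_cat m) (i, a) = (i, a)"
  by (simp add: A_idt)

lemma A_idt_src_tgt [simp]: "sm_src (idt A_cat m) = m" "sm_tgt (idt A_cat m) = m"
  by (simp_all add: A_idt)

lemma A_cmp_src_tgt [simp]:
  "sm_src (cmp A_cat \<psi> \<phi>) = sm_src \<phi>" "sm_tgt (cmp A_cat \<psi> \<phi>) = sm_tgt \<psi>"
  by (simp_all add: A_cmp)

lemma A_sum_idt:
  assumes "m \<in> A_obj" "n \<in> A_obj"
  shows "A_sum (idt A_cat m) (idt A_cat n) = idt A_cat (m @ n)"
proof (rule A_arr_eqI)
  note m = A.idt_hom[OF assms(1)] and n = A.idt_hom[OF assms(2)]
  show "A_sum (idt A_cat m) (idt A_cat n) \<in> hom A_cat (m @ n) (m @ n)"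
    using A_sum_hom[OF m n] .
  show "idt A_cat (m @ n) \<in> hom A_cat (m @ n) (m @ n)"
    using assms by (intro A.idt_hom) (simp add: A_append_obj)
  fix i a assume ia: "(i, a) \<in> blocks (m @ n)"
  then show "sm_fun (A_sum (idt A_cat m) (idt A_cat n)) (i, a) = sm_fun (idt A_cat (m @ n)) (i, a)"
    unfolding A_idt_fun[OF ia]
    by (cases rule: blocks_append_cases)
      (simp_all only: A_sum_fun(1)[OF m] A_sum_fun(2)[OF m n] A_idt_fun fst_conv snd_conv)
qed

lemma A_sum_cmp:
  assumes \<phi>: "\<phi> \<in> hom A_cat m n" and \<psi>: "\<psi> \<in> hom A_cat n k"
    and \<phi>': "\<phi>' \<in> hom A_cat m' n'" and \<psi>': "\<psi>' \<in> hom A_cat n' k'"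
  shows "A_sum (cmp A_cat \<psi> \<phi>) (cmp A_cat \<psi>' \<phi>') = cmp A_cat (A_sum \<psi> \<psi>') (A_sum \<phi> \<phi>')"
proof (rule A_arr_eqI)
  note c = A.cmp_hom[OF \<phi> \<psi>] and c' = A.cmp_hom[OF \<phi>' \<psi>']
  show "A_sum (cmp A_cat \<psi> \<phi>) (cmp A_cat \<psi>' \<phi>') \<in> hom A_cat (m @ m') (k @ k')"
    by (rule A_sum_hom[OF c c'])
  show "cmp A_cat (A_sum \<psi> \<psi>') (A_sum \<phi> \<phi>') \<in> hom A_cat (m @ m') (k @ k')"
    by (rule A.cmp_hom[OF A_sum_hom[OF \<phi> \<phi>'] A_sum_hom[OF \<psi> \<psi>']])
  fix i a assume ia: "(i, a) \<in> blocks (m @ m')"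
  then show "sm_fun (A_sum (cmp A_cat \<psi> \<phi>) (cmp A_cat \<psi>' \<phi>')) (i, a) =
      sm_fun (cmp A_cat (A_sum \<psi> \<psi>') (A_sum \<phi> \<phi>')) (i, a)"
    unfolding A_cmp_fun[OF A_sum_hom[OF \<phi> \<phi>'] ia]
  proof (cases rule: blocks_append_cases)
    case left
    then show "sm_fun (A_sum (cmp A_cat \<psi> \<phi>) (cmp A_cat \<psi>' \<phi>')) (i, a) =
        sm_fun (A_sum \<psi> \<psi>') (sm_fun (A_sum \<phi> \<phi>') (i, a))"
      using A_sum_fun(1)[OF \<psi> A_hom_fun_in[OF \<phi> left]]
      by (simp only: A_sum_fun(1)[OF c] A_sum_fun(1)[OF \<phi>] A_cmp_fun[OF \<phi>] prod.collapse)
  next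
    case (right j)
    then show "sm_fun (A_sum (cmp A_cat \<psi> \<phi>) (cmp A_cat \<psi>' \<phi>')) (i, a) =
        sm_fun (A_sum \<psi> \<psi>') (sm_fun (A_sum \<phi> \<phi>') (i, a))"
      using A_sum_fun(2)[OF \<psi> \<psi>' A_hom_fun_in[OF \<phi>' right(2)]]
      by (simp only: A_sum_fun(2)[OF c c'] A_sum_fun(2)[OF \<phi> \<phi>'] A_cmp_fun[OF \<phi>'] prod.collapse)
  qed
qed

lemma A_sum_assoc:
  assumes \<phi>: "\<phi> \<in> hom A_cat m n" and \<psi>: "\<psi> \<in> hom A_cat m' n'" and \<chi>: "\<chi> \<in> hom A_cat m'' n''"
  shows "A_sum (A_sum \<phi> \<psi>) \<chi> = A_sum \<phi> (A_sum \<psi> \<chi>)"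
proof (rule A_arr_eqI)
  note l = A_sum_hom[OF \<phi> \<psi>] and r = A_sum_hom[OF \<psi> \<chi>]
  show "A_sum (A_sum \<phi> \<psi>) \<chi> \<in> hom A_cat (m @ m' @ m'') (n @ n' @ n'')"
    using A_sum_hom[OF l \<chi>] by simp
  show "A_sum \<phi> (A_sum \<psi> \<chi>) \<in> hom A_cat (m @ m' @ m'') (n @ n' @ n'')"
    by (rule A_sum_hom[OF \<phi> r])
  fix i a assume "(i, a) \<in> blocks (m @ m' @ m'')"
  then show "sm_fun (A_sum (A_sum \<phi> \<psi>) \<chi>) (i, a) = sm_fun (A_sum \<phi> (A_sum \<psi> \<chi>)) (i, a)"
  proof (cases rule: blocks_append_cases)
    case left
    then have "(i, a) \<in> blocks (m @ m')" by (auto simp: nth_append)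
    with left show ?thesis by (simp only: A_sum_fun(1)[OF l] A_sum_fun(1)[OF \<phi>])
  next
    case (right j)
    note j = right
    from right(2) show ?thesis
    proof (cases rule: blocks_append_cases)
      case left
      then have "(length m + j, a) \<in> blocks (m @ m')" by (auto simp: nth_append)
      with left j show ?thesis
        by (simp only: A_sum_fun(1)[OF l] A_sum_fun(2)[OF \<phi> \<psi>] A_sum_fun(2)[OF \<phi> r] A_sum_fun(1)[OF \<psi>])
    next
      case (right j')
      with j have i: "i = length (m @ m') + j'" by simp
      show ?thesis
        unfolding i A_sum_fun(2)[OF l \<chi> right(2)]
        using A_sum_fun(2)[OF \<phi> r j(2)] A_sum_fun(2)[OF \<psi> \<chi> right(2)] right j by (simp add: add.assoc)
    qed
  qed
qed

lemma A_sum_unit: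
  assumes \<phi>: "\<phi> \<in> hom A_cat m n"
  shows "A_sum (idt A_cat []) \<phi> = \<phi>" "A_sum \<phi> (idt A_cat []) = \<phi>"
proof -
  have e: "idt A_cat [] \<in> hom A_cat [] []"
    by (rule A.idt_hom) (simp add: A_obj_iff)
  show "A_sum (idt A_cat []) \<phi> = \<phi>"
    using A_sum_hom[OF e \<phi>] A_sum_fun(2)[OF e \<phi>] by (intro A_arr_eqI[OF _ \<phi>]) simp_all
  show "A_sum \<phi> (idt A_cat []) = \<phi>"
    using A_sum_hom[OF \<phi> e] A_sum_fun(1)[OF \<phi>] by (intro A_arr_eqI[OF _ \<phi>]) simp_all
qed

section \<open>Products of morphisms of sequences: functoriality, associativity, unit\<close>

lemma A_mult_fun:
  assumes \<phi>: "\<phi> \<in> hom A_cat m m'" and \<psi>: "\<psi> \<in> hom A_cat n n'"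
    and "(i, a) \<in> blocks m" "(j, b) \<in> blocks n"
  shows "sm_fun (A_mult_arr \<phi> \<psi>) (rlex (length m) i j, lex (n ! j) a b) =
    (rlex (length m') (fst (sm_fun \<phi> (i, a))) (fst (sm_fun \<psi> (j, b))),
     lex (n' ! fst (sm_fun \<psi> (j, b))) (snd (sm_fun \<phi> (i, a))) (snd (sm_fun \<psi> (j, b))))"
  using A_mult_arr_fun[of i a \<phi> j b \<psi>] assms A_homD[OF \<phi>] A_homD[OF \<psi>] by simp

lemma A_mult_eqI:
  assumes "\<phi> \<in> hom A_cat (A_mult m n) k" "\<psi> \<in> hom A_cat (A_mult m n) k"
    and "\<And>i a j b. \<lbrakk>(i, a) \<in> blocks m; (j, b) \<in> blocks n\<rbrakk> \<Longrightarrow>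
      sm_fun \<phi> (rlex (length m) i j, lex (n ! j) a b) = sm_fun \<psi> (rlex (length m) i j, lex (n ! j) a b)"
  shows "\<phi> = \<psi>"
  using assms(1,2) by (rule A_arr_eqI) (metis assms(3) blocks_A_mult_cases)

lemma A_mult_idt:
  assumes "m \<in> A_obj" "n \<in> A_obj"
  shows "A_mult_arr (idt A_cat m) (idt A_cat n) = idt A_cat (A_mult m n)"
proof (rule A_mult_eqI)
  note m = A.idt_hom[OF assms(1)] and n = A.idt_hom[OF assms(2)]
  show "A_mult_arr (idt A_cat m) (idt A_cat n) \<in> hom A_cat (A_mult m n) (A_mult m n)"
    using A_mult_arr_hom[OF m n] .
  show "idt A_cat (A_mult m n) \<in> hom A_cat (A_mult m n) (A_mult m n)"
    using assms by (intro A.idt_hom A_mult_obj)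
  fix i a j b assume ia: "(i, a) \<in> blocks m" and jb: "(j, b) \<in> blocks n"
  show "sm_fun (A_mult_arr (idt A_cat m) (idt A_cat n)) (rlex (length m) i j, lex (n ! j) a b) =
    sm_fun (idt A_cat (A_mult m n)) (rlex (length m) i j, lex (n ! j) a b)"
    unfolding A_mult_fun[OF m n ia jb] A_idt_fun[OF in_blocks_A_mult[OF ia jb]] A_idt_fun[OF ia] A_idt_fun[OF jb]
    by simp
qed

lemma A_mult_cmp:
  assumes \<phi>: "\<phi> \<in> hom A_cat m n" and \<psi>: "\<psi> \<in> hom A_cat n k"
    and \<phi>': "\<phi>' \<in> hom A_cat m' n'" and \<psi>': "\<psi>' \<in> hom A_cat n' k'"
  shows "A_mult_arr (cmp A_cat \<psi> \<phi>) (cmp A_cat \<psi>' \<phi>') = cmp A_cat (A_mult_arr \<psi> \<psi>') (A_mult_arr \<phi> \<phi>')"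
proof (rule A_mult_eqI)
  note c = A.cmp_hom[OF \<phi> \<psi>] and c' = A.cmp_hom[OF \<phi>' \<psi>']
  note p = A_mult_arr_hom[OF \<phi> \<phi>'] and q = A_mult_arr_hom[OF \<psi> \<psi>']
  show "A_mult_arr (cmp A_cat \<psi> \<phi>) (cmp A_cat \<psi>' \<phi>') \<in> hom A_cat (A_mult m m') (A_mult k k')"
    by (rule A_mult_arr_hom[OF c c'])
  show "cmp A_cat (A_mult_arr \<psi> \<psi>') (A_mult_arr \<phi> \<phi>') \<in> hom A_cat (A_mult m m') (A_mult k k')"
    by (rule A.cmp_hom[OF p q])
  fix i a j b assume ia: "(i, a) \<in> blocks m" and jb: "(j, b) \<in> blocks m'"
  show "sm_fun (A_mult_arr (cmp A_cat \<psi> \<phi>) (cmp A_cat \<psi>' \<phi>')) (rlex (length m) i j, lex (m' ! j) a b) =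
    sm_fun (cmp A_cat (A_mult_arr \<psi> \<psi>') (A_mult_arr \<phi> \<phi>')) (rlex (length m) i j, lex (m' ! j) a b)"
    unfolding A_cmp_fun[OF p in_blocks_A_mult[OF ia jb]] A_mult_fun[OF c c' ia jb] A_mult_fun[OF \<phi> \<phi>' ia jb]
      A_mult_fun[OF \<psi> \<psi>' A_hom_fun_in[OF \<phi> ia] A_hom_fun_in[OF \<phi>' jb]]
      A_cmp_fun[OF \<phi> ia] A_cmp_fun[OF \<phi>' jb] prod.collapse ..
qed

text \<open>A point of a triple product has the same code in both bracketings, by
  \<open>rlex_assoc\<close> for the block and \<open>lex_assoc\<close> for the entry. The same two
  identities then match the codes of the images.\<close>

lemma A_mult_arr_assoc:
  assumes \<phi>: "\<phi> \<in> hom A_cat m n" and \<psi>: "\<psi> \<in> hom A_cat m' n'" and \<chi>: "\<chi> \<in> hom A_cat m'' n''"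
  shows "A_mult_arr (A_mult_arr \<phi> \<psi>) \<chi> = A_mult_arr \<phi> (A_mult_arr \<psi> \<chi>)"
proof (rule A_mult_eqI)
  note l = A_mult_arr_hom[OF \<phi> \<psi>] and r = A_mult_arr_hom[OF \<psi> \<chi>]
  show "A_mult_arr (A_mult_arr \<phi> \<psi>) \<chi> \<in> hom A_cat (A_mult m (A_mult m' m'')) (A_mult n (A_mult n' n''))"
    using A_mult_arr_hom[OF l \<chi>] by (simp only: A_mult_assoc)
  show "A_mult_arr \<phi> (A_mult_arr \<psi> \<chi>) \<in> hom A_cat (A_mult m (A_mult m' m'')) (A_mult n (A_mult n' n''))"
    using A_mult_arr_hom[OF \<phi> r] .
  fix i a j' b' assume ia: "(i, a) \<in> blocks m" and "(j', b') \<in> blocks (A_mult m' m'')"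
  then obtain j b k c where jb: "(j, b) \<in> blocks m'" and kc: "(k, c) \<in> blocks m''"
    and eq: "j' = rlex (length m') j k" "b' = lex (m'' ! k) b c"
    by (metis blocks_A_mult_cases)
  obtain i1 a1 where p: "sm_fun \<phi> (i, a) = (i1, a1)" "i1 < length n" "1 \<le> a1" "a1 \<le> n ! i1"
    by (rule A_hom_funE[OF \<phi> ia])
  obtain j1 b1 where q: "sm_fun \<psi> (j, b) = (j1, b1)" "j1 < length n'" "1 \<le> b1" "b1 \<le> n' ! j1"
    by (rule A_hom_funE[OF \<psi> jb])
  obtain k1 c1 where s: "sm_fun \<chi> (k, c) = (k1, c1)" "k1 < length n''" "1 \<le> c1" "c1 \<le> n'' ! k1"
    by (rule A_hom_funE[OF \<chi> kc])
  \<comment> \<open>The block of the inner product has size \<open>m' ! j * m'' ! k\<close>, which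
    is the multiplier that \<open>lex_assoc\<close> produces.\<close>
  have pt: "(rlex (length m) i j', lex (A_mult m' m'' ! j') a b') =
      (rlex (length (A_mult m m')) (rlex (length m) i j) k, lex (m'' ! k) (lex (m' ! j) a b) c)"
    using ia jb kc by (simp add: eq rlex_assoc lex_assoc)
  have "sm_fun (A_mult_arr (A_mult_arr \<phi> \<psi>) \<chi>) (rlex (length m) i j', lex (A_mult m' m'' ! j') a b') =
      (rlex (length (A_mult n n')) (rlex (length n) i1 j1) k1, lex (n'' ! k1) (lex (n' ! j1) a1 b1) c1)"
    unfolding pt A_mult_fun[OF l \<chi> in_blocks_A_mult[OF ia jb] kc] A_mult_fun[OF \<phi> \<psi> ia jb]
    by (simp add: p q s)
  moreover have "sm_fun (A_mult_arr \<phi> (A_mult_arr \<psi> \<chi>)) (rlex (length m) i j', lex (A_mult m' m'' ! j') a b') =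
      (rlex (length n) i1 (rlex (length n') j1 k1), lex (A_mult n' n'' ! rlex (length n') j1 k1) a1 (lex (n'' ! k1) b1 c1))"
    unfolding eq A_mult_fun[OF \<phi> r ia in_blocks_A_mult[OF jb kc]] A_mult_fun[OF \<psi> \<chi> jb kc]
    by (simp add: p q s)
  ultimately show "sm_fun (A_mult_arr (A_mult_arr \<phi> \<psi>) \<chi>) (rlex (length m) i j', lex (A_mult m' m'' ! j') a b') =
      sm_fun (A_mult_arr \<phi> (A_mult_arr \<psi> \<chi>)) (rlex (length m) i j', lex (A_mult m' m'' ! j') a b')"
    using p q s by (simp add: rlex_assoc lex_assoc)
qed

lemma A_mult_unit: "A_mult [1] m = m" "A_mult m [1] = m"
proof -
  show "A_mult [1] m = m"
    using A_mult_nth[of 0 "[1]" _ m] by (intro nth_equalityI) (simp_all add: rlex_def)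
  show "A_mult m [1] = m"
    using A_mult_nth[of _ m 0 "[1]"] by (intro nth_equalityI) (simp_all add: rlex_def)
qed

lemma A_mult_arr_unit:
  assumes \<phi>: "\<phi> \<in> hom A_cat m n"
  shows "A_mult_arr (idt A_cat [1]) \<phi> = \<phi>" "A_mult_arr \<phi> (idt A_cat [1]) = \<phi>"
proof -
  have e: "idt A_cat [1] \<in> hom A_cat [1] [1]"
    by (rule A.idt_hom) (simp add: A_obj_iff)
  have o: "(0, 1) \<in> blocks [1]" by simp
  have u: "u = (0, 1)" if "u \<in> blocks [1]" for u
    using that by (cases u) auto
  note idf = A_idt_fun[OF o]
  show "A_mult_arr (idt A_cat [1]) \<phi> = \<phi>"
  proof (rule A_mult_eqI[of _ "[1]" m n])
    fix i a j b assume "(i, a) \<in> blocks [1]" and jb: "(j, b) \<in> blocks m"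
    with u have ia: "i = 0" "a = 1" by blast+
    show "sm_fun (A_mult_arr (idt A_cat [1]) \<phi>) (rlex (length [1]) i j, lex (m ! j) a b) =
        sm_fun \<phi> (rlex (length [1]) i j, lex (m ! j) a b)"
      unfolding ia using A_mult_fun[OF e \<phi> o jb] idf by (simp add: rlex_def lex_def)
  qed (use A_mult_arr_hom[OF e \<phi>] \<phi> in \<open>simp_all only: A_mult_unit\<close>)
  show "A_mult_arr \<phi> (idt A_cat [1]) = \<phi>"
  proof (rule A_mult_eqI[of _ m "[1]" n])
    fix j b i a assume "(i, a) \<in> blocks [1]" and jb: "(j, b) \<in> blocks m"
    with u have ia: "i = 0" "a = 1" by blast+
    \<comment> \<open>The entry \<open>lex 1 b 1\<close> is (b - 1) + 1 with truncated subtraction,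
      so its equality with b uses positivity. The same is needed of the image entry.\<close>
    have "1 \<le> b" using jb by simp
    moreover have "1 \<le> snd (sm_fun \<phi> (j, b))" using A_hom_fun_in[OF \<phi> jb] by (simp only: in_blocks)
    ultimately show "sm_fun (A_mult_arr \<phi> (idt A_cat [1])) (rlex (length m) j i, lex ([1] ! i) b a) =
        sm_fun \<phi> (rlex (length m) j i, lex ([1] ! i) b a)"
      unfolding ia A_mult_fun[OF \<phi> e jb o] idf by (simp add: rlex_def lex_def)
  qed (use A_mult_arr_hom[OF \<phi> e] \<phi> in \<open>simp_all only: A_mult_unit\<close>)
qed

lemma A_mult_Nil [simp]: "A_mult [] n = []" "A_mult m [] = []"
  by (simp_all add: A_mult_def rlex_list_def)

lemma list_mult_Nil [simp]: "list_mult mu [] n x y = []" "list_mult mu m [] x y = []"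
  by (simp_all add: list_mult_def rlex_list_def)

lemma P_sum_a_simps [simp]:
  "gr_src (P_sum_a u v) = gr_src u @ gr_src v" "gr_tgt (P_sum_a u v) = gr_tgt u @ gr_tgt v"
  "gr_base (P_sum_a u v) = A_sum (gr_base u) (gr_base v)" "gr_fib (P_sum_a u v) = gr_fib u @ gr_fib v"
  by (simp_all add: P_sum_a_def)

lemma P_sum_o_simps [simp]:
  "fst (P_sum_o A B) = fst A @ fst B" "snd (P_sum_o A B) = snd A @ snd B"
  by (simp_all add: P_sum_o_def)

lemma P_mult_o_simps [simp]:
  "fst (P_mult_o mu A B) = A_mult (fst A) (fst B)"
  "snd (P_mult_o mu A B) = list_mult mu (fst A) (fst B) (snd A) (snd B)"
  by (simp_all add: P_mult_o_def list_mult_def case_prod_beta)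

lemma P_mult_a_simps [simp]:
  "gr_src (P_mult_a mu_o mu_a u v) =
    list_mult mu_o (sm_src (gr_base u)) (sm_src (gr_base v)) (gr_src u) (gr_src v)"
  "gr_tgt (P_mult_a mu_o mu_a u v) =
    list_mult mu_o (sm_tgt (gr_base u)) (sm_tgt (gr_base v)) (gr_tgt u) (gr_tgt v)"
  "gr_base (P_mult_a mu_o mu_a u v) = A_mult_arr (gr_base u) (gr_base v)"
  "gr_fib (P_mult_a mu_o mu_a u v) =
    list_mult mu_a (sm_tgt (gr_base u)) (sm_tgt (gr_base v)) (gr_fib u) (gr_fib v)"
  by (simp_all add: P_mult_a_def list_mult_def Let_def)

section \<open>The sum as a strict monoidal structure\<close>

context gamma_category
begin

lemma P_homD:
  assumes "u \<in> hom (P_cat X) A B"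
  shows "gr_src u = snd A" "gr_tgt u = snd B" "gr_base u \<in> hom A_cat (fst A) (fst B)"
    "sm_src (gr_base u) = fst A" "sm_tgt (gr_base u) = fst B"
    "A \<in> obj (P_cat X)" "B \<in> obj (P_cat X)"
    "gr_fib u \<in> hom (list_cat (fst B)) (o.push (gr_base u) (snd A)) (snd B)"
    "gr_fib u \<in> list_elems ar (fst B)" "length (gr_fib u) = length (fst B)"
  using assms A_homD[of "gr_base u" "fst A" "fst B"]
  by (auto simp: P_hom_iff dest: list_hom_elems list_elemsD)

lemma P_idt_simps [simp]:
  "gr_src (idt (P_cat X) A) = snd A" "gr_tgt (idt (P_cat X) A) = snd A"
  "gr_base (idt (P_cat X) A) = idt A_cat (fst A)"
  "gr_fib (idt (P_cat X) A) = idt (list_cat (fst A)) (snd A)"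
  by (simp_all add: P_idt)

lemma list_hom_append:
  "\<lbrakk>f \<in> hom (list_cat m) x y; g \<in> hom (list_cat n) x' y'\<rbrakk> \<Longrightarrow>
    f @ g \<in> hom (list_cat (m @ n)) (x @ x') (y @ y')"
  unfolding hom_list_prod_cat by (auto simp: nth_append)

lemma P_sum_obj: "\<lbrakk>A \<in> obj (P_cat X); B \<in> obj (P_cat X)\<rbrakk> \<Longrightarrow> P_sum_o A B \<in> obj (P_cat X)"
  by (simp add: P_obj_iff A_append_obj list_elems_append)

lemma P_sum_hom:
  assumes "u \<in> hom (P_cat X) A A'" "v \<in> hom (P_cat X) B B'"
  shows "P_sum_a u v \<in> hom (P_cat X) (P_sum_o A B) (P_sum_o A' B')"
proof -
  note u = P_homD[OF assms(1)] and v = P_homD[OF assms(2)]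
  show ?thesis
    using list_hom_append[OF u(8) v(8)] u v P_objD(2)[OF u(6)] P_objD(2)[OF v(6)]
    by (simp add: P_hom_iff P_sum_obj A_sum_hom o.push_sum)
qed

lemma P_sum_functor:
  "cat_functor (prod_cat (P_cat X) (P_cat X)) (P_cat X) (case_prod P_sum_o) (case_prod P_sum_a)"
proof (rule bifunctorI)
  show "P_sum_a (idt (P_cat X) A) (idt (P_cat X) B) = idt (P_cat X) (P_sum_o A B)"
    if "A \<in> obj (P_cat X)" "B \<in> obj (P_cat X)" for A B
    using P_objD[OF that(1)] P_objD[OF that(2)]
    by (intro gr_arrow.expand) (simp add: A_sum_idt list_prod_cat_append del: map_append)
next
  fix f f' g g' A A' A'' B B' B''
  assume f: "f \<in> hom (P_cat X) A A'" and f': "f' \<in> hom (P_cat X) A' A''"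
    and g: "g \<in> hom (P_cat X) B B'" and g': "g' \<in> hom (P_cat X) B' B''"
  note F = P_homD[OF f] and F' = P_homD[OF f'] and G = P_homD[OF g] and G' = P_homD[OF g']
  show "P_sum_a (cmp (P_cat X) f' f) (cmp (P_cat X) g' g) = cmp (P_cat X) (P_sum_a f' g') (P_sum_a f g)"
    using F F' G G' A_sum_cmp[OF F(3) F'(3) G(3) G'(3)] a.push_sum[OF F'(3) G'(3) F(9) G(9)]
    by (intro gr_arrow.expand) (simp add: P_cmp list_prod_cat_append del: map_append)
qed (auto intro: P.category_axioms P_sum_obj P_sum_hom)

lemma P_sum_monoidal: "strict_monoidal_category (P_cat X) P_sum_o P_sum_a P_zero"
proof (intro strict_monoidal_category.intro strict_monoidal_category_axioms.intro P_sum_functor P.category_axioms)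
  show "P_zero \<in> obj (P_cat X)"
    by (simp add: P_obj_iff P_zero_def A_obj_iff list_elems_def)
  show "P_sum_a (P_sum_a f g) h = P_sum_a f (P_sum_a g h)"
    if "f \<in> arr (P_cat X)" "g \<in> arr (P_cat X)" "h \<in> arr (P_cat X)" for f g h
    using that[THEN P.hom_src_tgt, THEN P_homD(3)]
    by (intro gr_arrow.expand) (simp add: A_sum_assoc)
  show "P_sum_a (idt (P_cat X) P_zero) f = f" "P_sum_a f (idt (P_cat X) P_zero) = f"
    if "f \<in> arr (P_cat X)" for f
    using P_homD(3)[OF P.hom_src_tgt[OF that]]
    by (intro gr_arrow.expand; simp add: P_zero_def A_sum_unit list_prod_cat_def)+
qed (simp_all add: P_sum_o_def P_zero_def)

end

section \<open>The product as a strict monoidal structure\<close>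

context gamma_monoid
begin

lemmas mu_hom = bifunctorD(2)[OF mu_functor]
  and mu_idt = bifunctorD(3)[OF mu_functor]
  and mu_cmp = bifunctorD(4)[OF mu_functor]

sublocale o: gamma_set_monoid ob "basept X" "push_o X" mu_o \<eta>
  by unfold_locales
    (use bifunctorD(1)[OF mu_functor] in \<open>auto simp: mu_o_basept_right mu_o_basept_left mu_o_natural mu_o_assoc
      eta_obj[simplified] mu_o_unit_left[simplified] mu_o_unit_right[simplified]\<close>)

sublocale a: gamma_set_monoid ar bid "push_a X" mu_a "idt (fib X 1) \<eta>"
proof
  show "mu_a m n f g \<in> ar (m * n)" if "f \<in> ar m" "g \<in> ar n" for m n f g
    using mu_hom[OF category.hom_src_tgt[OF cat_fib that(1)] category.hom_src_tgt[OF cat_fib that(2)]]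
    by (simp add: hom_def)
  show "idt (fib X 1) \<eta> \<in> ar 1"
    by (rule category.idt_arr[OF cat_fib eta_obj])
qed (fact mu_a_basept_right mu_a_basept_left mu_a_natural mu_a_assoc mu_a_unit_left mu_a_unit_right)+

abbreviation P_tensor_o (infixr "\<otimes>" 70) where "A \<otimes> B \<equiv> P_mult_o mu_o A B"
abbreviation P_tensor_a (infixr "\<otimes>\<^sub>a" 70) where "u \<otimes>\<^sub>a v \<equiv> P_mult_a mu_o mu_a u v"

lemma list_hom_mult:
  assumes "f \<in> hom (list_cat m) x x'" "g \<in> hom (list_cat n) y y'"
  shows "list_mult mu_a m n f g \<in> hom (list_cat (A_mult m n)) (list_mult mu_o m n x y) (list_mult mu_o m n x' y')"
  using assms mu_hom by (auto simp: hom_list_prod_cat elim!: rlex_cases)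

lemma list_mult_idt:
  assumes "x \<in> list_elems ob m" "y \<in> list_elems ob n"
  shows "list_mult mu_a m n (idt (list_cat m) x) (idt (list_cat n) y) = idt (list_cat (A_mult m n)) (list_mult mu_o m n x y)"
  using list_elemsD[OF assms(1)] list_elemsD[OF assms(2)]
  by (intro rlex_list_eqI[of _ "length m" "length n"]) (simp_all add: mu_idt rlex_less)

lemma list_mult_cmp:
  assumes "f \<in> hom (list_cat m) x x'" "f' \<in> hom (list_cat m) x' x''"
    "g \<in> hom (list_cat n) y y'" "g' \<in> hom (list_cat n) y' y''"
  shows "list_mult mu_a m n (cmp (list_cat m) f' f) (cmp (list_cat n) g' g) =
    cmp (list_cat (A_mult m n)) (list_mult mu_a m n f' g') (list_mult mu_a m n f g)"
  using assms unfolding hom_list_prod_cat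
  by (intro rlex_list_eqI[of _ "length m" "length n"]) (auto simp: rlex_less intro!: mu_cmp)

lemma P_mult_obj: "\<lbrakk>A \<in> obj (P_cat X); B \<in> obj (P_cat X)\<rbrakk> \<Longrightarrow> A \<otimes> B \<in> obj (P_cat X)"
  by (simp add: P_obj_iff A_mult_obj o.list_mult_in)

text \<open>The product of the fibre components starts at the product of two pushed lists;
  \<open>push_mult\<close> on objects identifies it with the pushforward of the product
  list.\<close>

lemma P_mult_hom:
  assumes "u \<in> hom (P_cat X) A A'" "v \<in> hom (P_cat X) B B'"
  shows "u \<otimes>\<^sub>a v \<in> hom (P_cat X) (A \<otimes> B) (A' \<otimes> B')"
proof -
  note u = P_homD[OF assms(1)] and v = P_homD[OF assms(2)]
  show ?thesis
    using list_hom_mult[OF u(8) v(8)] u v P_objD(2)[OF u(6)] P_objD(2)[OF v(6)]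
    by (simp add: P_hom_iff P_mult_obj A_mult_arr_hom o.push_mult[OF u(3) v(3)])
qed

text \<open>For composites, functoriality of \<open>mu_a\<close> separates the outer morphisms from
  the pushed inner ones, and \<open>push_mult\<close> on morphisms pulls the pushforward out of the
  product.\<close>

lemma P_mult_functor:
  "cat_functor (prod_cat (P_cat X) (P_cat X)) (P_cat X) (case_prod (P_mult_o mu_o)) (case_prod (P_mult_a mu_o mu_a))"
proof (rule bifunctorI)
  show "idt (P_cat X) A \<otimes>\<^sub>a idt (P_cat X) B = idt (P_cat X) (A \<otimes> B)"
    if "A \<in> obj (P_cat X)" "B \<in> obj (P_cat X)" for A B
    using P_objD[OF that(1)] P_objD[OF that(2)]
    by (intro gr_arrow.expand) (simp add: A_mult_idt list_mult_idt)
next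
  fix f f' g g' A A' A'' B B' B''
  assume f: "f \<in> hom (P_cat X) A A'" and f': "f' \<in> hom (P_cat X) A' A''"
    and g: "g \<in> hom (P_cat X) B B'" and g': "g' \<in> hom (P_cat X) B' B''"
  note F = P_homD[OF f] and F' = P_homD[OF f'] and G = P_homD[OF g] and G' = P_homD[OF g']
  show "cmp (P_cat X) f' f \<otimes>\<^sub>a cmp (P_cat X) g' g = cmp (P_cat X) (f' \<otimes>\<^sub>a g') (f \<otimes>\<^sub>a g)"
    using F F' G G' A_mult_cmp[OF F(3) F'(3) G(3) G'(3)] a.push_mult[OF F'(3) G'(3) F(9) G(9)]
      list_mult_cmp[OF push_hom[OF F'(3) F(8)] F'(8) push_hom[OF G'(3) G(8)] G'(8)]
    by (intro gr_arrow.expand) (simp add: P_cmp)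
qed (auto intro: P.category_axioms P_mult_obj P_mult_hom)

lemma P_mult_monoidal: "strict_monoidal_category (P_cat X) (P_mult_o mu_o) (P_mult_a mu_o mu_a) (P_unit \<eta>)"
proof (intro strict_monoidal_category.intro strict_monoidal_category_axioms.intro P_mult_functor P.category_axioms)
  have eta: "[\<eta>] \<in> list_elems ob [1]"
    using o.e_in by (simp add: list_elems_def)
  show "P_unit \<eta> \<in> obj (P_cat X)"
    using eta by (simp add: P_obj_iff P_unit_def A_obj_iff)
  show "(A \<otimes> B) \<otimes> C = A \<otimes> (B \<otimes> C)"
    if "A \<in> obj (P_cat X)" "B \<in> obj (P_cat X)" "C \<in> obj (P_cat X)" for A B C
    using that[THEN P_objD(2)] by (intro prod_eqI) (simp_all add: A_mult_assoc o.list_mult_assoc)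
  show "P_unit \<eta> \<otimes> A = A" "A \<otimes> P_unit \<eta> = A" if "A \<in> obj (P_cat X)" for A
    using P_objD(2)[OF that] o.list_mult_unit_left o.list_mult_unit_right A_mult_unit
    by (intro prod_eqI; simp add: P_unit_def)+
  show "(f \<otimes>\<^sub>a g) \<otimes>\<^sub>a h = f \<otimes>\<^sub>a (g \<otimes>\<^sub>a h)"
    if "f \<in> arr (P_cat X)" "g \<in> arr (P_cat X)" "h \<in> arr (P_cat X)" for f g h
  proof -
    note f = P_homD[OF P.hom_src_tgt[OF that(1)]] and g = P_homD[OF P.hom_src_tgt[OF that(2)]]
      and h = P_homD[OF P.hom_src_tgt[OF that(3)]]
    show ?thesis
      using f g h P_objD(2) A_mult_arr_assoc[OF f(3) g(3) h(3)] a.list_mult_assoc[OF f(9) g(9) h(9)]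
      by (intro gr_arrow.expand) (simp add: A_mult_assoc o.list_mult_assoc)
  qed
  show "idt (P_cat X) (P_unit \<eta>) \<otimes>\<^sub>a f = f" "f \<otimes>\<^sub>a idt (P_cat X) (P_unit \<eta>) = f"
    if "f \<in> arr (P_cat X)" for f
  proof -
    note f = P_homD[OF P.hom_src_tgt[OF that]]
    have "idt (list_cat [1]) [\<eta>] = [idt (fib X 1) \<eta>]" by (simp add: list_prod_cat_def)
    then show "idt (P_cat X) (P_unit \<eta>) \<otimes>\<^sub>a f = f" "f \<otimes>\<^sub>a idt (P_cat X) (P_unit \<eta>) = f"
      using f P_objD(2) A_mult_arr_unit[OF f(3)] o.list_mult_unit_left o.list_mult_unit_right
        a.list_mult_unit_left[OF f(9)] a.list_mult_unit_right[OF f(9)]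
      by (intro gr_arrow.expand; simp add: P_unit_def)+
  qed
qed

end


section \<open>Block permutations\<close>

lemma A_mult_nth': "\<lbrakk>p = length m; i < p; j < length n\<rbrakk> \<Longrightarrow> A_mult m n ! rlex p i j = m ! i * n ! j"
  by simp

lemma list_mult_nth':
  "\<lbrakk>p = length m; i < p; j < length n\<rbrakk> \<Longrightarrow> list_mult mu m n x y ! rlex p i j = mu (m ! i) (n ! j) (x ! i) (y ! j)"
  by simp

lemma sum_index_cases:
  assumes "k < p + (q :: nat)"
  obtains "k < p" | j where "k = p + j" "j < q"
  using assms by (cases "k < p") (auto simp: not_less le_iff_add)

text \<open>Index map of a sum of block permutations; \<open>p\<close> and \<open>q\<close> are the
  source and target lengths of the first summand.\<close>

definition sum_ix :: "nat \<Rightarrow> nat \<Rightarrow> (nat \<Rightarrow> nat) \<Rightarrow> (nat \<Rightarrow> nat) \<Rightarrow> nat \<Rightarrow> nat" where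
  "sum_ix p q s t k = (if k < p then s k else q + t (k - p))"

text \<open>Index map of a product of block permutations. Only the source and target lengths
  \<open>p\<close>, \<open>q\<close> of the left factor enter, since a reverse lexicographic
  position does not depend on the number of right indices.\<close>

definition mult_ix :: "nat \<Rightarrow> nat \<Rightarrow> (nat \<Rightarrow> nat) \<Rightarrow> (nat \<Rightarrow> nat) \<Rightarrow> nat \<Rightarrow> nat" where
  "mult_ix p q s t k = rlex q (s (k mod p)) (t (k div p))"

definition braid_ix :: "nat \<Rightarrow> nat \<Rightarrow> nat \<Rightarrow> nat" where
  "braid_ix p q k = (if k < p then q + k else k - p)"

text \<open>For left distributivity with lengths \<open>p\<close>, \<open>q\<close>,
  \<open>r\<close>: column j of the target consists of the \<open>p\<close> blocks of column j of
  the first product followed by the \<open>q\<close> blocks of column j of the second.\<close>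

definition dl_ix :: "nat \<Rightarrow> nat \<Rightarrow> nat \<Rightarrow> nat \<Rightarrow> nat" where
  "dl_ix p q r k = (if k < p * r then rlex (p + q) (k mod p) (k div p)
    else rlex (p + q) (p + (k - p * r) mod q) ((k - p * r) div q))"

lemma sum_ix_simps:
  "k < p \<Longrightarrow> sum_ix p q s t k = s k"
  "p = p' \<Longrightarrow> sum_ix p q s t (p' + j) = q + t j"
  "p = p' + p'' \<Longrightarrow> sum_ix p q s t (p' + (p'' + j)) = q + t j"
  by (simp_all add: sum_ix_def)

lemma mult_ix_rlex: "p = p' \<Longrightarrow> i < p \<Longrightarrow> mult_ix p q s t (rlex p' i j) = rlex q (s i) (t j)"
  by (simp add: mult_ix_def)

lemma braid_ix_simps:
  "k < p \<Longrightarrow> braid_ix p q k = q + k"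
  "p = p' \<Longrightarrow> braid_ix p q (p' + j) = j"
  by (simp_all add: braid_ix_def)

lemma dl_ix_simps:
  "\<lbrakk>p = p'; i < p; k < r\<rbrakk> \<Longrightarrow> dl_ix p q r (rlex p' i k) = rlex (p + q) i k"
  "\<lbrakk>p * r = n; q = q'; j < q\<rbrakk> \<Longrightarrow> dl_ix p q r (n + rlex q' j k) = rlex (p + q) (p + j) k"
  by (auto simp: dl_ix_def rlex_less)

text \<open>Increasing the right index by q skips exactly q full columns of length p. This is what
  makes right distributivity an identity.\<close>

lemma rlex_add: "rlex p i (q + j) = p * q + rlex p i j"
  by (simp add: rlex_def algebra_simps)

context gamma_category
begin

section \<open>Calculus of block morphisms\<close>

definition P_block_map :: "(nat \<Rightarrow> nat) \<Rightarrow> 'o P_obj \<Rightarrow> 'o P_obj \<Rightarrow> bool" where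
  "P_block_map s A B \<longleftrightarrow> A \<in> obj (P_cat X) \<and> B \<in> obj (P_cat X) \<and> block_map s (fst A) (fst B) \<and>
    (\<forall>i < length (fst A). snd B ! s i = snd A ! i)"

lemma P_block_simps [simp]:
  "gr_src (P_block X s A B) = snd A" "gr_tgt (P_block X s A B) = snd B"
  "gr_base (P_block X s A B) = A_block s (fst A) (fst B)"
  "gr_fib (P_block X s A B) = idt (list_cat (fst B)) (snd B)"
  by (simp_all add: P_block_def A_block_def A_diagram_simps)

text \<open>Source and target have equally many blocks, so surjectivity already gives a bijection of
  indices.\<close>

lemma P_block_mapI:
  assumes AB: "A \<in> obj (P_cat X)" "B \<in> obj (P_cat X)" "length (fst A) = length (fst B)"
    and s: "\<And>i. i < length (fst A) \<Longrightarrow> s i < length (fst B) \<and> fst B ! s i = fst A ! i \<and> snd B ! s i = snd A ! i"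
    and surj: "\<And>j. j < length (fst B) \<Longrightarrow> \<exists>i < length (fst A). s i = j"
  shows "P_block_map s A B"
proof -
  have "s ` {..<length (fst A)} = {..<length (fst B)}" using s surj by force
  then have "bij_betw s {..<length (fst A)} {..<length (fst B)}"
    using AB(3) by (simp add: bij_betw_def eq_card_imp_inj_on)
  then show ?thesis
    using AB s P_objD(1) by (simp add: P_block_map_def block_map_def)
qed

lemma P_block_mapD:
  assumes "P_block_map s A B"
  shows "A \<in> obj (P_cat X)" "B \<in> obj (P_cat X)" "block_map s (fst A) (fst B)"
    "length (fst B) = length (fst A)"
    "i < length (fst A) \<Longrightarrow> s i < length (fst B)" "i < length (fst A) \<Longrightarrow> fst B ! s i = fst A ! i"
    "i < length (fst A) \<Longrightarrow> snd B ! s i = snd A ! i"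
    "j < length (fst B) \<Longrightarrow> \<exists>i < length (fst A). s i = j"
proof -
  show *: "block_map s (fst A) (fst B)" "A \<in> obj (P_cat X)" "B \<in> obj (P_cat X)"
    using assms by (simp_all add: P_block_map_def)
  then have bij: "bij_betw s {..<length (fst A)} {..<length (fst B)}" by (simp add: block_map_def)
  show "length (fst B) = length (fst A)" using bij_betw_same_card[OF bij] by simp
  show "j < length (fst B) \<Longrightarrow> \<exists>i < length (fst A). s i = j"
    using bij unfolding bij_betw_def by (metis imageE lessThan_iff)
  show "i < length (fst A) \<Longrightarrow> s i < length (fst B)" using block_map_less[OF *(1)] .
  show "i < length (fst A) \<Longrightarrow> fst B ! s i = fst A ! i" using * by (simp add: block_map_def)
  show "i < length (fst A) \<Longrightarrow> snd B ! s i = snd A ! i" using assms by (simp add: P_block_map_def)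
qed

text \<open>This literal equality is what allows an identity to serve as the fibre component of a
  block morphism.\<close>

lemma push_P_block:
  assumes "P_block_map s A B"
  shows "o.push (A_block s (fst A) (fst B)) (snd A) = snd B"
proof (rule nth_equalityI)
  note s = P_block_mapD[OF assms]
  show "length (o.push (A_block s (fst A) (fst B)) (snd A)) = length (snd B)"
    using P_objD[OF s(2)] by simp
  fix j assume "j < length (o.push (A_block s (fst A) (fst B)) (snd A))"
  then obtain i where "i < length (fst A)" "j = s i" using s(8)[of j] by auto
  then show "o.push (A_block s (fst A) (fst B)) (snd A) ! j = snd B ! j"
    using o.push_block[OF s(3) P_objD(2)[OF s(1)]] s(7) by simp
qed

lemma P_block_hom:
  assumes "P_block_map s A B"
  shows "P_block X s A B \<in> hom (P_cat X) A B"
  using P_block_mapD(1-3)[OF assms] category.idt_hom[OF cat_list, of "snd B" "fst B"] P_objD(2)[of B]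
  by (simp add: P_hom_iff push_P_block[OF assms] A_block_hom list_prod_cat_obj)

text \<open>The identity component of the block morphism drops out, leaving the pushforward, which
  only permutes entries.\<close>

lemma gr_fib_block_cmp:
  assumes u: "u \<in> hom (P_cat X) A B" and s: "P_block_map s B C"
  shows "gr_fib (cmp (P_cat X) (P_block X s B C) u) = a.push (A_block s (fst B) (fst C)) (gr_fib u)"
proof -
  note u = P_homD[OF u]
  have "a.push (A_block s (fst B) (fst C)) (gr_fib u) \<in> hom (list_cat (fst C))
      (o.push (A_block s (fst B) (fst C)) (o.push (gr_base u) (snd A))) (snd C)"
    using push_hom[OF A_block_hom[OF P_block_mapD(3)[OF s]] u(8)] by (simp add: push_P_block[OF s])
  from category.cmp_idt_left[OF cat_list this] show ?thesis
    by (simp add: P_cmp)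
qed

text \<open>A pushed identity list is an identity list, so precomposition does not change the fibre
  component.\<close>

lemma gr_fib_cmp_block:
  assumes u: "u \<in> hom (P_cat X) B C" and s: "P_block_map s A B"
  shows "gr_fib (cmp (P_cat X) u (P_block X s A B)) = gr_fib u"
proof -
  note u = P_homD[OF u]
  show ?thesis
    using category.cmp_idt_right[OF cat_list u(8)] u P_objD[OF u(6)]
    by (simp add: P_cmp push_idt_list[OF u(3)])
qed

text \<open>Postcomposing with a block morphism permutes the fibre entries of \<open>u\<close> along
  \<open>t\<close>, and precomposing leaves those of \<open>v\<close> as they are. The square
  therefore commutes once the base maps and the fibre entries correspond under \<open>s\<close> and
  \<open>t\<close>.\<close>

lemma P_block_natural:
  assumes u: "u \<in> hom (P_cat X) A A'" and v: "v \<in> hom (P_cat X) B B'"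
    and s: "P_block_map s A B" and t: "P_block_map t A' B'"
    and base: "\<And>i a. (i, a) \<in> blocks (fst A) \<Longrightarrow>
      sm_fun (gr_base v) (s i, a) = (t (fst (sm_fun (gr_base u) (i, a))), snd (sm_fun (gr_base u) (i, a)))"
    and fib: "\<And>j. j < length (fst A') \<Longrightarrow> gr_fib v ! t j = gr_fib u ! j"
  shows "cmp (P_cat X) (P_block X t A' B') u = cmp (P_cat X) v (P_block X s A B)"
proof (rule P_arr_eqI)
  note u' = P_homD[OF u] and v' = P_homD[OF v] and t' = P_block_mapD[OF t] and s' = P_block_mapD[OF s]
  show "cmp (P_cat X) (P_block X t A' B') u \<in> hom (P_cat X) A B'"
    by (rule P.cmp_hom[OF u P_block_hom[OF t]])
  show "cmp (P_cat X) v (P_block X s A B) \<in> hom (P_cat X) A B'"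
    by (rule P.cmp_hom[OF P_block_hom[OF s] v])
  show "gr_fib (cmp (P_cat X) (P_block X t A' B') u) = gr_fib (cmp (P_cat X) v (P_block X s A B))"
    unfolding gr_fib_block_cmp[OF u t] gr_fib_cmp_block[OF v s]
  proof (rule nth_equalityI)
    fix j assume "j < length (a.push (A_block t (fst A') (fst B')) (gr_fib u))"
    then obtain i where "i < length (fst A')" "j = t i" using t'(8)[of j] by auto
    then show "a.push (A_block t (fst A') (fst B')) (gr_fib u) ! j = gr_fib v ! j"
      using a.push_block[OF t'(3) u'(9)] fib by simp
  qed (use v' in simp)
  fix i a assume ia: "(i, a) \<in> blocks (fst A)"
  show "sm_fun (gr_base (cmp (P_cat X) (P_block X t A' B') u)) (i, a) =
      sm_fun (gr_base (cmp (P_cat X) v (P_block X s A B))) (i, a)"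
    unfolding P_cmp A_cmp_fun[OF u'(3) ia] P_block_simps A_cmp_fun[OF A_block_hom[OF s'(3)] ia]
      A_block_fun[OF ia] base[OF ia]
    using A_block_fun[OF A_hom_fun_in[OF u'(3) ia]] by simp
qed

lemma P_block_cong:
  assumes "\<And>i. i < length (fst A) \<Longrightarrow> s i = t i"
  shows "P_block X s A B = P_block X t A B"
  unfolding P_block_def using assms by (auto simp: fun_eq_iff)

lemma P_block_map_id: "A \<in> obj (P_cat X) \<Longrightarrow> P_block_map (\<lambda>i. i) A A"
  by (rule P_block_mapI) auto

lemma P_block_idt: "idt (P_cat X) A = P_block X (\<lambda>i. i) A A"
  by (intro gr_arrow.expand) (simp add: A_idt A_block_def id_def)

lemma P_block_map_cmp:
  assumes "P_block_map s A B" "P_block_map t B C"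
  shows "P_block_map (\<lambda>i. t (s i)) A C"
  using P_block_mapD[OF assms(1)] P_block_mapD[OF assms(2)]
  by (intro P_block_mapI) (auto, metis)

lemma P_block_cmp:
  assumes s: "P_block_map s A B" and t: "P_block_map t B C"
  shows "cmp (P_cat X) (P_block X t B C) (P_block X s A B) = P_block X (\<lambda>i. t (s i)) A C"
proof (rule P_arr_eqI)
  show "cmp (P_cat X) (P_block X t B C) (P_block X s A B) \<in> hom (P_cat X) A C"
    by (rule P.cmp_hom[OF P_block_hom[OF s] P_block_hom[OF t]])
  show "P_block X (\<lambda>i. t (s i)) A C \<in> hom (P_cat X) A C"
    by (rule P_block_hom[OF P_block_map_cmp[OF s t]])
  show "gr_fib (cmp (P_cat X) (P_block X t B C) (P_block X s A B)) = gr_fib (P_block X (\<lambda>i. t (s i)) A C)"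
    unfolding gr_fib_cmp_block[OF P_block_hom[OF t] s] by simp
  fix i a assume ia: "(i, a) \<in> blocks (fst A)"
  then have "(s i, a) \<in> blocks (fst B)" using P_block_mapD[OF s] by simp
  then show "sm_fun (gr_base (cmp (P_cat X) (P_block X t B C) (P_block X s A B))) (i, a) =
      sm_fun (gr_base (P_block X (\<lambda>i. t (s i)) A C)) (i, a)"
    using A_cmp_fun[OF A_block_hom[OF P_block_mapD(3)[OF s]] ia] ia by (simp add: P_cmp del: in_blocks)
qed

lemma P_block_cmp_eqI:
  assumes "P_block_map s A B" "P_block_map t B C" "P_block_map s' A B'" "P_block_map t' B' C"
    and "\<And>i. i < length (fst A) \<Longrightarrow> t (s i) = t' (s' i)"
  shows "cmp (P_cat X) (P_block X t B C) (P_block X s A B) = cmp (P_cat X) (P_block X t' B' C) (P_block X s' A B')"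
  unfolding P_block_cmp[OF assms(1,2)] P_block_cmp[OF assms(3,4)] using assms(5) by (rule P_block_cong)

lemma P_block_iso:
  assumes s: "P_block_map s A B"
  shows "is_iso (P_cat X) (P_block X s A B)"
proof -
  note s' = P_block_mapD[OF s]
  define t where "t = inv_into {..<length (fst A)} s"
  have bij: "bij_betw s {..<length (fst A)} {..<length (fst B)}"
    using s' by (simp add: block_map_def)
  have ts: "t (s i) = i" if "i < length (fst A)" for i
    using bij_betw_inv_into_left[OF bij] that by (simp add: t_def)
  have st: "s (t j) = j" "t j < length (fst A)" if "j < length (fst B)" for j
    using bij_betw_inv_into_right[OF bij] bij_betwE[OF bij_betw_inv_into[OF bij]] that by (simp_all add: t_def)
  have t: "P_block_map t B A"
    using s' st ts by (intro P_block_mapI) metis+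
  have hom: "P_block X s A B \<in> hom (P_cat X) A B" by (rule P_block_hom[OF s])
  have "cmp (P_cat X) (P_block X t B A) (P_block X s A B) = idt (P_cat X) A"
    unfolding P_block_cmp[OF s t] P_block_idt by (rule P_block_cong) (rule ts)
  moreover have "cmp (P_cat X) (P_block X s A B) (P_block X t B A) = idt (P_cat X) B"
    unfolding P_block_cmp[OF t s] P_block_idt by (rule P_block_cong) (rule st)
  ultimately show ?thesis
    using P_block_hom[OF t] homD[OF hom] unfolding is_iso_def by metis
qed

lemma P_block_map_sum:
  assumes s: "P_block_map s A B" and t: "P_block_map t C D"
  shows "P_block_map (sum_ix (length (fst A)) (length (fst B)) s t) (P_sum_o A C) (P_sum_o B D)"
proof (rule P_block_mapI)
  note s' = P_block_mapD[OF s] and t' = P_block_mapD[OF t]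
  note len = P_objD(3)[OF s'(1)] P_objD(3)[OF s'(2)]
  show "P_sum_o A C \<in> obj (P_cat X)" "P_sum_o B D \<in> obj (P_cat X)"
    using s' t' by (simp_all add: P_sum_obj)
  show "length (fst (P_sum_o A C)) = length (fst (P_sum_o B D))" using s' t' by simp
  fix i assume "i < length (fst (P_sum_o A C))"
  then have "i < length (fst A) + length (fst C)" by simp
  then show "sum_ix (length (fst A)) (length (fst B)) s t i < length (fst (P_sum_o B D)) \<and>
       fst (P_sum_o B D) ! sum_ix (length (fst A)) (length (fst B)) s t i = fst (P_sum_o A C) ! i \<and>
       snd (P_sum_o B D) ! sum_ix (length (fst A)) (length (fst B)) s t i = snd (P_sum_o A C) ! i"
    using s' t' len by (cases rule: sum_index_cases) (simp_all add: sum_ix_simps nth_append trans_less_add1)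
next
  note s' = P_block_mapD[OF s] and t' = P_block_mapD[OF t]
  fix j assume "j < length (fst (P_sum_o B D))"
  then have "j < length (fst B) + length (fst D)" by simp
  then show "\<exists>i < length (fst (P_sum_o A C)). sum_ix (length (fst A)) (length (fst B)) s t i = j"
  proof (cases rule: sum_index_cases)
    case 1
    then obtain i where "i < length (fst A)" "s i = j" using s' by blast
    then show ?thesis by (intro exI[of _ i]) (simp add: sum_ix_simps)
  next
    case (2 j')
    then obtain i where "i < length (fst C)" "t i = j'" using t' by blast
    with 2 show ?thesis by (intro exI[of _ "length (fst A) + i"]) (simp add: sum_ix_simps)
  qed
qed

lemma P_block_sum:
  assumes s: "P_block_map s A B" and t: "P_block_map t C D"
  shows "P_sum_a (P_block X s A B) (P_block X t C D) =
    P_block X (sum_ix (length (fst A)) (length (fst B)) s t) (P_sum_o A C) (P_sum_o B D)"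
proof (rule P_arr_eqI)
  note st = P_block_map_sum[OF s t]
  show "P_sum_a (P_block X s A B) (P_block X t C D) \<in> hom (P_cat X) (P_sum_o A C) (P_sum_o B D)"
    by (rule P_sum_hom[OF P_block_hom[OF s] P_block_hom[OF t]])
  show "P_block X (sum_ix (length (fst A)) (length (fst B)) s t) (P_sum_o A C) (P_sum_o B D)
      \<in> hom (P_cat X) (P_sum_o A C) (P_sum_o B D)"
    by (rule P_block_hom[OF st])
  show "gr_fib (P_sum_a (P_block X s A B) (P_block X t C D)) =
      gr_fib (P_block X (sum_ix (length (fst A)) (length (fst B)) s t) (P_sum_o A C) (P_sum_o B D))"
    using P_objD(3)[OF P_block_mapD(2)[OF s]] by (simp add: list_prod_cat_append del: map_append)
  note A = A_block_hom[OF P_block_mapD(3)[OF s]] and C = A_block_hom[OF P_block_mapD(3)[OF t]]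
  fix i a assume "(i, a) \<in> blocks (fst (P_sum_o A C))"
  then have ia: "(i, a) \<in> blocks (fst A @ fst C)" by simp
  then show "sm_fun (gr_base (P_sum_a (P_block X s A B) (P_block X t C D))) (i, a) =
      sm_fun (gr_base (P_block X (sum_ix (length (fst A)) (length (fst B)) s t) (P_sum_o A C) (P_sum_o B D))) (i, a)"
    unfolding P_sum_a_simps P_block_simps P_sum_o_simps A_block_fun[OF ia]
  proof (cases rule: blocks_append_cases)
    case left
    then show "sm_fun (A_sum (A_block s (fst A) (fst B)) (A_block t (fst C) (fst D))) (i, a) =
        (sum_ix (length (fst A)) (length (fst B)) s t i, a)"
      unfolding A_sum_fun(1)[OF A left] A_block_fun[OF left] by (simp add: sum_ix_simps)
  next
    case (right j)
    then show "sm_fun (A_sum (A_block s (fst A) (fst B)) (A_block t (fst C) (fst D))) (i, a) =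
        (sum_ix (length (fst A)) (length (fst B)) s t i, a)"
      unfolding right(1) A_sum_fun(2)[OF A C right(2)] A_block_fun[OF right(2)] by (simp add: sum_ix_simps)
  qed
qed

section \<open>The braiding\<close>

lemma P_block_map_braid:
  assumes A: "A \<in> obj (P_cat X)" and B: "B \<in> obj (P_cat X)"
  shows "P_block_map (braid_ix (length (fst A)) (length (fst B))) (P_sum_o A B) (P_sum_o B A)"
proof (rule P_block_mapI)
  note len = P_objD(3)[OF A] P_objD(3)[OF B]
  show "P_sum_o A B \<in> obj (P_cat X)" "P_sum_o B A \<in> obj (P_cat X)"
    using assms by (simp_all add: P_sum_obj)
  show "length (fst (P_sum_o A B)) = length (fst (P_sum_o B A))" by simp
  fix i assume "i < length (fst (P_sum_o A B))"
  then have "i < length (fst A) + length (fst B)" by simp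
  then show "braid_ix (length (fst A)) (length (fst B)) i < length (fst (P_sum_o B A)) \<and>
       fst (P_sum_o B A) ! braid_ix (length (fst A)) (length (fst B)) i = fst (P_sum_o A B) ! i \<and>
       snd (P_sum_o B A) ! braid_ix (length (fst A)) (length (fst B)) i = snd (P_sum_o A B) ! i"
    using len by (cases rule: sum_index_cases) (simp_all add: braid_ix_simps nth_append)
next
  fix j assume "j < length (fst (P_sum_o B A))"
  then have "j < length (fst B) + length (fst A)" by simp
  then show "\<exists>i < length (fst (P_sum_o A B)). braid_ix (length (fst A)) (length (fst B)) i = j"
  proof (cases rule: sum_index_cases)
    case 1
    then show ?thesis by (intro exI[of _ "length (fst A) + j"]) (simp add: braid_ix_simps)
  next
    case (2 j')
    then show ?thesis by (intro exI[of _ j']) (simp add: braid_ix_simps)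
  qed
qed

lemma P_braid_eq: "P_braid X A B = P_block X (braid_ix (length (fst A)) (length (fst B))) (P_sum_o A B) (P_sum_o B A)"
  by (simp add: P_braid_def braid_ix_def[abs_def] Let_def)

lemma P_sum_o_assoc [simp]: "P_sum_o (P_sum_o A B) C = P_sum_o A (P_sum_o B C)"
  by (simp add: P_sum_o_def)

lemma P_sum_o_zero [simp]: "P_sum_o P_zero A = A" "P_sum_o A P_zero = A"
  by (simp_all add: P_sum_o_def P_zero_def)

text \<open>Symmetry, unit and hexagon compare block morphisms and reduce to arithmetic of
  \<open>braid_ix\<close>. Only naturality involves arbitrary morphisms; there a left block moves
  right by the length of the other summand, before and after applying the base map.\<close>

lemma P_permutative: "permutative_category (P_cat X) P_sum_o P_sum_a P_zero (P_braid X)"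
proof (intro permutative_category.intro permutative_category_axioms.intro P_sum_monoidal)
  fix A B D :: "'o P_obj" assume A: "A \<in> obj (P_cat X)" and B: "B \<in> obj (P_cat X)"
  let ?p = "length (fst A)" and ?q = "length (fst B)" and ?r = "length (fst D)"
  note AB = P_block_map_braid[OF A B] and BA = P_block_map_braid[OF B A]
  show "P_braid X A B \<in> hom (P_cat X) (P_sum_o A B) (P_sum_o B A)"
    unfolding P_braid_eq by (rule P_block_hom[OF AB])
  show "cmp (P_cat X) (P_braid X B A) (P_braid X A B) = idt (P_cat X) (P_sum_o A B)"
    unfolding P_braid_eq P_block_cmp[OF AB BA] P_block_idt
    by (rule P_block_cong) (auto simp: braid_ix_simps elim!: sum_index_cases)
  assume D: "D \<in> obj (P_cat X)"
  note AD = P_block_map_braid[OF A D]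
  note s = P_block_map_sum[OF AB P_block_map_id[OF D], simplified] and t = P_block_map_sum[OF P_block_map_id[OF B] AD]
  \<comment> \<open>The index map on the right is that of the composite in the hexagon: A moves past
    B while D stays, then past D while B stays.\<close>
  have "P_braid X A (P_sum_o B D) = P_block X
      (\<lambda>i. sum_ix ?q ?q (\<lambda>i. i) (braid_ix ?p ?r) (sum_ix (?p + ?q) (?q + ?p) (braid_ix ?p ?q) (\<lambda>i. i) i))
      (P_sum_o A (P_sum_o B D)) (P_sum_o (P_sum_o B D) A)"
    unfolding P_braid_eq
    by (rule P_block_cong) (auto simp: braid_ix_simps sum_ix_simps add.assoc elim!: sum_index_cases)
  then show "P_braid X A (P_sum_o B D) =
     cmp (P_cat X) (P_sum_a (idt (P_cat X) B) (P_braid X A D)) (P_sum_a (P_braid X A B) (idt (P_cat X) D))"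
    unfolding P_braid_eq P_block_idt P_block_sum[OF AB P_block_map_id[OF D]] P_block_sum[OF P_block_map_id[OF B] AD]
    using P_block_cmp[OF s t] by simp
next
  fix A assume "A \<in> obj (P_cat X)"
  show "P_braid X A P_zero = idt (P_cat X) A"
    unfolding P_braid_eq P_block_idt P_sum_o_zero
    by (rule P_block_cong) (simp add: braid_ix_simps P_zero_def)
next
  fix f g A A' B B' assume f: "f \<in> hom (P_cat X) A A'" and g: "g \<in> hom (P_cat X) B B'"
  note F = P_homD[OF f] and G = P_homD[OF g]
  show "cmp (P_cat X) (P_braid X A' B') (P_sum_a f g) = cmp (P_cat X) (P_sum_a g f) (P_braid X A B)"
    unfolding P_braid_eq
  proof (rule P_block_natural[OF P_sum_hom[OF f g] P_sum_hom[OF g f]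
      P_block_map_braid[OF F(6) G(6)] P_block_map_braid[OF F(7) G(7)]])
    fix i a assume "(i, a) \<in> blocks (fst (P_sum_o A B))"
    then have "(i, a) \<in> blocks (fst A @ fst B)" by simp
    then show "sm_fun (gr_base (P_sum_a g f)) (braid_ix (length (fst A)) (length (fst B)) i, a) =
       (braid_ix (length (fst A')) (length (fst B')) (fst (sm_fun (gr_base (P_sum_a f g)) (i, a))),
        snd (sm_fun (gr_base (P_sum_a f g)) (i, a)))"
    proof (cases rule: blocks_append_cases)
      case left
      then have "braid_ix (length (fst A)) (length (fst B)) i = length (fst B) + i" by (simp add: braid_ix_simps)
      then show ?thesis
        using A_hom_fun_less[OF F(3) left]
        by (simp add: A_sum_fun(1)[OF F(3) left] A_sum_fun(2)[OF G(3) F(3) left] braid_ix_simps)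
    next
      case (right j)
      then show ?thesis
        using prod.collapse
        by (simp add: A_sum_fun(1)[OF G(3) right(2)] A_sum_fun(2)[OF F(3) G(3) right(2)] braid_ix_simps)
    qed
  next
    fix j assume "j < length (fst (P_sum_o A' B'))"
    then have "j < length (fst A') + length (fst B')" by simp
    then show "gr_fib (P_sum_a g f) ! braid_ix (length (fst A')) (length (fst B')) j = gr_fib (P_sum_a f g) ! j"
      using F G by (cases rule: sum_index_cases) (simp_all add: braid_ix_simps nth_append)
  qed
qed

end


section \<open>Distributivity\<close>

lemma sum_mult_index_cases:
  assumes "k < p * r + q * r"
  obtains i l where "i < p" "l < r" "k = rlex p i l" | j l where "j < q" "l < r" "k = p * r + rlex q j l"
  using assms by (cases rule: sum_index_cases) (metis rlex_cases)+

lemma dl_ix_symmetry: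
  assumes "k < p * r + q * r"
  shows "mult_ix (p + q) (q + p) (braid_ix p q) (\<lambda>i. i) (dl_ix p q r k) = dl_ix q p r (braid_ix (p * r) (q * r) k)"
  using assms
  by (cases rule: sum_mult_index_cases) (simp_all add: dl_ix_simps mult_ix_rlex braid_ix_simps rlex_less)

text \<open>Both sides send block (i, l) of a summand to row i plus the number of rows of the
  earlier summands, in column l, where columns have length p + p' + p''.\<close>

lemma dl_ix_internal:
  assumes "k < p * r + (p' * r + p'' * r)"
  shows "dl_ix (p + p') p'' r (sum_ix (p * r + p' * r) ((p + p') * r) (dl_ix p p' r) (\<lambda>i. i) k) =
    dl_ix p (p' + p'') r (sum_ix (p * r) (p * r) (\<lambda>i. i) (dl_ix p' p'' r) k)"
  using assms
proof (cases rule: sum_index_cases)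
  case 1
  then obtain i l where "i < p" "l < r" "k = rlex p i l" by (rule rlex_cases)
  with 1 show ?thesis by (simp add: sum_ix_simps dl_ix_simps add.assoc)
next
  case (2 k')
  from 2(2) show ?thesis
  proof (cases rule: sum_mult_index_cases)
    case (1 i l)
    with 2(1) rlex_less[of i p' l r] show ?thesis by (simp add: sum_ix_simps dl_ix_simps add.assoc)
  next
    case (2 j l)
    with \<open>k = p * r + k'\<close> show ?thesis by (simp add: sum_ix_simps dl_ix_simps add.assoc)
  qed
qed

text \<open>Distributing over a product treats the pair (j, l') as one column index. Doing it in two
  steps distributes over l' and then over j, and \<open>rlex_assoc\<close> identifies the resulting
  positions.\<close>

lemma dl_ix_external:
  assumes "k < p * (q * r) + p' * (q * r)"
  shows "dl_ix p p' (q * r) k =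
    mult_ix (p * q + p' * q) ((p + p') * q) (dl_ix p p' q) (\<lambda>i. i) (dl_ix (p * q) (p' * q) r k)"
  using assms
proof (cases rule: sum_mult_index_cases)
  case (1 i l)
  then obtain j l' where l: "j < q" "l' < r" "l = rlex q j l'" by (metis rlex_cases)
  have "dl_ix (p * q) (p' * q) r k = rlex (p * q + p' * q) (rlex p i j) l'"
    using 1 l rlex_less[of i p j q] by (simp add: rlex_assoc[symmetric] dl_ix_simps)
  then show ?thesis
    using 1 l rlex_less[of i p j q] by (simp add: dl_ix_simps mult_ix_rlex rlex_assoc)
next
  case (2 i l)
  then obtain j l' where l: "j < q" "l' < r" "l = rlex q j l'" by (metis rlex_cases)
  have "dl_ix (p * q) (p' * q) r k = rlex (p * q + p' * q) (p * q + rlex p' i j) l'"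
    using 2 l rlex_less[of i p' j q] by (simp add: rlex_assoc[symmetric] dl_ix_simps)
  then show ?thesis
    using 2 l rlex_less[of i p' j q] by (simp add: dl_ix_simps mult_ix_rlex rlex_assoc)
qed

text \<open>A left factor of length p refines every row into p rows and is not moved by either map.
  With right distributivity an identity, this is the mixed external axiom at the level of
  indices.\<close>

lemma dl_ix_mult_left:
  assumes "k < p * q * r + p * q' * r"
  shows "dl_ix (p * q) (p * q') r k = mult_ix p p (\<lambda>i. i) (dl_ix q q' r) k"
  using assms
proof (cases rule: sum_mult_index_cases)
  case (1 i l)
  then obtain i1 j where i: "i1 < p" "j < q" "i = rlex p i1 j" by (metis rlex_cases)
  have "dl_ix (p * q) (p * q') r k = rlex (p * (q + q')) (rlex p i1 j) l"
    using 1 i by (simp add: dl_ix_simps distrib_left)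
  moreover have "mult_ix p p (\<lambda>i. i) (dl_ix q q' r) k = rlex p i1 (rlex (q + q') j l)"
    using 1 i by (simp add: rlex_assoc mult_ix_rlex dl_ix_simps)
  ultimately show ?thesis by (simp add: rlex_assoc)
next
  case (2 i l)
  then obtain i1 j where i: "i1 < p" "j < q'" "i = rlex p i1 j" by (metis rlex_cases)
  have "dl_ix (p * q) (p * q') r k = rlex (p * (q + q')) (rlex p i1 (q + j)) l"
    using 2 i by (simp add: dl_ix_simps distrib_left rlex_add)
  \<comment> \<open>The position is reread with the left factor outermost, so that
    \<open>mult_ix\<close> can act on the remaining index.\<close>
  moreover have "k = rlex p i1 (q * r + rlex q' j l)"
    using 2 i by (simp add: rlex_assoc rlex_add)
  then have "mult_ix p p (\<lambda>i. i) (dl_ix q q' r) k = rlex p i1 (rlex (q + q') (q + j) l)"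
    using 2 i by (simp add: mult_ix_rlex dl_ix_simps)
  ultimately show ?thesis by (simp add: rlex_assoc)
qed

text \<open>Swapping the right indices moves whole columns of length p, so by
  \<open>rlex_add\<close> it is itself a swap of two concatenated products.\<close>

lemma braid_ix_mult_left:
  assumes "k < p * q + p * r"
  shows "mult_ix p p (\<lambda>i. i) (braid_ix q r) k = braid_ix (p * q) (p * r) k"
  using assms
proof (cases rule: sum_index_cases)
  case 1
  then obtain i j where "i < p" "j < q" "k = rlex p i j" by (rule rlex_cases)
  with 1 show ?thesis by (simp add: mult_ix_rlex braid_ix_simps rlex_add)
next
  case (2 k')
  then obtain i j where ij: "i < p" "j < r" "k' = rlex p i j" by (metis rlex_cases)
  with 2 have "k = rlex p i (q + j)" by (simp add: rlex_add)
  with ij have "mult_ix p p (\<lambda>i. i) (braid_ix q r) k = rlex p i j"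
    by (simp add: mult_ix_rlex braid_ix_simps)
  with 2 ij show ?thesis by (simp add: braid_ix_simps)
qed

text \<open>The target lists all columns from q before those from q'. The inner swap exchanges the
  two middle summands, so that both products with q columns precede both with q' columns; the two
  halves are then interleaved separately. The four summands are the four cases.\<close>

lemma dl_ix_two_by_two:
  assumes "k < p * q + (p * q' + (p' * q + p' * q'))"
  shows "dl_ix p p' (q + q') k =
    sum_ix (p * q + p' * q) ((p + p') * q) (dl_ix p p' q) (dl_ix p p' q')
      (sum_ix (p * q) (p * q) (\<lambda>i. i)
        (sum_ix (p * q' + p' * q) (p' * q + p * q') (braid_ix (p * q') (p' * q)) (\<lambda>i. i)) k)"
  using assms
proof (cases rule: sum_index_cases)
  case 1
  then obtain i j where ij: "i < p" "j < q" "k = rlex p i j" by (rule rlex_cases)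
  with 1 show ?thesis by (simp add: sum_ix_simps dl_ix_simps)
next
  case (2 k1)
  note k = 2
  from 2(2) show ?thesis
  proof (cases rule: sum_index_cases)
    case 1
    then obtain i j where ij: "i < p" "j < q'" "k1 = rlex p i j" by (rule rlex_cases)
    then have "k = rlex p i (q + j)" using k by (simp add: rlex_add)
    then have "dl_ix p p' (q + q') k = rlex (p + p') i (q + j)" using ij by (simp add: dl_ix_simps)
    then show ?thesis using ij 1 k(1)
      by (simp add: sum_ix_simps dl_ix_simps braid_ix_simps) (simp add: rlex_add)
  next
    case (2 k2)
    note k' = 2
    from 2(2) show ?thesis
    proof (cases rule: sum_index_cases)
      case 1
      then obtain i j where ij: "i < p'" "j < q" "k2 = rlex p' i j" by (rule rlex_cases)
      then have "k = p * (q + q') + rlex p' i j" using k k' by (simp add: distrib_left)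
      then have "dl_ix p p' (q + q') k = rlex (p + p') (p + i) j" using ij by (simp add: dl_ix_simps)
      then show ?thesis using ij 1 k(1) k'(1)
        by (simp add: sum_ix_simps dl_ix_simps braid_ix_simps)
    next
      case (2 k3)
      then obtain i j where ij: "i < p'" "j < q'" "k3 = rlex p' i j" by (metis rlex_cases)
      then have "k = p * (q + q') + rlex p' i (q + j)" using k k' 2 by (simp add: distrib_left rlex_add)
      then have "dl_ix p p' (q + q') k = rlex (p + p') (p + i) (q + j)" using ij by (simp add: dl_ix_simps)
      then show ?thesis using ij 2 k(1) k'(1)
        by (simp add: sum_ix_simps dl_ix_simps braid_ix_simps add.assoc) (simp add: rlex_add add.assoc)
    qed
  qed
qed

text \<open>By \<open>rlex_add\<close>, blocks whose right index lies in \<open>k\<close> come after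
  all those whose right index lies in \<open>n\<close>.\<close>

lemma A_mult_append: "A_mult m (n @ k) = A_mult m n @ A_mult m k"
proof (rule rlex_list_eqI[where p = "length m" and q = "length n + length k"])
  fix i j assume i: "i < length m" and j: "j < length n + length k"
  from j show "A_mult m (n @ k) ! rlex (length m) i j = (A_mult m n @ A_mult m k) ! rlex (length m) i j"
    by (cases rule: sum_index_cases)
      (use i j in \<open>simp_all add: A_mult_nth' nth_append rlex_less\<close>, simp add: rlex_add)
qed (simp_all add: distrib_left)

lemma list_mult_append:
  assumes "length y = length n"
  shows "list_mult mu m (n @ k) x (y @ z) = list_mult mu m n x y @ list_mult mu m k x z"
proof (rule rlex_list_eqI[where p = "length m" and q = "length n + length k"])
  fix i j assume i: "i < length m" and j: "j < length n + length k"
  from j show "list_mult mu m (n @ k) x (y @ z) ! rlex (length m) i j =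
      (list_mult mu m n x y @ list_mult mu m k x z) ! rlex (length m) i j"
    by (cases rule: sum_index_cases)
      (use i j assms in \<open>simp_all add: list_mult_nth' nth_append rlex_less\<close>, simp add: rlex_add)
qed (simp_all add: distrib_left)

text \<open>With the identity as right distributivity, its naturality square amounts to this
  equality at the base. The shift by \<open>length n\<close> of a right index becomes the shift by a
  full product, in source and target alike.\<close>

lemma A_mult_arr_sum:
  assumes \<phi>: "\<phi> \<in> hom A_cat m m'" and \<psi>: "\<psi> \<in> hom A_cat n n'" and \<chi>: "\<chi> \<in> hom A_cat k k'"
  shows "A_mult_arr \<phi> (A_sum \<psi> \<chi>) = A_sum (A_mult_arr \<phi> \<psi>) (A_mult_arr \<phi> \<chi>)"
proof (rule A_arr_eqI)
  note s = A_sum_hom[OF \<psi> \<chi>] and l = A_mult_arr_hom[OF \<phi> \<psi>] and r = A_mult_arr_hom[OF \<phi> \<chi>]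
  show "A_mult_arr \<phi> (A_sum \<psi> \<chi>) \<in> hom A_cat (A_mult m n @ A_mult m k) (A_mult m' n' @ A_mult m' k')"
    using A_mult_arr_hom[OF \<phi> s] by (simp add: A_mult_append)
  show "A_sum (A_mult_arr \<phi> \<psi>) (A_mult_arr \<phi> \<chi>) \<in> hom A_cat (A_mult m n @ A_mult m k) (A_mult m' n' @ A_mult m' k')"
    by (rule A_sum_hom[OF l r])
  fix u c assume "(u, c) \<in> blocks (A_mult m n @ A_mult m k)"
  then show "sm_fun (A_mult_arr \<phi> (A_sum \<psi> \<chi>)) (u, c) = sm_fun (A_sum (A_mult_arr \<phi> \<psi>) (A_mult_arr \<phi> \<chi>)) (u, c)"
  proof (cases rule: blocks_append_cases)
    case left
    then obtain i a j b where ia: "(i, a) \<in> blocks m" and jb: "(j, b) \<in> blocks n"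
      and eq: "u = rlex (length m) i j" "c = lex (n ! j) a b"
      by (rule blocks_A_mult_cases)
    have jb': "(j, b) \<in> blocks (n @ k)" and nth: "(n @ k) ! j = n ! j" using jb by (auto simp: nth_append)
    show ?thesis
      unfolding A_sum_fun(1)[OF l left] unfolding eq A_mult_fun[OF \<phi> \<psi> ia jb]
      using A_mult_fun[OF \<phi> s ia jb'] A_hom_fun_less[OF \<psi> jb] nth
      by (simp add: A_sum_fun(1)[OF \<psi> jb] nth_append)
  next
    case (right u')
    from right(2) obtain i a j b where ia: "(i, a) \<in> blocks m" and jb: "(j, b) \<in> blocks k"
      and eq: "u' = rlex (length m) i j" "c = lex (k ! j) a b"
      by (rule blocks_A_mult_cases)
    have jb': "(length n + j, b) \<in> blocks (n @ k)" and nth: "(n @ k) ! (length n + j) = k ! j" using jb by auto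
    have u: "u = rlex (length m) i (length n + j)" using right(1) eq(1) by (simp add: rlex_add)
    have "sm_fun (A_mult_arr \<phi> (A_sum \<psi> \<chi>)) (u, c) =
        (rlex (length m') (fst (sm_fun \<phi> (i, a))) (length n' + fst (sm_fun \<chi> (j, b))),
         lex (k' ! fst (sm_fun \<chi> (j, b))) (snd (sm_fun \<phi> (i, a))) (snd (sm_fun \<chi> (j, b))))"
      using A_mult_fun[OF \<phi> s ia jb'] nth by (simp add: u eq A_sum_fun(2)[OF \<psi> \<chi> jb])
    then show ?thesis
      unfolding right(1) A_sum_fun(2)[OF l r right(2)] unfolding eq A_mult_fun[OF \<phi> \<chi> ia jb]
      by (simp add: rlex_add)
  qed
qed

context gamma_monoid
begin

section \<open>Products of block morphisms\<close>

lemma P_block_map_mult: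
  assumes s: "P_block_map s A B" and t: "P_block_map t C D"
  shows "P_block_map (mult_ix (length (fst A)) (length (fst B)) s t) (A \<otimes> C) (B \<otimes> D)"
proof (rule P_block_mapI)
  note s' = P_block_mapD[OF s] and t' = P_block_mapD[OF t]
  show "A \<otimes> C \<in> obj (P_cat X)" "B \<otimes> D \<in> obj (P_cat X)"
    using s' t' by (simp_all add: P_mult_obj)
  show "length (fst (A \<otimes> C)) = length (fst (B \<otimes> D))" using s' t' by simp
  fix k assume "k < length (fst (A \<otimes> C))"
  then have "k < length (fst A) * length (fst C)" by simp
  then obtain i j where "i < length (fst A)" "j < length (fst C)" "k = rlex (length (fst A)) i j"
    by (rule rlex_cases)
  moreover from this have "s i < length (fst B)" "t j < length (fst D)" using s'(5) t'(5) by simp_all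
  ultimately show "mult_ix (length (fst A)) (length (fst B)) s t k < length (fst (B \<otimes> D)) \<and>
       fst (B \<otimes> D) ! mult_ix (length (fst A)) (length (fst B)) s t k = fst (A \<otimes> C) ! k \<and>
       snd (B \<otimes> D) ! mult_ix (length (fst A)) (length (fst B)) s t k = snd (A \<otimes> C) ! k"
    using s'(6,7) t'(6,7) rlex_less[of "s i" "length (fst B)" "t j" "length (fst D)"]
    by (simp add: mult_ix_rlex)
next
  note s' = P_block_mapD[OF s] and t' = P_block_mapD[OF t]
  fix k assume "k < length (fst (B \<otimes> D))"
  then have "k < length (fst B) * length (fst D)" by simp
  then obtain i j where "i < length (fst B)" "j < length (fst D)" "k = rlex (length (fst B)) i j"
    by (rule rlex_cases)
  moreover from this obtain i' j' where "i' < length (fst A)" "j' < length (fst C)" "s i' = i" "t j' = j"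
    using s'(8) t'(8) by blast
  ultimately show "\<exists>i < length (fst (A \<otimes> C)). mult_ix (length (fst A)) (length (fst B)) s t i = k"
    by (intro exI[of _ "rlex (length (fst A)) i' j'"]) (simp add: mult_ix_rlex rlex_less)
qed

lemma P_block_mult:
  assumes s: "P_block_map s A B" and t: "P_block_map t C D"
  shows "P_block X s A B \<otimes>\<^sub>a P_block X t C D =
    P_block X (mult_ix (length (fst A)) (length (fst B)) s t) (A \<otimes> C) (B \<otimes> D)"
proof (rule P_arr_eqI)
  note s' = P_block_mapD[OF s] and t' = P_block_mapD[OF t]
  show "P_block X s A B \<otimes>\<^sub>a P_block X t C D \<in> hom (P_cat X) (A \<otimes> C) (B \<otimes> D)"
    by (rule P_mult_hom[OF P_block_hom[OF s] P_block_hom[OF t]])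
  show "P_block X (mult_ix (length (fst A)) (length (fst B)) s t) (A \<otimes> C) (B \<otimes> D)
      \<in> hom (P_cat X) (A \<otimes> C) (B \<otimes> D)"
    by (rule P_block_hom[OF P_block_map_mult[OF s t]])
  show "gr_fib (P_block X s A B \<otimes>\<^sub>a P_block X t C D) =
      gr_fib (P_block X (mult_ix (length (fst A)) (length (fst B)) s t) (A \<otimes> C) (B \<otimes> D))"
    using P_objD(2)[OF s'(2)] P_objD(2)[OF t'(2)] by (simp add: list_mult_idt)
  note A = A_block_hom[OF s'(3)] and C = A_block_hom[OF t'(3)]
  fix k c assume "(k, c) \<in> blocks (fst (A \<otimes> C))"
  then have kc: "(k, c) \<in> blocks (A_mult (fst A) (fst C))" by simp
  then obtain i a j b where ia: "(i, a) \<in> blocks (fst A)" and jb: "(j, b) \<in> blocks (fst C)"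
    and eq: "k = rlex (length (fst A)) i j" "c = lex (fst C ! j) a b"
    by (rule blocks_A_mult_cases)
  show "sm_fun (gr_base (P_block X s A B \<otimes>\<^sub>a P_block X t C D)) (k, c) =
      sm_fun (gr_base (P_block X (mult_ix (length (fst A)) (length (fst B)) s t) (A \<otimes> C) (B \<otimes> D))) (k, c)"
    unfolding P_mult_a_simps P_block_simps P_mult_o_simps A_block_fun[OF kc]
    unfolding eq A_mult_fun[OF A C ia jb] A_block_fun[OF ia] A_block_fun[OF jb]
    using ia jb t'(6) by (simp add: mult_ix_rlex)
qed

section \<open>The two distributivity morphisms\<close>

lemma P_dist_l_eq: "P_dist_l X mu_o A B C = P_block X (dl_ix (length (fst A)) (length (fst B)) (length (fst C)))
    (P_sum_o (A \<otimes> C) (B \<otimes> C)) (P_sum_o A B \<otimes> C)"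
  by (simp add: P_dist_l_def dl_ix_def[abs_def] Let_def)

lemma P_block_map_dl:
  assumes A: "A \<in> obj (P_cat X)" and B: "B \<in> obj (P_cat X)" and C: "C \<in> obj (P_cat X)"
  shows "P_block_map (dl_ix (length (fst A)) (length (fst B)) (length (fst C)))
    (P_sum_o (A \<otimes> C) (B \<otimes> C)) (P_sum_o A B \<otimes> C)"
proof (rule P_block_mapI)
  let ?p = "length (fst A)" and ?q = "length (fst B)" and ?r = "length (fst C)"
  note len = P_objD(3)[OF A] P_objD(3)[OF B]
  show "P_sum_o (A \<otimes> C) (B \<otimes> C) \<in> obj (P_cat X)" "P_sum_o A B \<otimes> C \<in> obj (P_cat X)"
    using assms by (simp_all add: P_sum_obj P_mult_obj)
  show "length (fst (P_sum_o (A \<otimes> C) (B \<otimes> C))) = length (fst (P_sum_o A B \<otimes> C))"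
    by (simp add: distrib_right)
  fix k assume "k < length (fst (P_sum_o (A \<otimes> C) (B \<otimes> C)))"
  then have "k < ?p * ?r + ?q * ?r" by simp
  then show "dl_ix ?p ?q ?r k < length (fst (P_sum_o A B \<otimes> C)) \<and>
       fst (P_sum_o A B \<otimes> C) ! dl_ix ?p ?q ?r k = fst (P_sum_o (A \<otimes> C) (B \<otimes> C)) ! k \<and>
       snd (P_sum_o A B \<otimes> C) ! dl_ix ?p ?q ?r k = snd (P_sum_o (A \<otimes> C) (B \<otimes> C)) ! k"
  proof (cases rule: sum_mult_index_cases)
    case (1 i l)
    with len show ?thesis
      using rlex_less[of i ?p l ?r] rlex_less[of i "?p + ?q" l ?r]
      by (simp add: dl_ix_simps A_mult_nth' list_mult_nth' nth_append)
  next
    case (2 j l)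
    with len show ?thesis
      using rlex_less[of "?p + j" "?p + ?q" l ?r]
      by (simp add: dl_ix_simps A_mult_nth' list_mult_nth' nth_append)
  qed
next
  let ?p = "length (fst A)" and ?q = "length (fst B)" and ?r = "length (fst C)"
  fix k assume "k < length (fst (P_sum_o A B \<otimes> C))"
  then have "k < (?p + ?q) * ?r" by simp
  then obtain i l where il: "i < ?p + ?q" "l < ?r" "k = rlex (?p + ?q) i l" by (rule rlex_cases)
  from il(1) show "\<exists>i < length (fst (P_sum_o (A \<otimes> C) (B \<otimes> C))). dl_ix ?p ?q ?r i = k"
  proof (cases rule: sum_index_cases)
    case 1
    with il rlex_less[of i ?p l ?r] show ?thesis
      by (intro exI[of _ "rlex ?p i l"]) (simp add: dl_ix_simps)
  next
    case (2 j)
    with il rlex_less[of j ?q l ?r] show ?thesis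
      by (intro exI[of _ "?p * ?r + rlex ?q j l"]) (simp add: dl_ix_simps)
  qed
qed

lemma P_mult_sum:
  assumes "B \<in> obj (P_cat X)"
  shows "A \<otimes> P_sum_o B C = P_sum_o (A \<otimes> B) (A \<otimes> C)"
  using P_objD(3)[OF assms] by (intro prod_eqI) (simp_all add: A_mult_append list_mult_append)

lemma P_mult_arr_sum:
  assumes f: "f \<in> hom (P_cat X) A A'" and g: "g \<in> hom (P_cat X) B B'" and h: "h \<in> hom (P_cat X) C C'"
  shows "f \<otimes>\<^sub>a P_sum_a g h = P_sum_a (f \<otimes>\<^sub>a g) (f \<otimes>\<^sub>a h)"
proof -
  note F = P_homD[OF f] and G = P_homD[OF g] and H = P_homD[OF h]
  show ?thesis
    using F G H P_objD(3)[OF G(6)] P_objD(3)[OF G(7)]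
    by (intro gr_arrow.expand) (simp add: A_mult_arr_sum[OF F(3) G(3) H(3)] list_mult_append)
qed

text \<open>In the reverse lexicographic order the blocks of \<open>A \<otimes> (B \<oplus> C)\<close> are those of \<open>A \<otimes> B\<close> followed by
  those of \<open>A \<otimes> C\<close>, so that \<open>\<partial>\<^sup>r\<close> is an identity.\<close>

lemma P_dist_r_eq:
  assumes "B \<in> obj (P_cat X)"
  shows "P_dist_r X mu_o A B C = idt (P_cat X) (A \<otimes> P_sum_o B C)"
  unfolding P_dist_r_def P_mult_sum[OF assms, symmetric] P_block_idt
  \<comment> \<open>Both branches of the index map return k, by division with remainder: of k by p
    in the first, of k - p q in the second, where the p q subtracted is restored by the shift q of
    the column.\<close>
  by (rule P_block_cong) (simp add: Let_def rlex_def distrib_left)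

text \<open>On the base, moving block (i, j) to its row in the sum commutes with applying the two
  coordinate maps, the row offset changing from the length of A to that of A'. On the fibres both
  sides carry the same \<open>mu_a\<close> entry.\<close>

lemma dl_natural:
  assumes f: "f \<in> hom (P_cat X) A A'" and g: "g \<in> hom (P_cat X) B B'" and h: "h \<in> hom (P_cat X) C C'"
  shows "cmp (P_cat X) (P_dist_l X mu_o A' B' C') (P_sum_a (f \<otimes>\<^sub>a h) (g \<otimes>\<^sub>a h)) =
    cmp (P_cat X) (P_sum_a f g \<otimes>\<^sub>a h) (P_dist_l X mu_o A B C)"
  unfolding P_dist_l_eq
proof (rule P_block_natural)
  note F = P_homD[OF f] and G = P_homD[OF g] and H = P_homD[OF h]
  note fh = A_mult_arr_hom[OF F(3) H(3)] and gh = A_mult_arr_hom[OF G(3) H(3)] and fg = A_sum_hom[OF F(3) G(3)]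
  show "P_sum_a (f \<otimes>\<^sub>a h) (g \<otimes>\<^sub>a h) \<in> hom (P_cat X) (P_sum_o (A \<otimes> C) (B \<otimes> C)) (P_sum_o (A' \<otimes> C') (B' \<otimes> C'))"
    by (intro P_sum_hom P_mult_hom f g h)
  show "P_sum_a f g \<otimes>\<^sub>a h \<in> hom (P_cat X) (P_sum_o A B \<otimes> C) (P_sum_o A' B' \<otimes> C')"
    by (intro P_sum_hom P_mult_hom f g h)
  show "P_block_map (dl_ix (length (fst A)) (length (fst B)) (length (fst C))) (P_sum_o (A \<otimes> C) (B \<otimes> C)) (P_sum_o A B \<otimes> C)"
    "P_block_map (dl_ix (length (fst A')) (length (fst B')) (length (fst C'))) (P_sum_o (A' \<otimes> C') (B' \<otimes> C')) (P_sum_o A' B' \<otimes> C')"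
    using F G H by (simp_all add: P_block_map_dl)
  fix k c assume "(k, c) \<in> blocks (fst (P_sum_o (A \<otimes> C) (B \<otimes> C)))"
  then have "(k, c) \<in> blocks (A_mult (fst A) (fst C) @ A_mult (fst B) (fst C))" by simp
  then show "sm_fun (gr_base (P_sum_a f g \<otimes>\<^sub>a h)) (dl_ix (length (fst A)) (length (fst B)) (length (fst C)) k, c) =
     (dl_ix (length (fst A')) (length (fst B')) (length (fst C')) (fst (sm_fun (gr_base (P_sum_a (f \<otimes>\<^sub>a h) (g \<otimes>\<^sub>a h))) (k, c))),
      snd (sm_fun (gr_base (P_sum_a (f \<otimes>\<^sub>a h) (g \<otimes>\<^sub>a h))) (k, c)))"
    unfolding P_sum_a_simps P_mult_a_simps
  proof (cases rule: blocks_append_cases)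
    case left
    then obtain i a j b where ia: "(i, a) \<in> blocks (fst A)" and jb: "(j, b) \<in> blocks (fst C)"
      and eq: "k = rlex (length (fst A)) i j" "c = lex (fst C ! j) a b"
      by (rule blocks_A_mult_cases)
    have ia': "(i, a) \<in> blocks (fst A @ fst B)" using ia by (auto simp: nth_append)
    have "dl_ix (length (fst A)) (length (fst B)) (length (fst C)) k = rlex (length (fst A @ fst B)) i j"
      using ia jb by (simp add: eq dl_ix_simps)
    then show "sm_fun (A_mult_arr (A_sum (gr_base f) (gr_base g)) (gr_base h))
        (dl_ix (length (fst A)) (length (fst B)) (length (fst C)) k, c) =
     (dl_ix (length (fst A')) (length (fst B')) (length (fst C'))
        (fst (sm_fun (A_sum (A_mult_arr (gr_base f) (gr_base h)) (A_mult_arr (gr_base g) (gr_base h))) (k, c))),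
      snd (sm_fun (A_sum (A_mult_arr (gr_base f) (gr_base h)) (A_mult_arr (gr_base g) (gr_base h))) (k, c)))"
      unfolding A_sum_fun(1)[OF fh left]
      using A_mult_fun[OF F(3) H(3) ia jb] A_mult_fun[OF fg H(3) ia' jb]
        A_hom_fun_less[OF F(3) ia] A_hom_fun_less[OF H(3) jb]
      by (simp add: eq A_sum_fun(1)[OF F(3) ia] dl_ix_simps)
  next
    case (right k')
    from right(2) obtain i a j b where ia: "(i, a) \<in> blocks (fst B)" and jb: "(j, b) \<in> blocks (fst C)"
      and eq: "k' = rlex (length (fst B)) i j" "c = lex (fst C ! j) a b"
      by (rule blocks_A_mult_cases)
    have ia': "(length (fst A) + i, a) \<in> blocks (fst A @ fst B)" using ia by simp
    have "dl_ix (length (fst A)) (length (fst B)) (length (fst C)) k = rlex (length (fst A @ fst B)) (length (fst A) + i) j"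
      using ia jb by (simp add: right(1) eq dl_ix_simps)
    then show "sm_fun (A_mult_arr (A_sum (gr_base f) (gr_base g)) (gr_base h))
        (dl_ix (length (fst A)) (length (fst B)) (length (fst C)) k, c) =
     (dl_ix (length (fst A')) (length (fst B')) (length (fst C'))
        (fst (sm_fun (A_sum (A_mult_arr (gr_base f) (gr_base h)) (A_mult_arr (gr_base g) (gr_base h))) (k, c))),
      snd (sm_fun (A_sum (A_mult_arr (gr_base f) (gr_base h)) (A_mult_arr (gr_base g) (gr_base h))) (k, c)))"
      unfolding right(1) A_sum_fun(2)[OF fh gh right(2)]
      using A_mult_fun[OF G(3) H(3) ia jb] A_mult_fun[OF fg H(3) ia' jb]
        A_hom_fun_less[OF G(3) ia] A_hom_fun_less[OF H(3) jb]
      by (simp add: eq A_sum_fun(2)[OF F(3) G(3) ia] dl_ix_simps)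
  qed
next
  note F = P_homD[OF f] and G = P_homD[OF g] and H = P_homD[OF h]
  fix k assume "k < length (fst (P_sum_o (A' \<otimes> C') (B' \<otimes> C')))"
  then have "k < length (fst A') * length (fst C') + length (fst B') * length (fst C')" by simp
  then show "gr_fib (P_sum_a f g \<otimes>\<^sub>a h) ! dl_ix (length (fst A')) (length (fst B')) (length (fst C')) k =
    gr_fib (P_sum_a (f \<otimes>\<^sub>a h) (g \<otimes>\<^sub>a h)) ! k"
  proof (cases rule: sum_mult_index_cases)
    case (1 i l)
    with F G H rlex_less[of i "length (fst A')" l "length (fst C')"] show ?thesis
      by (simp add: dl_ix_simps list_mult_nth' nth_append)
  next
    case (2 j l)
    with F G H show ?thesis
      by (simp add: dl_ix_simps list_mult_nth' nth_append)
  qed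
qed

section \<open>The ring category axioms\<close>

lemma P_mult_assoc:
  "\<lbrakk>A \<in> obj (P_cat X); B \<in> obj (P_cat X); C \<in> obj (P_cat X)\<rbrakk> \<Longrightarrow> (A \<otimes> B) \<otimes> C = A \<otimes> (B \<otimes> C)"
  by (rule strict_monoidal_category.tensor_o_assoc[OF P_mult_monoidal])

lemma P_zero_mult [simp]: "P_zero \<otimes> A = P_zero" "A \<otimes> P_zero = P_zero"
  by (simp_all add: prod_eq_iff P_zero_def)

lemmas P_sum_idt = bifunctorD(3)[OF P_sum_functor]
  and P_mult_idt = bifunctorD(3)[OF P_mult_functor]

text \<open>In this normal form intermediate objects agree literally and index maps mention nothing
  but lengths.\<close>

lemmas index_norm = P_sum_o_assoc P_sum_o_simps P_mult_o_simps length_append length_A_mult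

lemma dl_symmetry:
  assumes A: "A \<in> obj (P_cat X)" and B: "B \<in> obj (P_cat X)" and C: "C \<in> obj (P_cat X)"
  shows "cmp (P_cat X) (P_braid X A B \<otimes>\<^sub>a idt (P_cat X) C) (P_dist_l X mu_o A B C) =
    cmp (P_cat X) (P_dist_l X mu_o B A C) (P_braid X (A \<otimes> C) (B \<otimes> C))"
proof -
  note AC = P_mult_obj[OF A C] and BC = P_mult_obj[OF B C]
  note br = P_block_map_braid[OF A B] and id = P_block_map_id[OF C]
  show ?thesis
    unfolding P_dist_l_eq P_braid_eq P_block_idt P_block_mult[OF br id]
    by (rule P_block_cmp_eqI[OF P_block_map_dl[OF A B C] P_block_map_mult[OF br id]
        P_block_map_braid[OF AC BC] P_block_map_dl[OF B A C]])
      (simp add: dl_ix_symmetry)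
qed

lemma dl_internal:
  assumes A: "A \<in> obj (P_cat X)" and A': "A' \<in> obj (P_cat X)" and A'': "A'' \<in> obj (P_cat X)"
    and B: "B \<in> obj (P_cat X)"
  shows "cmp (P_cat X) (P_dist_l X mu_o (P_sum_o A A') A'' B) (P_sum_a (P_dist_l X mu_o A A' B) (idt (P_cat X) (A'' \<otimes> B))) =
    cmp (P_cat X) (P_dist_l X mu_o A (P_sum_o A' A'') B) (P_sum_a (idt (P_cat X) (A \<otimes> B)) (P_dist_l X mu_o A' A'' B))"
proof -
  note dl = P_block_map_dl
  note id = P_block_map_id[OF P_mult_obj[OF A'' B]] and id' = P_block_map_id[OF P_mult_obj[OF A B]]
  show ?thesis
    unfolding P_dist_l_eq P_block_idt P_block_sum[OF dl[OF A A' B] id] P_block_sum[OF id' dl[OF A' A'' B]] index_norm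
    by (rule P_block_cmp_eqI[OF P_block_map_sum[OF dl[OF A A' B] id, unfolded index_norm]
        dl[OF P_sum_obj[OF A A'] A'' B, unfolded index_norm]
        P_block_map_sum[OF id' dl[OF A' A'' B], unfolded index_norm]
        dl[OF A P_sum_obj[OF A' A''] B, unfolded index_norm]])
      (simp add: dl_ix_internal)
qed

lemma dl_external:
  assumes A: "A \<in> obj (P_cat X)" and A': "A' \<in> obj (P_cat X)" and B: "B \<in> obj (P_cat X)" and C: "C \<in> obj (P_cat X)"
  shows "P_dist_l X mu_o A A' (B \<otimes> C) =
    cmp (P_cat X) (P_dist_l X mu_o A A' B \<otimes>\<^sub>a idt (P_cat X) C) (P_dist_l X mu_o (A \<otimes> B) (A' \<otimes> B) C)"
proof -
  note dl = P_block_map_dl and id = P_block_map_id[OF C]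
  note assoc = P_mult_assoc[OF A B C] P_mult_assoc[OF A' B C] P_mult_assoc[OF P_sum_obj[OF A A'] B C]
  show ?thesis
    unfolding P_dist_l_eq P_block_idt P_block_mult[OF dl[OF A A' B] id]
      P_block_cmp[OF dl[OF P_mult_obj[OF A B] P_mult_obj[OF A' B] C] P_block_map_mult[OF dl[OF A A' B] id]]
    \<comment> \<open>After rebracketing both block morphisms have the same source and target, so
      comparing index maps suffices.\<close>
    unfolding assoc
    by (rule P_block_cong) (simp add: dl_ix_external)
qed

text \<open>What remains of the mixed external axiom once both occurrences of right distributivity
  are identities.\<close>

lemma dl_dr_external:
  assumes A: "A \<in> obj (P_cat X)" and B: "B \<in> obj (P_cat X)" and B': "B' \<in> obj (P_cat X)" and C: "C \<in> obj (P_cat X)"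
  shows "P_dist_l X mu_o (A \<otimes> B) (A \<otimes> B') C = idt (P_cat X) A \<otimes>\<^sub>a P_dist_l X mu_o B B' C"
proof -
  note dl = P_block_map_dl[OF B B' C] and id = P_block_map_id[OF A]
  note assoc = P_mult_assoc[OF A B C] P_mult_assoc[OF A B' C] P_mult_assoc[OF A P_sum_obj[OF B B'] C]
  show ?thesis
    unfolding P_dist_l_eq P_block_idt P_block_mult[OF id dl] P_mult_sum[OF B, symmetric]
      P_mult_sum[OF P_mult_obj[OF B C]] assoc
    by (rule P_block_cong) (simp add: dl_ix_mult_left mult.assoc)
qed

text \<open>What remains of the 2-by-2 axiom once its three occurrences of right distributivity are
  identities; \<open>P_mult_sum\<close> splits the source into four summands.\<close>

lemma two_by_two:
  assumes A: "A \<in> obj (P_cat X)" and A': "A' \<in> obj (P_cat X)" and B: "B \<in> obj (P_cat X)" and B': "B' \<in> obj (P_cat X)"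
  shows "P_dist_l X mu_o A A' (P_sum_o B B') =
    cmp (P_cat X) (P_sum_a (P_dist_l X mu_o A A' B) (P_dist_l X mu_o A A' B'))
      (P_sum_a (idt (P_cat X) (A \<otimes> B)) (P_sum_a (P_braid X (A \<otimes> B') (A' \<otimes> B)) (idt (P_cat X) (A' \<otimes> B'))))"
proof -
  note dl = P_block_map_dl[OF A A']
  note id = P_block_map_id[OF P_mult_obj[OF A B]] and id' = P_block_map_id[OF P_mult_obj[OF A' B']]
  note br = P_block_map_braid[OF P_mult_obj[OF A B'] P_mult_obj[OF A' B]]
  note br' = P_block_map_sum[OF br id']
  show ?thesis
    unfolding P_dist_l_eq P_braid_eq P_block_idt P_block_sum[OF dl[OF B] dl[OF B']] P_block_sum[OF br id']
      P_block_sum[OF id br'] P_mult_sum[OF B]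
    unfolding index_norm
    unfolding P_block_cmp[OF P_block_map_sum[OF id br', unfolded index_norm]
        P_block_map_sum[OF dl[OF B] dl[OF B'], unfolded index_norm]]
    by (rule P_block_cong) (simp add: dl_ix_two_by_two)
qed

text \<open>What remains of the symmetry axiom on the right once both distributivity morphisms are
  identities.\<close>

lemma dr_symmetry:
  assumes A: "A \<in> obj (P_cat X)" and B: "B \<in> obj (P_cat X)" and C: "C \<in> obj (P_cat X)"
  shows "idt (P_cat X) A \<otimes>\<^sub>a P_braid X B C = P_braid X (A \<otimes> B) (A \<otimes> C)"
proof -
  note br = P_block_map_braid[OF B C] and id = P_block_map_id[OF A]
  show ?thesis
    unfolding P_braid_eq P_block_idt P_block_mult[OF id br] P_mult_sum[OF B] P_mult_sum[OF C]
    by (rule P_block_cong) (simp add: braid_ix_mult_left)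
qed

lemma dl_unit:
  assumes A: "A \<in> obj (P_cat X)" and B: "B \<in> obj (P_cat X)"
  shows "P_dist_l X mu_o A B (P_unit \<eta>) = idt (P_cat X) (P_sum_o A B)"
proof -
  note unit = strict_monoidal_category.tensor_o_unit_right[OF P_mult_monoidal]
  show ?thesis
    unfolding P_dist_l_eq P_block_idt unit[OF A] unit[OF B] unit[OF P_sum_obj[OF A B]]
  proof (rule P_block_cong)
    fix k assume "k < length (fst (P_sum_o A B))"
    \<comment> \<open>The factor 1 is the length of the unit object. There is a single column, of
      index 0, and both branches of \<open>dl_ix\<close> return k.\<close>
    then have "k < length (fst A) * 1 + length (fst B) * 1" by simp
    then show "dl_ix (length (fst A)) (length (fst B)) (length (fst (P_unit \<eta>))) k = k"
      by (cases rule: sum_mult_index_cases) (simp_all add: P_unit_def dl_ix_def rlex_def)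
  qed
qed

lemma zero_mult_arr:
  assumes "f \<in> arr (P_cat X)"
  shows "idt (P_cat X) P_zero \<otimes>\<^sub>a f = idt (P_cat X) P_zero" "f \<otimes>\<^sub>a idt (P_cat X) P_zero = idt (P_cat X) P_zero"
proof -
  have f: "f \<in> hom (P_cat X) (src (P_cat X) f) (tgt (P_cat X) f)" using P.hom_src_tgt[OF assms] .
  have z: "idt (P_cat X) P_zero \<in> hom (P_cat X) P_zero P_zero"
    using strict_monoidal_category.unit_obj[OF P_sum_monoidal] by (rule P.idt_hom)
  show "idt (P_cat X) P_zero \<otimes>\<^sub>a f = idt (P_cat X) P_zero"
    using P_mult_hom[OF z f, unfolded P_zero_mult] z by (intro P_arr_eqI[OF _ z]) (simp_all add: P_zero_def list_prod_cat_def)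
  show "f \<otimes>\<^sub>a idt (P_cat X) P_zero = idt (P_cat X) P_zero"
    using P_mult_hom[OF f z, unfolded P_zero_mult] z by (intro P_arr_eqI[OF _ z]) (simp_all add: P_zero_def list_prod_cat_def)
qed

text \<open>Wherever \<open>P_dist_r\<close> occurs it is replaced by an identity; the typing of the
  neighbouring arrow then cancels it, because the objects agree literally by
  \<open>P_mult_sum\<close> and strict associativity.\<close>

lemma P_tight_ring_category:
  "tight_ring_category (P_cat X) P_sum_o P_sum_a P_zero (P_braid X)
    (P_mult_o mu_o) (P_mult_a mu_o mu_a) (P_unit \<eta>) (P_dist_l X mu_o) (P_dist_r X mu_o)"
proof (intro tight_ring_category.intro ring_category.intro P_permutative P_mult_monoidal)
  let ?P = "P_cat X"
  have zero: "P_zero \<in> obj ?P" by (rule strict_monoidal_category.unit_obj[OF P_sum_monoidal])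
  show "ring_category_axioms ?P P_sum_o P_sum_a P_zero (P_braid X)
    (P_mult_o mu_o) (P_mult_a mu_o mu_a) (P_unit \<eta>) (P_dist_l X mu_o) (P_dist_r X mu_o)"
  proof (rule ring_category_axioms.intro)
    fix A B C assume A: "A \<in> obj ?P" and B: "B \<in> obj ?P" and C: "C \<in> obj ?P"
    note obj = A B C P_sum_obj P_mult_obj
    show "P_dist_l X mu_o A B C \<in> hom ?P (P_sum_o (A \<otimes> C) (B \<otimes> C)) (P_sum_o A B \<otimes> C)"
      unfolding P_dist_l_eq by (rule P_block_hom[OF P_block_map_dl[OF A B C]])
    show "P_dist_r X mu_o A B C \<in> hom ?P (P_sum_o (A \<otimes> B) (A \<otimes> C)) (A \<otimes> P_sum_o B C)"
      using P.idt_hom[of "A \<otimes> P_sum_o B C"] obj by (simp add: P_dist_r_eq P_mult_sum)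
    show "cmp ?P (P_braid X A B \<otimes>\<^sub>a idt ?P C) (P_dist_l X mu_o A B C) =
        cmp ?P (P_dist_l X mu_o B A C) (P_braid X (A \<otimes> C) (B \<otimes> C))"
      by (rule dl_symmetry[OF A B C])
    \<comment> \<open>This typing supplies the source and target at which the two identities are
      cancelled.\<close>
    have "P_braid X (A \<otimes> B) (A \<otimes> C) \<in> hom ?P (P_sum_o (A \<otimes> B) (A \<otimes> C)) (P_sum_o (A \<otimes> C) (A \<otimes> B))"
      unfolding P_braid_eq by (rule P_block_hom[OF P_block_map_braid]) (simp_all add: obj)
    then show "cmp ?P (idt ?P A \<otimes>\<^sub>a P_braid X B C) (P_dist_r X mu_o A B C) =
        cmp ?P (P_dist_r X mu_o A C B) (P_braid X (A \<otimes> B) (A \<otimes> C))"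
      by (simp add: dr_symmetry[OF A B C] P_dist_r_eq[OF B] P_dist_r_eq[OF C] P_mult_sum[OF B] P_mult_sum[OF C]
          P.cmp_idt_left P.cmp_idt_right)
  next
    fix f g h A A' B B' C C'
    assume f: "f \<in> hom ?P A A'" and g: "g \<in> hom ?P B B'" and h: "h \<in> hom ?P C C'"
    note F = P_homD[OF f] and G = P_homD[OF g] and H = P_homD[OF h]
    show "cmp ?P (P_dist_l X mu_o A' B' C') (P_sum_a (f \<otimes>\<^sub>a h) (g \<otimes>\<^sub>a h)) =
        cmp ?P (P_sum_a f g \<otimes>\<^sub>a h) (P_dist_l X mu_o A B C)"
      by (rule dl_natural[OF f g h])
    have "f \<otimes>\<^sub>a P_sum_a g h \<in> hom ?P (A \<otimes> P_sum_o B C) (A' \<otimes> P_sum_o B' C')"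
      by (intro P_mult_hom P_sum_hom f g h)
    then show "cmp ?P (P_dist_r X mu_o A' B' C') (P_sum_a (f \<otimes>\<^sub>a g) (f \<otimes>\<^sub>a h)) =
        cmp ?P (f \<otimes>\<^sub>a P_sum_a g h) (P_dist_r X mu_o A B C)"
      unfolding P_dist_r_eq[OF G(6)] P_dist_r_eq[OF G(7)] P_mult_arr_sum[OF f g h, symmetric]
      by (simp add: P.cmp_idt_left P.cmp_idt_right)
  next
    fix f assume "f \<in> arr ?P"
    then show "idt ?P P_zero \<otimes>\<^sub>a f = idt ?P P_zero" "f \<otimes>\<^sub>a idt ?P P_zero = idt ?P P_zero"
      by (rule zero_mult_arr)+
  next
    fix A B assume A: "A \<in> obj ?P" and B: "B \<in> obj ?P"
    show "P_dist_l X mu_o P_zero A B = idt ?P (A \<otimes> B)" "P_dist_l X mu_o A P_zero B = idt ?P (A \<otimes> B)"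
      "P_dist_l X mu_o A B P_zero = idt ?P P_zero"
      unfolding P_dist_l_eq P_block_idt P_zero_mult P_sum_o_zero
      by (rule P_block_cong; simp add: dl_ix_def rlex_def P_zero_def)+
    show "P_dist_r X mu_o P_zero A B = idt ?P P_zero" "P_dist_r X mu_o A P_zero B = idt ?P (A \<otimes> B)"
      "P_dist_r X mu_o A B P_zero = idt ?P (A \<otimes> B)"
      using zero A B by (simp_all add: P_dist_r_eq)
    show "P_dist_l X mu_o A B (P_unit \<eta>) = idt ?P (P_sum_o A B)"
      by (rule dl_unit[OF A B])
    show "P_dist_r X mu_o (P_unit \<eta>) A B = idt ?P (P_sum_o A B)"
      using strict_monoidal_category.tensor_o_unit_left[OF P_mult_monoidal P_sum_obj[OF A B]]
      by (simp add: P_dist_r_eq[OF A])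
  next
    fix A A' A'' B assume A: "A \<in> obj ?P" "A' \<in> obj ?P" "A'' \<in> obj ?P" "B \<in> obj ?P"
    show "cmp ?P (P_dist_l X mu_o (P_sum_o A A') A'' B) (P_sum_a (P_dist_l X mu_o A A' B) (idt ?P (A'' \<otimes> B))) =
      cmp ?P (P_dist_l X mu_o A (P_sum_o A' A'') B) (P_sum_a (idt ?P (A \<otimes> B)) (P_dist_l X mu_o A' A'' B))"
      by (rule dl_internal[OF A])
  next
    fix A B B' B'' assume A: "A \<in> obj ?P" "B \<in> obj ?P" "B' \<in> obj ?P" "B'' \<in> obj ?P"
    then show "cmp ?P (P_dist_r X mu_o A (P_sum_o B B') B'') (P_sum_a (P_dist_r X mu_o A B B') (idt ?P (A \<otimes> B''))) =
      cmp ?P (P_dist_r X mu_o A B (P_sum_o B' B'')) (P_sum_a (idt ?P (A \<otimes> B)) (P_dist_r X mu_o A B' B''))"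
      by (simp add: P_dist_r_eq P_sum_obj P_mult_obj P_sum_idt P_mult_sum)
  next
    fix A A' B C assume A: "A \<in> obj ?P" "A' \<in> obj ?P" "B \<in> obj ?P" "C \<in> obj ?P"
    show "P_dist_l X mu_o A A' (B \<otimes> C) =
      cmp ?P (P_dist_l X mu_o A A' B \<otimes>\<^sub>a idt ?P C) (P_dist_l X mu_o (A \<otimes> B) (A' \<otimes> B) C)"
      by (rule dl_external[OF A])
  next
    fix A B B' C assume A: "A \<in> obj ?P" "B \<in> obj ?P" "B' \<in> obj ?P" "C \<in> obj ?P"
    have dl: "P_dist_l X mu_o (A \<otimes> B) (A \<otimes> B') C \<in>
        hom ?P (P_sum_o ((A \<otimes> B) \<otimes> C) ((A \<otimes> B') \<otimes> C)) (P_sum_o (A \<otimes> B) (A \<otimes> B') \<otimes> C)"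
      unfolding P_dist_l_eq by (rule P_block_hom[OF P_block_map_dl]) (simp_all add: A P_mult_obj)
    have "P_dist_r X mu_o A B B' \<otimes>\<^sub>a idt ?P C = idt ?P (P_sum_o (A \<otimes> B) (A \<otimes> B') \<otimes> C)"
      using A by (simp add: P_dist_r_eq P_sum_obj P_mult_obj P_mult_idt P_mult_sum)
    moreover have "P_dist_r X mu_o A (B \<otimes> C) (B' \<otimes> C) = idt ?P (P_sum_o ((A \<otimes> B) \<otimes> C) ((A \<otimes> B') \<otimes> C))"
      using A by (simp add: P_dist_r_eq P_mult_obj P_mult_sum P_mult_assoc)
    ultimately show "cmp ?P (P_dist_r X mu_o A B B' \<otimes>\<^sub>a idt ?P C) (P_dist_l X mu_o (A \<otimes> B) (A \<otimes> B') C) =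
      cmp ?P (idt ?P A \<otimes>\<^sub>a P_dist_l X mu_o B B' C) (P_dist_r X mu_o A (B \<otimes> C) (B' \<otimes> C))"
      using P.cmp_idt_left[OF dl] P.cmp_idt_right[OF dl] by (simp add: dl_dr_external[OF A])
  next
    fix A B C C' assume A: "A \<in> obj ?P" "B \<in> obj ?P" "C \<in> obj ?P" "C' \<in> obj ?P"
    \<comment> \<open>All three morphisms of this axiom are shown to be the identity of one and the
      same object.\<close>
    have "P_dist_r X mu_o (A \<otimes> B) C C' = idt ?P (A \<otimes> (B \<otimes> P_sum_o C C'))"
      using A by (simp add: P_dist_r_eq P_mult_assoc P_sum_obj)
    moreover have "idt ?P A \<otimes>\<^sub>a P_dist_r X mu_o B C C' = idt ?P (A \<otimes> (B \<otimes> P_sum_o C C'))"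
      using A by (simp add: P_dist_r_eq P_mult_idt P_sum_obj P_mult_obj)
    moreover have "P_dist_r X mu_o A (B \<otimes> C) (B \<otimes> C') = idt ?P (A \<otimes> (B \<otimes> P_sum_o C C'))"
      using A by (simp add: P_dist_r_eq P_mult_obj P_mult_sum)
    moreover have "A \<otimes> (B \<otimes> P_sum_o C C') \<in> obj ?P"
      using A by (simp add: P_sum_obj P_mult_obj)
    ultimately show "P_dist_r X mu_o (A \<otimes> B) C C' =
        cmp ?P (idt ?P A \<otimes>\<^sub>a P_dist_r X mu_o B C C') (P_dist_r X mu_o A (B \<otimes> C) (B \<otimes> C'))"
      using P.cmp_idt_left[OF P.idt_hom] by simp
  next
    fix A A' B B' assume A: "A \<in> obj ?P" "A' \<in> obj ?P" "B \<in> obj ?P" "B' \<in> obj ?P"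
    have dl: "P_dist_l X mu_o A A' (P_sum_o B B') \<in>
        hom ?P (P_sum_o (A \<otimes> P_sum_o B B') (A' \<otimes> P_sum_o B B')) (P_sum_o A A' \<otimes> P_sum_o B B')"
      unfolding P_dist_l_eq by (rule P_block_hom[OF P_block_map_dl]) (simp_all add: A P_sum_obj)
    have "P_sum_a (P_dist_r X mu_o A B B') (P_dist_r X mu_o A' B B') =
        idt ?P (P_sum_o (A \<otimes> P_sum_o B B') (A' \<otimes> P_sum_o B B'))"
      using A by (simp add: P_dist_r_eq P_sum_idt P_sum_obj P_mult_obj)
    moreover have "P_dist_r X mu_o (P_sum_o A A') B B' = idt ?P (P_sum_o A A' \<otimes> P_sum_o B B')"
      using A by (simp add: P_dist_r_eq)
    ultimately show "cmp ?P (P_dist_l X mu_o A A' (P_sum_o B B')) (P_sum_a (P_dist_r X mu_o A B B') (P_dist_r X mu_o A' B B')) =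
      cmp ?P (P_dist_r X mu_o (P_sum_o A A') B B') (cmp ?P (P_sum_a (P_dist_l X mu_o A A' B) (P_dist_l X mu_o A A' B'))
        (P_sum_a (idt ?P (A \<otimes> B)) (P_sum_a (P_braid X (A \<otimes> B') (A' \<otimes> B)) (idt ?P (A' \<otimes> B')))))"
      using P.cmp_idt_left[OF dl] P.cmp_idt_right[OF dl] unfolding two_by_two[OF A, symmetric] by simp
  qed simp_all
  show "tight_ring_category_axioms ?P (P_dist_l X mu_o) (P_dist_r X mu_o)"
  proof (rule tight_ring_category_axioms.intro)
    fix A B C assume A: "A \<in> obj ?P" "B \<in> obj ?P" "C \<in> obj ?P"
    show "is_iso ?P (P_dist_l X mu_o A B C)"
      unfolding P_dist_l_eq by (rule P_block_iso[OF P_block_map_dl[OF A]])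
    show "is_iso ?P (P_dist_r X mu_o A B C)"
      \<comment> \<open>An identity is the block morphism of the identity permutation, so
        invertibility of block morphisms covers this case too.\<close>
      unfolding P_dist_r_eq[OF A(2)] P_block_idt
      by (rule P_block_iso[OF P_block_map_id]) (simp add: A P_sum_obj P_mult_obj)
  qed
qed

end

theorem corollary9p3:
  fixes X :: "('o, 'm) gamma_diagram"
    and mu_o :: "nat \<Rightarrow> nat \<Rightarrow> 'o \<Rightarrow> 'o \<Rightarrow> 'o"
    and mu_a :: "nat \<Rightarrow> nat \<Rightarrow> 'm \<Rightarrow> 'm \<Rightarrow> 'm"
    and \<eta> :: 'o
  assumes "gamma_monoid X mu_o mu_a \<eta>"
  shows "tight_ring_category (P_cat X)
    P_sum_o P_sum_a P_zero (P_braid X)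
    (P_mult_o mu_o) (P_mult_a mu_o mu_a) (P_unit \<eta>)
    (P_dist_l X mu_o) (P_dist_r X mu_o)"
  using assms by (rule gamma_monoid.P_tight_ring_category)

end
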